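(* Let $f_i:\Omega\times\mathbb{R}^m\times\mathbb{R}^{m\times d}\to\mathbb{R}$, $i\in I\cup\{0\}$, $I=\{1,\dots,\ell\}$, satisfy the codifferentiability conditions of order $p\in[1,+\infty]$, and let either $1<p\le+\infty$, or the set $\Omega$ be bounded and have the segment property. Let $u_0\in W^{1,p}(\Omega;\mathbb{R}^m)$ be fixed and suppose that $u_*$ is a locally optimal solution of the problem $$\min\ \mathcal{I}_0(u)=\int_\Omega f_0(x,u(x),\nabla u(x))\,dx\quad\text{subject to}\quad\mathcal{I}_i(u)=\int_\Omega f_i(x,u(x),\nabla u(x))\,dx\le0,\ i\in I,\quad u\in u_0+W^{1,p}_0(\Omega;\mathbb{R}^m).$$ Put $I(u_* )=\{i\in I\mid\mathcal{I}_i(u_* )=0\}$. Let $(0,w_{1i}(\cdot),w_{2i}(\cdot))$ be measurable selections of the multifunctions $\overline{d}_{u,\xi}f_i(\cdot,u_*(\cdot),\nabla u_*(\cdot))$, $i\in I$, such that there does not exist $\zeta\in L^{p'}(\Omega;\mathbb{R}^{m\times d};\operatorname{div})$ satisfying for a.e. $x\in\Omega$ the inclusion $$(0,\operatorname{div}(\zeta)(x),\zeta(x))\in\operatorname{co}\big\{\underline{d}_{u,\xi}f_i(x,u_*(x),\nabla u_*(x))+(0,w_{1i}(x),w_{2i}(x))\bigm|i\in I(u_* )\big\}.$$ Then for any measurable selection $(0,w_{10}(\cdot),w_{20}(\cdot))$ of the set-valued map $\overline{d}_{u,\xi}f_0(\cdot,u_*(\cdot),\nabla u_*(\cdot))$ one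 can find $\lambda_i\ge0$, $i\in I$, and $\zeta\in L^{p'}(\Omega;\mathbb{R}^{m\times d};\operatorname{div})$ such that $\lambda_i\mathcal{I}_i(u_* )=0$ for any $i\in I$, and for a.e. $x\in\Omega$ \begin{multline*} (0,\operatorname{div}(\zeta)(x),\zeta(x))\in\underline{d}_{u,\xi}f_0(x,u_*(x),\nabla u_*(x))+(0,w_{10}(x),w_{20}(x))\\+\sum_{i=1}^{\ell}\lambda_i\Big(\underline{d}_{u,\xi}f_i(x,u_*(x),\nabla u_*(x))+(0,w_{1i}(x),w_{2i}(x))\Big). \end{multline*}
   Context: **Codifferentials.** Let $X$ be a real Banach space, $X^*$ its dual, $U\subseteq X$ open. A function $F:U\to\mathbb{R}$ is codifferentiable at $x\in U$ if there is a pair $DF(x)=[\underline{d}F(x),\overline{d}F(x)]$ (a codifferential) of convex subsets of $\mathbb{R}\times X^*$, compact in the product of the standard topology and the weak$^*$ topology, such that $\Phi_F(x,0)=\Psi_F(x,0)=0$ and for all $\Delta x\in X$ $$\lim_{\alpha\to+0}\frac1\alpha\big|F(x+\alpha\Delta x)-F(x)-\Phi_F(x,\alpha\Delta x)-\Psi_F(x,\alpha\Delta x)\big|=0,$$ where $\Phi_F(x,\Delta x)=\max_{(a,x^* )\in\underline{d}F(x)}(a+\langle x^*,\Delta x\rangle)$ and $\Psi_F(x,\Delta x)=\min_{(b,y^* )\in\overline{d}F(x)}(b+\langle y^*,\Delta x\rangle)$. Codifferentials are not unique. **Setting.** $\Omega\subseteq\mathbb{R}^d$ is an open set (not necessarily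 bounded). $W^{1,p}(\Omega;\mathbb{R}^m)$, $1\le p\le+\infty$, is the Sobolev space with norm $\|u\|_{1,p}=(\|u\|_p^p+\|\nabla u\|_p^p)^{1/p}$ for $p<+\infty$, $\|u\|_{1,\infty}=\max\{\|u\|_\infty,\|\nabla u\|_\infty\}$; $W^{1,p}_0(\Omega;\mathbb{R}^m)$ is the closure of $C^\infty_c(\Omega;\mathbb{R}^m)$ in it; $1/p+1/p'=1$; $|\cdot|$ is the Euclidean norm. Local optimality is understood with respect to the norm of $W^{1,p}(\Omega;\mathbb{R}^m)$. $\operatorname{co}$ of a family of sets is the convex hull of their union ($\operatorname{co}\emptyset=\emptyset$). Let $f=f(x,u,\xi)$ be any one of the functions $f_i$. For a.e. $x\in\Omega$ the function $(u,\xi)\mapsto f(x,u,\xi)$ is assumed codifferentiable at every point of $\mathbb{R}^m\times\mathbb{R}^{m\times d}$; $[\underline{d}_{u,\xi}f(x,u,\xi),\overline{d}_{u,\xi}f(x,u,\xi)]$ denotes a fixed choice of its codifferential, consisting of convex compact subsets of $\mathbb{R}\times\mathbb{R}^m\times\mathbb{R}^{m\times d}$. A (set-valued or single-valued) map $F(x,y)$ is a Carathéodory map if it is measurable in $x$ for every $y$ and continuous in $y$ for (a.e.) every $x$ (for compact-valued maps into $\mathbb{R}^k$: Hausdorff continuous). A measurable selection of a multifunction $G$ on $\Omega$ is a measurable $z$ with $z(x)\in G(x)$ for a.e. $x$. **Codifferentiability conditions of order $p$.** $f$ satisfies them if: (1) $f$ is a Carathéodory function, and: if $1\le p<+\infty$,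 there are an a.e. nonnegative $\beta\in L^1(\Omega)$ and $C>0$ with $|f(x,u,\xi)|\le\beta(x)+C(|u|^p+|\xi|^p)$ for a.e. $x$ and all $(u,\xi)$; if $p=+\infty$, for any $N>0$ there is an a.e. nonnegative $\beta_N\in L^1(\Omega)$ with $|f(x,u,\xi)|\le\beta_N(x)$ for a.e. $x$ and all $(u,\xi)$ with $\max\{|u|,|\xi|\}\le N$; (2) for a.e. $x$ the function $(u,\xi)\mapsto f(x,u,\xi)$ is codifferentiable on $\mathbb{R}^m\times\mathbb{R}^{m\times d}$, both $\underline{d}_{u,\xi}f$ and $\overline{d}_{u,\xi}f$ are Carathéodory maps, and: if $1\le p<+\infty$, there are $C>0$ and a.e. nonnegative $\beta\in L^1(\Omega)$, $\gamma\in L^{p'}(\Omega)$ such that for a.e. $x$, all $(u,\xi)$, all $(a,v_1,v_2)\in\underline{d}_{u,\xi}f(x,u,\xi)$ and $(b,w_1,w_2)\in\overline{d}_{u,\xi}f(x,u,\xi)$: $\max\{|a|,|b|\}\le\beta(x)+C(|u|^p+|\xi|^p)$ and $\max\{|v_1|,|v_2|,|w_1|,|w_2|\}\le\gamma(x)+C(|u|^{p-1}+|\xi|^{p-1})$; if $p=+\infty$, for any $N>0$ there is an a.e. nonnegative $\beta_N\in L^1(\Omega)$ such that $\max\{|a|,|v_1|,|v_2|,|b|,|w_1|,|w_2|\}\le\beta_N(x)$ for a.e. $x$, for all such triples and all $(u,\xi)$ with $\max\{|u|,|\xi|\}\le N$. **Segment property.** $\Omega$ has the segment property if for every $x\in\partial\Omega$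 there are a neighbourhood $U_x\subset\mathbb{R}^d$ of $x$ and a nonzero $y_x\in\mathbb{R}^d$ such that for any $z\in\operatorname{cl}\Omega\cap U_x$ one has $z+ty_x\in\Omega$ for all $t\in(0,1)$. **Weak divergence.** $v\in L^1_{loc}(\Omega)$ is the weak divergence of $u\in L^1_{loc}(\Omega;\mathbb{R}^d)$, $v=\operatorname{div}u$, if $\int_\Omega v\varphi\,dx=-\int_\Omega\langle u,\nabla\varphi\rangle dx$ for all $\varphi\in C_c^\infty(\Omega)$. $L^{q}(\Omega;\mathbb{R}^{m\times d};\operatorname{div})$ is the space of all $u\in L^q(\Omega;\mathbb{R}^{m\times d})$ for which the row-wise weak divergence $\operatorname{div}u=(\operatorname{div}(u_{11},\dots,u_{1d}),\dots,\operatorname{div}(u_{m1},\dots,u_{md}))$ exists and belongs to $L^q(\Omega;\mathbb{R}^m)$. *)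

theory Defs
  imports "HOL-Analysis.Analysis" "HOL-Probability.Essential_Supremum"
begin

text \<open>
  The dual of the Euclidean space is identified with the space itself through the inner product;
  the weak* topology is then the norm topology. Nonemptiness of both sets is implicit in the
  existence of the maximum and the minimum, which for compact sets are the \<open>SUP\<close> and \<open>INF\<close> below.
\<close>

definition hypo_max :: "(real \<times> 'a::euclidean_space) set \<Rightarrow> 'a \<Rightarrow> real" where
  "hypo_max A h = (SUP (a, v)\<in>A. a + v \<bullet> h)"

definition hyper_min :: "(real \<times> 'a::euclidean_space) set \<Rightarrow> 'a \<Rightarrow> real" where
  "hyper_min B h = (INF (b, w)\<in>B. b + w \<bullet> h)"

definition is_codifferential ::
  "('a::euclidean_space \<Rightarrow> real) \<Rightarrow> 'a \<Rightarrow> (real \<times> 'a) set \<Rightarrow> (real \<times> 'a) set \<Rightarrow> bool" where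
  "is_codifferential F y A B \<longleftrightarrow>
     A \<noteq> {} \<and> convex A \<and> compact A \<and> B \<noteq> {} \<and> convex B \<and> compact B \<and>
     hypo_max A 0 = 0 \<and> hyper_min B 0 = 0 \<and>
     (\<forall>h. ((\<lambda>\<alpha>. (1 / \<alpha>) *
         \<bar>F (y + \<alpha> *\<^sub>R h) - F y - hypo_max A (\<alpha> *\<^sub>R h) - hyper_min B (\<alpha> *\<^sub>R h)\<bar>) \<longlongrightarrow> 0)
       (at_right 0))"

definition caratheodory ::
  "'a::euclidean_space set \<Rightarrow> ('a \<Rightarrow> 'b::topological_space \<Rightarrow> real) \<Rightarrow> bool" where
  "caratheodory \<Omega> f \<longleftrightarrow>
     (\<forall>y. (\<lambda>x. f x y) \<in> borel_measurable (lebesgue_on \<Omega>)) \<and>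
     (AE x in lebesgue_on \<Omega>. continuous_on UNIV (f x))"

text \<open>Meaningful for nonempty bounded sets only; it is applied to nonempty compact ones.\<close>

definition hausdorff_dist :: "'a::metric_space set \<Rightarrow> 'a set \<Rightarrow> real" where
  "hausdorff_dist A B = max (SUP a\<in>A. infdist a B) (SUP b\<in>B. infdist b A)"

definition measurable_multi ::
  "'a::euclidean_space set \<Rightarrow> ('a \<Rightarrow> 'c::topological_space set) \<Rightarrow> bool" where
  "measurable_multi \<Omega> G \<longleftrightarrow>
     (\<forall>V. open V \<longrightarrow> {x\<in>\<Omega>. G x \<inter> V \<noteq> {}} \<in> sets (lebesgue_on \<Omega>))"

definition caratheodory_multi ::
  "'a::euclidean_space set \<Rightarrow> ('a \<Rightarrow> 'b::topological_space \<Rightarrow> 'c::metric_space set) \<Rightarrow> bool" where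
  "caratheodory_multi \<Omega> G \<longleftrightarrow>
     (\<forall>y. measurable_multi \<Omega> (\<lambda>x. G x y)) \<and>
     (AE x in lebesgue_on \<Omega>. \<forall>y. ((\<lambda>y'. hausdorff_dist (G x y') (G x y)) \<longlongrightarrow> 0) (at y))"

definition measurable_selection ::
  "'a::euclidean_space set \<Rightarrow> ('a \<Rightarrow> 'c::topological_space set) \<Rightarrow> ('a \<Rightarrow> 'c) \<Rightarrow> bool" where
  "measurable_selection \<Omega> G z \<longleftrightarrow>
     z \<in> borel_measurable (lebesgue_on \<Omega>) \<and> (AE x in lebesgue_on \<Omega>. z x \<in> G x)"

text \<open>
  Elements of function spaces are total functions, of which only the restriction to \<open>\<Omega>\<close> up to
  null sets matters. Exponents range over \<open>[1, \<infinity>]\<close>.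
\<close>

definition Lp_space ::
  "ennreal \<Rightarrow> 'a::euclidean_space set \<Rightarrow> ('a \<Rightarrow> 'b::euclidean_space) set" where
  "Lp_space p \<Omega> = {u. u \<in> borel_measurable (lebesgue_on \<Omega>) \<and>
     (if p = \<infinity> then esssup (lebesgue_on \<Omega>) (\<lambda>x. ereal (norm (u x))) < \<infinity>
      else integrable (lebesgue_on \<Omega>) (\<lambda>x. norm (u x) powr enn2real p))}"

definition Lp_norm ::
  "ennreal \<Rightarrow> 'a::euclidean_space set \<Rightarrow> ('a \<Rightarrow> 'b::euclidean_space) \<Rightarrow> real" where
  "Lp_norm p \<Omega> u =
     (if p = \<infinity> then real_of_ereal (esssup (lebesgue_on \<Omega>) (\<lambda>x. ereal (norm (u x))))
      else (LINT x|lebesgue_on \<Omega>. norm (u x) powr enn2real p) powr (1 / enn2real p))"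

definition conj_exp :: "ennreal \<Rightarrow> ennreal" where
  "conj_exp p = (if p = 1 then \<infinity> else if p = \<infinity> then 1
     else ennreal (enn2real p / (enn2real p - 1)))"

lemma conj_exp: "1 / p + 1 / conj_exp p = 1" if "1 \<le> p"
proof (cases p)
  case (real r)
  with that have r: "1 \<le> r"
    by (simp add: ennreal_1[symmetric] del: ennreal_1)
  show ?thesis
  proof (cases "r = 1")
    case True
    then show ?thesis using real by (simp add: conj_exp_def)
  next
    case False
    with r have r: "1 < r" by simp
    have "p \<noteq> 1" using real r by (simp add: ennreal_eq_1)
    then have "conj_exp p = ennreal (r / (r - 1))"
      using real r by (simp add: conj_exp_def)
    then have "1 / p + 1 / conj_exp p = ennreal (1 / r) + ennreal (1 / (r / (r - 1)))"
      using real r by (simp add: divide_ennreal flip: ennreal_1)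
    also have "\<dots> = ennreal (1 / r + (r - 1) / r)"
      using r by (simp flip: ennreal_plus)
    also have "1 / r + (r - 1) / r = 1"
      using r by (simp add: field_simps)
    finally show ?thesis by simp
  qed
next
  case top
  then show ?thesis by (simp add: conj_exp_def)
qed

definition locally_integrable ::
  "'a::euclidean_space set \<Rightarrow> ('a \<Rightarrow> 'b::euclidean_space) \<Rightarrow> bool" where
  "locally_integrable \<Omega> u \<longleftrightarrow>
     (\<forall>K. compact K \<and> K \<subseteq> \<Omega> \<longrightarrow> integrable (lebesgue_on K) u)"

definition dir_deriv ::
  "'a::euclidean_space \<Rightarrow> ('a \<Rightarrow> 'b::euclidean_space) \<Rightarrow> 'a \<Rightarrow> 'b" where
  "dir_deriv b g = (\<lambda>x. frechet_derivative g (at x) b)"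

text \<open>\<open>C\<^sup>\<infinity>\<close>: all iterated partial derivatives exist and are (totally) differentiable.\<close>

definition smooth :: "('a::euclidean_space \<Rightarrow> 'b::euclidean_space) \<Rightarrow> bool" where
  "smooth g \<longleftrightarrow> (\<forall>bs. set bs \<subseteq> Basis \<longrightarrow> (\<forall>x. foldr dir_deriv bs g differentiable (at x)))"

definition test_functions ::
  "'a::euclidean_space set \<Rightarrow> ('a \<Rightarrow> 'b::euclidean_space) set" where
  "test_functions \<Omega> =
     {\<phi>. smooth \<phi> \<and> compact (closure {x. \<phi> x \<noteq> 0}) \<and> closure {x. \<phi> x \<noteq> 0} \<subseteq> \<Omega>}"

definition grad :: "(real^'d \<Rightarrow> real) \<Rightarrow> real^'d \<Rightarrow> real^'d" where
  "grad \<phi> x = (\<chi> j. dir_deriv (axis j 1) \<phi> x)"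

text \<open>
  A matrix in \<open>\<real>\<^bsup>m\<times>d\<^esup>\<close> is an element of \<^typ>\<open>real^'d^'m\<close>, so that \<open>G x $ i $ j\<close> is the derivative
  of the \<open>i\<close>-th component in the \<open>j\<close>-th direction; the norm is the Euclidean (Frobenius) one.
  Weak gradient and weak divergence are unique up to null sets; \<open>weak_grad\<close> and \<open>weak_div\<close>
  pick a representative.
\<close>

definition has_weak_grad ::
  "(real^'d) set \<Rightarrow> (real^'d \<Rightarrow> real^'m) \<Rightarrow> (real^'d \<Rightarrow> real^'d^'m) \<Rightarrow> bool" where
  "has_weak_grad \<Omega> u G \<longleftrightarrow> locally_integrable \<Omega> u \<and> locally_integrable \<Omega> G \<and>
     (\<forall>\<phi>\<in>test_functions \<Omega>. \<forall>i j.
        (LINT x|lebesgue_on \<Omega>. u x $ i * grad \<phi> x $ j)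
        = - (LINT x|lebesgue_on \<Omega>. G x $ i $ j * \<phi> x))"

definition weak_grad ::
  "(real^'d) set \<Rightarrow> (real^'d \<Rightarrow> real^'m) \<Rightarrow> real^'d \<Rightarrow> real^'d^'m" where
  "weak_grad \<Omega> u = (SOME G. has_weak_grad \<Omega> u G)"

definition has_weak_div ::
  "(real^'d) set \<Rightarrow> (real^'d \<Rightarrow> real^'d) \<Rightarrow> (real^'d \<Rightarrow> real) \<Rightarrow> bool" where
  "has_weak_div \<Omega> u v \<longleftrightarrow> locally_integrable \<Omega> u \<and> locally_integrable \<Omega> v \<and>
     (\<forall>\<phi>\<in>test_functions \<Omega>.
        (LINT x|lebesgue_on \<Omega>. v x * \<phi> x) = - (LINT x|lebesgue_on \<Omega>. u x \<bullet> grad \<phi> x))"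

definition has_row_weak_div ::
  "(real^'d) set \<Rightarrow> (real^'d \<Rightarrow> real^'d^'m) \<Rightarrow> (real^'d \<Rightarrow> real^'m) \<Rightarrow> bool" where
  "has_row_weak_div \<Omega> \<zeta> v \<longleftrightarrow> (\<forall>i. has_weak_div \<Omega> (\<lambda>x. \<zeta> x $ i) (\<lambda>x. v x $ i))"

definition weak_div ::
  "(real^'d) set \<Rightarrow> (real^'d \<Rightarrow> real^'d^'m) \<Rightarrow> real^'d \<Rightarrow> real^'m" where
  "weak_div \<Omega> \<zeta> = (SOME v. has_row_weak_div \<Omega> \<zeta> v)"

definition Lp_div_space ::
  "ennreal \<Rightarrow> (real^'d) set \<Rightarrow> (real^'d \<Rightarrow> real^'d^'m) set" where
  "Lp_div_space q \<Omega> =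
     {\<zeta>\<in>Lp_space q \<Omega>. (\<exists>v. has_row_weak_div \<Omega> \<zeta> v) \<and> weak_div \<Omega> \<zeta> \<in> Lp_space q \<Omega>}"

definition sobolev :: "ennreal \<Rightarrow> (real^'d) set \<Rightarrow> (real^'d \<Rightarrow> real^'m) set" where
  "sobolev p \<Omega> =
     {u\<in>Lp_space p \<Omega>. (\<exists>G. has_weak_grad \<Omega> u G) \<and> weak_grad \<Omega> u \<in> Lp_space p \<Omega>}"

definition sobolev_norm :: "ennreal \<Rightarrow> (real^'d) set \<Rightarrow> (real^'d \<Rightarrow> real^'m) \<Rightarrow> real" where
  "sobolev_norm p \<Omega> u =
     (if p = \<infinity> then max (Lp_norm p \<Omega> u) (Lp_norm p \<Omega> (weak_grad \<Omega> u))
      else (Lp_norm p \<Omega> u powr enn2real p + Lp_norm p \<Omega> (weak_grad \<Omega> u) powr enn2real p)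
        powr (1 / enn2real p))"

definition sobolev0 :: "ennreal \<Rightarrow> (real^'d) set \<Rightarrow> (real^'d \<Rightarrow> real^'m) set" where
  "sobolev0 p \<Omega> = {u\<in>sobolev p \<Omega>.
     \<forall>\<epsilon>>0. \<exists>\<phi>\<in>test_functions \<Omega>. sobolev_norm p \<Omega> (\<lambda>x. u x - \<phi> x) < \<epsilon>}"

text \<open>The factor \<open>t\<^bsup>p-1\<^esup>\<close> is constantly \<open>1\<close> for \<open>p = 1\<close>, whereas \<open>0 powr 0 = 0\<close>.\<close>

definition rpow :: "real \<Rightarrow> real \<Rightarrow> real" where
  "rpow t s = (if s = 0 then 1 else t powr s)"

definition growth_condition ::
  "ennreal \<Rightarrow> 'x::euclidean_space set \<Rightarrow>
   ('x \<Rightarrow> 'u::euclidean_space \<times> 'v::euclidean_space \<Rightarrow> real) \<Rightarrow> bool" where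
  "growth_condition p \<Omega> f \<longleftrightarrow>
     (if p = \<infinity> then
        (\<forall>N>0. \<exists>\<beta>\<in>Lp_space 1 \<Omega>. (AE x in lebesgue_on \<Omega>. (0::real) \<le> \<beta> x) \<and>
          (AE x in lebesgue_on \<Omega>. \<forall>u \<xi>. max (norm u) (norm \<xi>) \<le> N \<longrightarrow> \<bar>f x (u, \<xi>)\<bar> \<le> \<beta> x))
      else
        (\<exists>\<beta>\<in>Lp_space 1 \<Omega>. \<exists>C>0. (AE x in lebesgue_on \<Omega>. (0::real) \<le> \<beta> x) \<and>
          (AE x in lebesgue_on \<Omega>. \<forall>u \<xi>.
             \<bar>f x (u, \<xi>)\<bar> \<le> \<beta> x + C * (norm u powr enn2real p + norm \<xi> powr enn2real p))))"

definition codiff_growth_condition ::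
  "ennreal \<Rightarrow> 'x::euclidean_space set \<Rightarrow>
   ('x \<Rightarrow> 'u::euclidean_space \<times> 'v::euclidean_space \<Rightarrow> (real \<times> 'u \<times> 'v) set) \<Rightarrow>
   ('x \<Rightarrow> 'u \<times> 'v \<Rightarrow> (real \<times> 'u \<times> 'v) set) \<Rightarrow> bool" where
  "codiff_growth_condition p \<Omega> dl du \<longleftrightarrow>
     (if p = \<infinity> then
        (\<forall>N>0. \<exists>\<beta>\<in>Lp_space 1 \<Omega>. (AE x in lebesgue_on \<Omega>. (0::real) \<le> \<beta> x) \<and>
          (AE x in lebesgue_on \<Omega>. \<forall>u \<xi>. max (norm u) (norm \<xi>) \<le> N \<longrightarrow>
             (\<forall>(a, v1, v2)\<in>dl x (u, \<xi>). \<forall>(b, w1, w2)\<in>du x (u, \<xi>).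
                Max {\<bar>a\<bar>, norm v1, norm v2, \<bar>b\<bar>, norm w1, norm w2} \<le> \<beta> x)))
      else
        (\<exists>C>0. \<exists>\<beta>\<in>Lp_space 1 \<Omega>. \<exists>\<gamma>\<in>Lp_space (conj_exp p) \<Omega>.
          (AE x in lebesgue_on \<Omega>. (0::real) \<le> \<beta> x) \<and>
          (AE x in lebesgue_on \<Omega>. (0::real) \<le> \<gamma> x) \<and>
          (AE x in lebesgue_on \<Omega>. \<forall>u \<xi>.
             \<forall>(a, v1, v2)\<in>dl x (u, \<xi>). \<forall>(b, w1, w2)\<in>du x (u, \<xi>).
                max \<bar>a\<bar> \<bar>b\<bar> \<le> \<beta> x + C * (norm u powr enn2real p + norm \<xi> powr enn2real p) \<and>
                Max {norm v1, norm v2, norm w1, norm w2}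
                  \<le> \<gamma> x + C * (rpow (norm u) (enn2real p - 1) + rpow (norm \<xi>) (enn2real p - 1)))))"

text \<open>\<open>dl\<close> and \<open>du\<close> are the fixed choices of the lower and upper components of the codifferential.\<close>

definition codiff_conditions ::
  "ennreal \<Rightarrow> 'x::euclidean_space set \<Rightarrow>
   ('x \<Rightarrow> 'u::euclidean_space \<times> 'v::euclidean_space \<Rightarrow> real) \<Rightarrow>
   ('x \<Rightarrow> 'u \<times> 'v \<Rightarrow> (real \<times> 'u \<times> 'v) set) \<Rightarrow>
   ('x \<Rightarrow> 'u \<times> 'v \<Rightarrow> (real \<times> 'u \<times> 'v) set) \<Rightarrow> bool" where
  "codiff_conditions p \<Omega> f dl du \<longleftrightarrow>
     caratheodory \<Omega> f \<and> growth_condition p \<Omega> f \<and>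
     (AE x in lebesgue_on \<Omega>. \<forall>y. is_codifferential (f x) y (dl x y) (du x y)) \<and>
     caratheodory_multi \<Omega> dl \<and> caratheodory_multi \<Omega> du \<and>
     codiff_growth_condition p \<Omega> dl du"

definition segment_property :: "'a::euclidean_space set \<Rightarrow> bool" where
  "segment_property \<Omega> \<longleftrightarrow>
     (\<forall>x\<in>frontier \<Omega>. \<exists>U y. open U \<and> x \<in> U \<and> y \<noteq> 0 \<and>
        (\<forall>z\<in>closure \<Omega> \<inter> U. \<forall>t\<in>{0<..<1}. z + t *\<^sub>R y \<in> \<Omega>))"

definition functional ::
  "(real^'d) set \<Rightarrow> (real^'d \<Rightarrow> (real^'m) \<times> (real^'d^'m) \<Rightarrow> real) \<Rightarrow>
   (real^'d \<Rightarrow> real^'m) \<Rightarrow> real" where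
  "functional \<Omega> f u = (LINT x|lebesgue_on \<Omega>. f x (u x, weak_grad \<Omega> u x))"

definition feasible ::
  "ennreal \<Rightarrow> (real^'d) set \<Rightarrow> (nat \<Rightarrow> real^'d \<Rightarrow> (real^'m) \<times> (real^'d^'m) \<Rightarrow> real) \<Rightarrow> nat \<Rightarrow>
   (real^'d \<Rightarrow> real^'m) \<Rightarrow> (real^'d \<Rightarrow> real^'m) set" where
  "feasible p \<Omega> f l u0 =
     {u. (\<lambda>x. u x - u0 x) \<in> sobolev0 p \<Omega> \<and> (\<forall>i\<in>{1..l}. functional \<Omega> (f i) u \<le> 0)}"

definition locally_optimal ::
  "ennreal \<Rightarrow> (real^'d) set \<Rightarrow> (nat \<Rightarrow> real^'d \<Rightarrow> (real^'m) \<times> (real^'d^'m) \<Rightarrow> real) \<Rightarrow> nat \<Rightarrow>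
   (real^'d \<Rightarrow> real^'m) \<Rightarrow> (real^'d \<Rightarrow> real^'m) \<Rightarrow> bool" where
  "locally_optimal p \<Omega> f l u0 us \<longleftrightarrow>
     us \<in> feasible p \<Omega> f l u0 \<and>
     (\<exists>r>0. \<forall>u\<in>feasible p \<Omega> f l u0.
        sobolev_norm p \<Omega> (\<lambda>x. u x - us x) < r \<longrightarrow> functional \<Omega> (f 0) us \<le> functional \<Omega> (f 0) u)"

end

(*
  Only the quasidifferential information at u_* is needed. Along a test function h the integrand
  has an upper directional derivative at most sigma(S_i(x); (h, grad h)), the support function of
  S_i(x) = {v | (0, v) in d_i(x)} + w_i(x), and the bounds on the codifferential make f Lipschitz
  along segments (a continuous function with bounded right increments), so dominated convergence
  passes this to the integral functionals. Optimality then excludes a test function h for which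
  the sublinear integrals P_i(h) are negative for i = 0 and all active constraints, and separation
  yields multipliers with sum_i lambda_i P_i >= 0 on test functions.

  By Hahn-Banach there is a linear functional below the integral of the support function of
  sum_i lambda_i S_i(x) that vanishes on all jets (h, grad h); by Radon-Nikodym it is given by a
  measurable v, and testing it against a dense set of directions shows v(x) in
  sum_i lambda_i S_i(x) almost everywhere. No measurable selection theorem is used. Vanishing on
  the jets says that the first component of v is the weak divergence of the second.
*)

theory Submission
  imports Defs
begin

section \<open>Smooth functions\<close>

text \<open>Directional derivatives see only height zero:
  \<open>hypo_max A (\<alpha> *\<^sub>R h) / \<alpha>\<close> maximises
  \<open>a / \<alpha> + v \<bullet> h\<close> with \<open>a \<le> 0\<close>, so negative heights
  drop out as \<alpha> tends to 0. Fixing \<open>(0, w)\<close> in the upper part replaces a minimum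
  by a value that is at least as large, which is the direction that optimality tolerates.

  The obstacle is duality: for \<open>p = \<infinity>\<close> the dual of the Lebesgue space is not
  a function space. So the functionals live on the weighted space of all \<open>\<eta>\<close> with
  \<open>\<rho> * norm \<eta>\<close> integrable, where \<open>\<rho>\<close> in L^{p'} bounds all
  the sets S_i. It contains the jets of test functions, and functionals dominated by
  \<open>\<rho>\<close> have densities dominated by \<open>\<rho>\<close>, for every exponent; this
  places \<open>\<zeta>\<close> and its divergence in L^{p'}.

  The multipliers come normalised to sum 1, and that of the objective may vanish a priori. The
  density would then yield a field that the assumption on the active constraints excludes; so one
  may divide by this multiplier.\<close>

lemma smooth_coinduct:
  assumes "g \<in> S"
    and "\<And>g x. g \<in> S \<Longrightarrow> g differentiable (at x)"
    and "\<And>g b. g \<in> S \<Longrightarrow> b \<in> Basis \<Longrightarrow> dir_deriv b g \<in> S"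
  shows "smooth g"
proof -
  have "foldr dir_deriv bs g \<in> S" if "set bs \<subseteq> Basis" for bs
    using that by (induction bs) (auto simp: assms)
  then show ?thesis unfolding smooth_def using assms(2) by blast
qed

lemma smooth_differentiable: "smooth g \<Longrightarrow> g differentiable (at x)"
  unfolding smooth_def by (drule spec[of _ "[]"]) auto

lemma smooth_dir_deriv: "smooth (dir_deriv b g)" if "smooth g" "b \<in> Basis"
  unfolding smooth_def
proof (intro allI impI)
  fix bs x assume "set bs \<subseteq> (Basis :: 'a set)"
  then show "foldr dir_deriv bs (dir_deriv b g) differentiable (at x)"
    \<comment> \<open>\<open>foldr\<close> applies the last entry of the list first, so the
      derivatives of \<open>dir_deriv b g\<close> along \<open>bs\<close> are those of
      \<open>g\<close> along \<open>bs @ [b]\<close>.\<close>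
    using that unfolding smooth_def by (auto dest!: spec[of _ "bs @ [b]"])
qed

lemma smooth_continuous_on: "smooth g \<Longrightarrow> continuous_on S g"
  by (meson smooth_differentiable differentiable_imp_continuous_within continuous_at_imp_continuous_on)

lemma smooth_has_derivative: "smooth g \<Longrightarrow> (g has_derivative (\<lambda>b. dir_deriv b g x)) (at x)"
  unfolding dir_deriv_def using frechet_derivative_works smooth_differentiable by fastforce

lemma dir_deriv_eqI: "(\<And>x. (g has_derivative g' x) (at x)) \<Longrightarrow> dir_deriv b g = (\<lambda>x. g' x b)"
  unfolding dir_deriv_def by (metis frechet_derivative_at)

text \<open>A bounded linear map commutes with differentiation, so the compositions of
  \<open>T\<close> with smooth functions form a class stable under partial derivatives.\<close>

lemma smooth_bounded_linear:
  assumes "bounded_linear T" "smooth g" shows "smooth (\<lambda>x. T (g x))"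
proof -
  have D: "((\<lambda>x. T (g x)) has_derivative (\<lambda>b. T (dir_deriv b g x))) (at x)" if "smooth g" for g x
    using bounded_linear.has_derivative[OF assms(1) smooth_has_derivative[OF that]] .
  show ?thesis
    by (rule smooth_coinduct[where S = "{\<lambda>x. T (g x) | g. smooth g}"])
       (use assms D smooth_dir_deriv in \<open>auto simp: differentiable_def dir_deriv_eqI[OF D]\<close>, blast)
qed

lemma smooth_add:
  assumes "smooth g" "smooth h" shows "smooth (\<lambda>x. g x + h x)"
proof -
  have D: "((\<lambda>x. g x + h x) has_derivative (\<lambda>b. dir_deriv b g x + dir_deriv b h x)) (at x)"
    if "smooth g" "smooth h" for g h x
    using that by (intro has_derivative_add smooth_has_derivative)
  show ?thesis
    by (rule smooth_coinduct[where S = "{\<lambda>x. g x + h x | g h. smooth g \<and> smooth h}"])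
       (use assms D smooth_dir_deriv in \<open>auto simp: differentiable_def dir_deriv_eqI[OF D]\<close>, blast+)
qed

text \<open>By the product rule, the algebra generated by a class of functions is stable under partial derivatives if the derivatives of the generators lie in it.\<close>

inductive_set smooth_algebra :: "('a::euclidean_space \<Rightarrow> real) set \<Rightarrow> ('a \<Rightarrow> real) set" for S where
  base: "g \<in> S \<Longrightarrow> g \<in> smooth_algebra S"
| add: "g \<in> smooth_algebra S \<Longrightarrow> h \<in> smooth_algebra S \<Longrightarrow> (\<lambda>x. g x + h x) \<in> smooth_algebra S"
| mult: "g \<in> smooth_algebra S \<Longrightarrow> h \<in> smooth_algebra S \<Longrightarrow> (\<lambda>x. g x * h x) \<in> smooth_algebra S"

lemma smooth_algebra_smooth:
  assumes "g \<in> smooth_algebra S"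
    and base: "\<And>g x. g \<in> S \<Longrightarrow> g differentiable (at x)"
      "\<And>g b. g \<in> S \<Longrightarrow> b \<in> Basis \<Longrightarrow> dir_deriv b g \<in> smooth_algebra S"
  shows "smooth g"
proof -
  have "(\<forall>x. g differentiable (at x)) \<and> (\<forall>b\<in>Basis. dir_deriv b g \<in> smooth_algebra S)"
    if "g \<in> smooth_algebra S" for g
    using that
  proof induction
    case (base g)
    then show ?case using assms(2,3) by blast
  next
    case (add g h)
    then have D: "((\<lambda>x. g x + h x) has_derivative (\<lambda>b. dir_deriv b g x + dir_deriv b h x)) (at x)" for x
      unfolding dir_deriv_def by (intro has_derivative_add) (auto simp: frechet_derivative_works[symmetric])
    show ?case using D add by (auto simp: dir_deriv_eqI[OF D] differentiable_def intro: smooth_algebra.intros)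
  next
    case (mult g h)
    then have D: "((\<lambda>x. g x * h x) has_derivative (\<lambda>b. g x * dir_deriv b h x + dir_deriv b g x * h x)) (at x)" for x
      unfolding dir_deriv_def by (intro has_derivative_mult) (auto simp: frechet_derivative_works[symmetric])
    show ?case using D mult by (auto simp: dir_deriv_eqI[OF D] differentiable_def intro!: smooth_algebra.add smooth_algebra.mult)
  qed
  then show ?thesis
    by (intro smooth_coinduct[OF assms(1)]) auto
qed

text \<open>The smooth functions themselves serve as generators of the algebra: their partial
  derivatives are generators again.\<close>

lemma smooth_mult:
  fixes g h :: "'a::euclidean_space \<Rightarrow> real"
  assumes "smooth g" "smooth h" shows "smooth (\<lambda>x. g x * h x)"
  by (rule smooth_algebra_smooth[where S = "{g. smooth g}"])
     (use assms in \<open>auto intro: smooth_algebra.intros smooth_differentiable smooth_dir_deriv\<close>)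

lemma smooth_const: "smooth (\<lambda>x. c)"
proof -
  have D: "((\<lambda>x. c) has_derivative (\<lambda>b. 0)) (at x)" for c :: 'b and x :: 'a by simp
  show ?thesis
    by (rule smooth_coinduct[where S = "range (\<lambda>c x. c)"])
       (use D in \<open>auto simp: differentiable_def dir_deriv_eqI[OF D], blast\<close>)
qed

lemma smooth_prod:
  fixes g :: "'i \<Rightarrow> 'a::euclidean_space \<Rightarrow> real"
  assumes "\<And>i. i \<in> I \<Longrightarrow> smooth (g i)" shows "smooth (\<lambda>x. \<Prod>i\<in>I. g i x)"
  using assms by (induction I rule: infinite_finite_induct) (auto intro: smooth_mult smooth_const)

text \<open>The powers of \<open>1 / t\<close> are included because they make the span closed under differentiation.\<close>

definition flat_exp :: "nat \<Rightarrow> real \<Rightarrow> real" where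
  "flat_exp n t = (if t > 0 then exp (- inverse t) * inverse t ^ n else 0)"

text \<open>With \<open>s = 1 / t\<close> this is the decay of \<open>s ^ n / exp s\<close> at
  infinity.\<close>

lemma flat_exp_tendsto_0: "(flat_exp n \<longlongrightarrow> 0) (at_right 0)"
proof -
  have "((\<lambda>s::real. s ^ n / exp s) \<longlongrightarrow> 0) at_top" by (rule tendsto_power_div_exp_0)
  then have "((\<lambda>t::real. inverse t ^ n / exp (inverse t)) \<longlongrightarrow> 0) (at_right 0)"
    by (rule filterlim_compose) (rule filterlim_inverse_at_top_right)
  then show ?thesis
    by (rule Lim_transform_eventually)
       (auto simp: eventually_at_filter flat_exp_def exp_minus field_simps)
qed

text \<open>For \<open>t > 0\<close> put \<open>s = 1 / t\<close>, whose derivative is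
  \<open>- (s * s)\<close>: differentiating the exponential raises the power of \<open>s\<close> by
  2, differentiating the monomial raises it by 1. At 0 the right difference quotient is
  \<open>flat_exp (Suc n)\<close>, which tends to 0.\<close>

lemma flat_exp_deriv: "(flat_exp n has_real_derivative flat_exp (n + 2) t - n * flat_exp (n + 1) t) (at t)"
proof -
  consider "t > 0" | "t < 0" | "t = 0" by linarith
  then show ?thesis
  proof cases
    case 1
    define s where "s = inverse t"
    have inv: "(inverse has_real_derivative - (s * s)) (at t)"
      using DERIV_inverse[of t] 1 by (simp add: s_def power2_eq_square)
    have "((\<lambda>t. exp (- inverse t) * inverse t ^ n) has_real_derivative
      exp (- s) * (s * s) * s ^ n + exp (- s) * (n * s ^ (n - 1) * - (s * s))) (at t)"
      unfolding s_def
      by (rule derivative_eq_intros inv[unfolded s_def] refl)+ (simp add: algebra_simps)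
    also have "exp (- s) * (s * s) * s ^ n + exp (- s) * (n * s ^ (n - 1) * - (s * s))
        = flat_exp (n + 2) t - n * flat_exp (n + 1) t"
      using 1 by (cases n) (simp_all add: flat_exp_def s_def[symmetric] algebra_simps)
    finally have "((\<lambda>t. exp (- inverse t) * inverse t ^ n) has_real_derivative
      flat_exp (n + 2) t - n * flat_exp (n + 1) t) (at t)" .
    then show ?thesis
      by (rule has_field_derivative_transform_within_open[where S = "{0<..}"])
         (use 1 in \<open>auto simp: flat_exp_def\<close>)
  next
    case 2
    have "((\<lambda>t. 0) has_real_derivative flat_exp (n + 2) t - n * flat_exp (n + 1) t) (at t)"
      using 2 by (auto simp: flat_exp_def)
    then show ?thesis
      by (rule has_field_derivative_transform_within_open[where S = "{..<0}"])
         (use 2 in \<open>auto simp: flat_exp_def\<close>)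
  next
    case 3
    have R: "((\<lambda>s. flat_exp n s / s) \<longlongrightarrow> 0) (at_right 0)"
      using flat_exp_tendsto_0[of "Suc n"]
      by (rule Lim_transform_eventually) (auto simp: eventually_at_filter flat_exp_def field_simps)
    have L: "((\<lambda>s. flat_exp n s / s) \<longlongrightarrow> 0) (at_left 0)"
      by (rule Lim_transform_eventually[OF tendsto_const])
         (auto simp: eventually_at_filter flat_exp_def)
    have "((\<lambda>s. flat_exp n s / s) \<longlongrightarrow> 0) (at 0)"
      using filterlim_split_at[OF L R] .
    then show ?thesis using 3 by (simp add: has_field_derivative_iff flat_exp_def)
  qed
qed

text \<open>The generators are all \<open>flat_exp n\<close> of the affine function together with
  the constants; the constants supply the scalar factors that the chain rule produces.\<close>

lemma smooth_flat_exp: "smooth (\<lambda>x. flat_exp n (c * (x \<bullet> b) + r))"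
proof -
  define S where "S = {\<lambda>x. flat_exp n (c * (x \<bullet> b) + r) | n. True} \<union> range (\<lambda>(k::real) (x::'a). k)"
  have D: "((\<lambda>x. flat_exp n (c * (x \<bullet> b) + r)) has_derivative
      (\<lambda>h. c * (h \<bullet> b) * (flat_exp (n + 2) (c * (x \<bullet> b) + r) - n * flat_exp (n + 1) (c * (x \<bullet> b) + r)))) (at x)" for n x
  proof -
    have "((\<lambda>x. c * (x \<bullet> b) + r) has_derivative (\<lambda>h. c * (h \<bullet> b))) (at x)"
      by (auto intro!: derivative_eq_intros)
    from DERIV_compose_FDERIV[OF flat_exp_deriv this] show ?thesis by (simp add: algebra_simps)
  qed
  have D0: "((\<lambda>x. k) has_derivative (\<lambda>b. 0)) (at x)" for k :: real and x :: 'a by simp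
  have E: "(\<lambda>x. flat_exp n (c * (x \<bullet> b) + r)) \<in> smooth_algebra S" "(\<lambda>x. k) \<in> smooth_algebra S" for n k
    by (auto intro!: base simp: S_def)
  have split: "(\<lambda>x. c * (h \<bullet> b) * (flat_exp (n + 2) (c * (x \<bullet> b) + r) - n * flat_exp (n + 1) (c * (x \<bullet> b) + r)))
    = (\<lambda>x. c * (h \<bullet> b) * flat_exp (n + 2) (c * (x \<bullet> b) + r) + (- c * (h \<bullet> b) * n) * flat_exp (n + 1) (c * (x \<bullet> b) + r))"
    for h n by (auto simp: algebra_simps)
  show ?thesis
  proof (rule smooth_algebra_smooth[OF E(1)])
    fix g x assume "g \<in> S"
    then consider n where "g = (\<lambda>x. flat_exp n (c * (x \<bullet> b) + r))" | k where "g = (\<lambda>x. k)"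
      unfolding S_def by blast
    then show "g differentiable (at x)"
      by cases (auto intro: differentiableI[OF D])
  next
    fix g and h :: 'a assume "g \<in> S"
    then show "dir_deriv h g \<in> smooth_algebra S"
      unfolding S_def
    proof (elim UnE CollectE exE conjE rangeE)
      fix n assume g: "g = (\<lambda>x. flat_exp n (c * (x \<bullet> b) + r))"
      show "dir_deriv h g \<in> smooth_algebra ({\<lambda>x. flat_exp n (c * (x \<bullet> b) + r) | n. True} \<union> range (\<lambda>(k::real) (x::'a). k))"
        unfolding g dir_deriv_eqI[OF D] split S_def[symmetric]
        by (intro smooth_algebra.add smooth_algebra.mult E)
    next
      fix k assume g: "g = (\<lambda>x. k)"
      show "dir_deriv h g \<in> smooth_algebra ({\<lambda>x. flat_exp n (c * (x \<bullet> b) + r) | n. True} \<union> range (\<lambda>(k::real) (x::'a). k))"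
        unfolding g dir_deriv_eqI[OF D0] S_def[symmetric] by (rule E)
    qed
  qed
qed

lemma flat_exp_0_bounds: "0 \<le> flat_exp 0 t" "flat_exp 0 t \<le> 1" "t \<le> 0 \<Longrightarrow> flat_exp 0 t = 0" "0 < t \<Longrightarrow> flat_exp 0 t \<noteq> 0"
  by (auto simp: flat_exp_def)

text \<open>Stretching by \<open>n\<close> sends positive arguments to infinity, where the function
  tends to 1, and keeps nonpositive ones where it vanishes.\<close>

lemma flat_exp_0_tendsto: "((\<lambda>n. flat_exp 0 (real n * t)) \<longlongrightarrow> (if 0 < t then 1 else 0)) sequentially"
proof (cases "0 < t")
  case True
  have "filterlim (\<lambda>n. real n * t) at_top sequentially"
    using filterlim_tendsto_pos_mult_at_top[OF tendsto_const True filterlim_real_sequentially]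
    by (simp add: mult.commute)
  then have "((\<lambda>n. inverse (real n * t)) \<longlongrightarrow> 0) sequentially"
    by (rule tendsto_inverse_0_at_top)
  then have "((\<lambda>n. exp (- inverse (real n * t))) \<longlongrightarrow> exp (- 0)) sequentially"
    by (intro tendsto_intros)
  then have "((\<lambda>n. flat_exp 0 (real n * t)) \<longlongrightarrow> exp (- 0)) sequentially"
    by (rule Lim_transform_eventually)
       (use True in \<open>auto simp: flat_exp_def intro: eventually_mono[OF eventually_gt_at_top[of 0]]\<close>)
  then show ?thesis using True by simp
next
  case False
  then have "flat_exp 0 (real n * t) = 0" for n
    by (intro flat_exp_0_bounds) (simp add: mult_nonneg_nonpos)
  then show ?thesis using False by simp
qed

text \<open>Smooth approximations of the indicator of the open box \<open>box c d\<close>, with one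
  factor for each face; \<open>n\<close> controls the steepness of the transition inside the
  box.\<close>

definition box_bump :: "'a::euclidean_space \<Rightarrow> 'a \<Rightarrow> nat \<Rightarrow> 'a \<Rightarrow> real" where
  "box_bump c d n x = (\<Prod>b\<in>Basis. flat_exp 0 (real n * (x \<bullet> b - c \<bullet> b)) * flat_exp 0 (real n * (d \<bullet> b - x \<bullet> b)))"

lemma smooth_box_bump: "smooth (box_bump c d n)"
proof -
  have "smooth (\<lambda>x. flat_exp 0 (real n * (x \<bullet> b - c \<bullet> b)) * flat_exp 0 (real n * (d \<bullet> b - x \<bullet> b)))" for b :: 'a
    using smooth_mult[OF smooth_flat_exp[of 0 n b "- n * (c \<bullet> b)"] smooth_flat_exp[of 0 "- real n" b "n * (d \<bullet> b)"]]
    by (simp add: algebra_simps)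
  then show ?thesis
    unfolding box_bump_def[abs_def] by (intro smooth_prod) auto
qed

lemma box_bump_outside:
  assumes "x \<notin> box c d" shows "box_bump c d n x = 0"
proof -
  obtain b where b: "b \<in> Basis" "x \<bullet> b - c \<bullet> b \<le> 0 \<or> d \<bullet> b - x \<bullet> b \<le> 0"
    using assms by (force simp: mem_box not_less)
  then have "flat_exp 0 (real n * (x \<bullet> b - c \<bullet> b)) * flat_exp 0 (real n * (d \<bullet> b - x \<bullet> b)) = 0"
    using flat_exp_0_bounds(3)[OF mult_nonneg_nonpos] by fastforce
  then show ?thesis
    using b(1) unfolding box_bump_def by (intro prod_zero) auto
qed

lemma box_bump_bounds: "0 \<le> box_bump c d n x" "box_bump c d n x \<le> 1"
  unfolding box_bump_def
  by (auto intro!: prod_nonneg prod_le_1 mult_le_one mult_nonneg_nonneg flat_exp_0_bounds simp del: zero_le_mult_iff)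

lemma box_bump_tendsto: "(\<lambda>n. box_bump c d n x) \<longlonglongrightarrow> indicator (box c d) x"
proof -
  have "(\<lambda>n. box_bump c d n x) \<longlonglongrightarrow>
      (\<Prod>b\<in>Basis. (if 0 < x \<bullet> b - c \<bullet> b then 1 else 0) * (if 0 < d \<bullet> b - x \<bullet> b then 1 else 0))"
    unfolding box_bump_def by (intro tendsto_prod tendsto_mult flat_exp_0_tendsto)
  also have "(\<Prod>b\<in>Basis. (if 0 < x \<bullet> b - c \<bullet> b then 1 else 0) * (if 0 < d \<bullet> b - x \<bullet> b then 1 else 0))
      = (indicator (box c d) x :: real)"
    by (auto simp: indicator_def mem_box intro: prod.neutral)
  finally show ?thesis .
qed

lemma box_bump_test_function:
  assumes "box c d \<subseteq> cbox a b" "cbox a b \<subseteq> \<Omega>"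
  shows "box_bump c d n \<in> test_functions \<Omega>"
proof -
  have "{x. box_bump c d n x \<noteq> 0} \<subseteq> cbox a b"
    using box_bump_outside assms(1) by blast
  then have "closure {x. box_bump c d n x \<noteq> 0} \<subseteq> cbox a b"
    by (intro closure_minimal) auto
  then show ?thesis
    using assms(2) unfolding test_functions_def
    by (auto simp: smooth_box_bump compact_eq_bounded_closed intro: bounded_subset[OF bounded_cbox])
qed

section \<open>The fundamental lemma of the calculus of variations\<close>

text \<open>Open boxes form an intersection-stable generator of the Borel sets, and the sets over
  which \<open>g\<close> integrates to zero are closed under disjoint countable unions and, given
  the integral over the whole space, under complements. So all set integrals of \<open>g\<close>
  agree with those of 0.\<close>

lemma AE_zero_if_box_integrals_zero:
  fixes g :: "'a::euclidean_space \<Rightarrow> real"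
  assumes int: "integrable lborel g"
    and box: "\<And>a b. (LINT x:box a b|lborel. g x) = 0" and UNIV: "(LINT x|lborel. g x) = 0"
  shows "AE x in lborel. g x = 0"
proof (rule density_unique_real[OF int integrable_zero])
  fix A :: "'a set" assume "A \<in> sets lborel"
  then have A: "A \<in> sigma_sets UNIV (range (\<lambda>(a, b). box a b))"
    by (metis borel_eq_box sets_lborel sets_measure_of subset_UNIV top_greatest Pow_UNIV)
  have pi: "Int_stable (range (\<lambda>(a::'a, b). box a b))" "range (\<lambda>(a::'a, b). box a b) \<subseteq> Pow UNIV"
    by (auto simp: Int_stable_def box_Int_box)
  have "set_lebesgue_integral lborel A g = 0"
    using pi A
  proof (induction rule: sigma_sets_induct_disjoint)
    fix A assume "A \<in> range (\<lambda>(a::'a, b). box a b)"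
    then show "set_lebesgue_integral lborel A g = 0" using box by auto
  next
    show "set_lebesgue_integral lborel {} g = 0" by (simp add: set_lebesgue_integral_def)
  next
    fix A :: "'a set" assume A: "A \<in> sigma_sets UNIV (range (\<lambda>(a, b). box a b))"
      "set_lebesgue_integral lborel A g = 0"
    then have [measurable]: "A \<in> sets lborel"
      by (metis borel_eq_box sets_lborel sets_measure_of subset_UNIV Pow_UNIV)
    have "(\<lambda>x. indicator (UNIV - A) x *\<^sub>R g x) = (\<lambda>x. g x - indicator A x *\<^sub>R g x)"
      by (auto simp: indicator_def)
    then show "set_lebesgue_integral lborel (UNIV - A) g = 0"
      using A(2) UNIV int integrable_mult_indicator[OF \<open>A \<in> sets lborel\<close> int]
      by (simp add: set_lebesgue_integral_def)
  next
    fix A :: "nat \<Rightarrow> 'a set" assume A: "disjoint_family A"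
      "range A \<subseteq> sigma_sets UNIV (range (\<lambda>(a, b). box a b))"
      "\<And>i. set_lebesgue_integral lborel (A i) g = 0"
    then have mA: "A i \<in> sets lborel" for i
      by (metis borel_eq_box sets_lborel sets_measure_of subset_UNIV Pow_UNIV range_subsetD)
    have "integrable lborel (\<lambda>x. indicator (\<Union>i. A i) x *\<^sub>R g x)"
      using mA by (intro integrable_mult_indicator int sets.countable_UN) auto
    then have "(LINT x:(\<Union>i. A i)|lborel. g x) = (\<Sum>i. LINT x:A i|lborel. g x)"
      using A(1) mA by (intro lebesgue_integral_countable_add) (auto simp: disjoint_family_on_def set_integrable_def)
    then show "set_lebesgue_integral lborel (\<Union> (range A)) g = 0" using A(3) by simp
  qed
  then show "set_lebesgue_integral lborel A g = (LINT x:A|lborel. 0)" by (simp add: set_lebesgue_integral_def)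
qed

lemma integrable_lebesgue_on_iff:
  fixes g :: "'a::euclidean_space \<Rightarrow> 'b::euclidean_space"
  assumes "S \<in> sets lebesgue"
  shows "integrable (lebesgue_on S) g \<longleftrightarrow> integrable lebesgue (\<lambda>x. indicator S x *\<^sub>R g x)"
  using assms by (subst integrable_restrict_space) auto

lemma integral_lebesgue_on_eq:
  fixes g :: "'a::euclidean_space \<Rightarrow> 'b::euclidean_space"
  assumes "S \<in> sets lebesgue"
  shows "(LINT x|lebesgue_on S. g x) = (LINT x|lebesgue. indicator S x *\<^sub>R g x)"
  using assms by (subst integral_restrict_space) auto

lemma integral_lebesgue_on_superset:
  fixes g :: "'a::euclidean_space \<Rightarrow> 'b::euclidean_space"
  assumes "S \<in> sets lebesgue" "T \<in> sets lebesgue" "S \<subseteq> T" "\<And>x. x \<in> T - S \<Longrightarrow> g x = 0"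
  shows "(LINT x|lebesgue_on T. g x) = (LINT x|lebesgue_on S. g x)"
    and "integrable (lebesgue_on T) g \<longleftrightarrow> integrable (lebesgue_on S) g"
proof -
  have "(\<lambda>x. indicator T x *\<^sub>R g x) = (\<lambda>x. indicator S x *\<^sub>R g x)"
    using assms(3,4) by (auto simp: indicator_def fun_eq_iff)
  then show "(LINT x|lebesgue_on T. g x) = (LINT x|lebesgue_on S. g x)"
    "integrable (lebesgue_on T) g \<longleftrightarrow> integrable (lebesgue_on S) g"
    using assms(1,2) by (simp_all add: integral_lebesgue_on_eq integrable_lebesgue_on_iff)
qed

text \<open>On a closed box inside \<open>\<Omega>\<close> the function is integrable, and bumps
  converge boundedly to indicators of sub-boxes; hence \<open>g\<close> integrates to zero over each
  of these. Countably many such closed boxes exhaust \<open>\<Omega>\<close>.\<close>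

lemma fundamental_lemma_calculus_of_variations:
  fixes g :: "'a::euclidean_space \<Rightarrow> real"
  assumes \<Omega>: "open \<Omega>" and int: "locally_integrable \<Omega> g"
    and zero: "\<And>\<phi>. \<phi> \<in> test_functions \<Omega> \<Longrightarrow> (LINT x|lebesgue_on \<Omega>. g x * \<phi> x) = 0"
  shows "AE x in lebesgue_on \<Omega>. g x = 0"
proof -
  have \<Omega>': "\<Omega> \<in> sets lebesgue" using \<Omega> by auto
  have local: "AE x in lebesgue. x \<in> box a b \<longrightarrow> g x = 0" if ab: "cbox a b \<subseteq> \<Omega>" for a b
  proof -
    define G where "G x = indicator (cbox a b) x * g x" for x
    have G: "integrable lebesgue G"
      using int ab unfolding locally_integrable_def G_def
      by (auto simp: integrable_lebesgue_on_iff dest!: spec[of _ "cbox a b"])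
    then have mG[measurable]: "G \<in> borel_measurable lebesgue" by auto
    have sub: "(LINT x|lebesgue. indicator (box c d) x * G x) = 0" if cd: "box c d \<subseteq> cbox a b" for c d
    proof (rule LIMSEQ_unique)
      have [measurable]: "box_bump c d n \<in> borel_measurable lebesgue" for n
        using smooth_continuous_on[OF smooth_box_bump, of UNIV c d n]
        by (intro measurable_completion) (auto simp: borel_measurable_continuous_onI)
      show "(\<lambda>n. LINT x|lebesgue. box_bump c d n x * G x) \<longlonglongrightarrow> (LINT x|lebesgue. indicator (box c d) x * G x)"
      proof (rule integral_dominated_convergence[where w = "\<lambda>x. \<bar>G x\<bar>"])
        show "AE x in lebesgue. (\<lambda>n. box_bump c d n x * G x) \<longlonglongrightarrow> indicator (box c d) x * G x"
          by (auto intro!: tendsto_mult box_bump_tendsto)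
        show "AE x in lebesgue. norm (box_bump c d n x * G x) \<le> \<bar>G x\<bar>" for n
          using box_bump_bounds[of c d n] by (auto simp: abs_mult intro!: mult_left_le_one_le)
        show "(\<lambda>x. indicator (box c d) x * G x) \<in> borel_measurable lebesgue"
          by (intro borel_measurable_times borel_measurable_indicator mG) auto
      qed (use G in auto)
      have "(LINT x|lebesgue. box_bump c d n x * G x) = 0" for n
      proof -
        have "(LINT x|lebesgue. box_bump c d n x * G x) = (LINT x|lebesgue_on \<Omega>. g x * box_bump c d n x)"
          unfolding integral_lebesgue_on_eq[OF \<Omega>']
          using ab subsetD[OF cd] box_bump_outside[of _ c d n]
          by (intro Bochner_Integration.integral_cong) (auto simp: G_def indicator_def)
        also have "\<dots> = 0" using zero box_bump_test_function[OF cd ab] by auto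
        finally show ?thesis .
      qed
      then show "(\<lambda>n. LINT x|lebesgue. box_bump c d n x * G x) \<longlonglongrightarrow> 0" by simp
    qed
    \<comment> \<open>Cutting off outside \<open>box a b\<close> reduces integrals over arbitrary
      boxes to sub-boxes, because boxes intersect in boxes.\<close>
    define H where "H x = indicator (box a b) x * G x" for x
    have H: "integrable lebesgue H"
      using integrable_mult_indicator[OF _ G, of "box a b"] by (simp add: H_def[abs_def])
    \<comment> \<open>The uniqueness of densities is applied over \<open>lborel\<close>, while
      \<open>H\<close> is only Lebesgue measurable; a Borel representative bridges the two.\<close>
    obtain H' where H'[measurable]: "H' \<in> borel_measurable lborel" "AE x in lborel. H x = H' x"
      using completion_ex_borel_measurable_real[of H lborel] H by auto
    then have AE: "AE x in lebesgue. H x = H' x" by (auto intro: AE_completion)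
    have intH': "integrable lebesgue H'"
      using H AE H'(1) by (subst integrable_cong_AE[of _ _ H]) (auto intro: measurable_completion)
    have eq: "(LINT x|lebesgue. indicator S x * H' x) = (LINT x|lebesgue. indicator S x * H x)" if "S \<in> sets lborel" for S
      using that AE H'(1) by (intro integral_cong_AE) (auto intro!: borel_measurable_times borel_measurable_integrable[OF H] measurable_completion[of H'] borel_measurable_indicator)
    have "AE x in lborel. H' x = 0"
    proof (rule AE_zero_if_box_integrals_zero)
      show "integrable lborel H'" using intH' by (subst (asm) integrable_completion) auto
    next
      fix c d :: 'a
      obtain c' d' where cd: "box c d \<inter> box a b = box c' d'" using box_Int_box by blast
      have "(LINT x:box c d|lborel. H' x) = (LINT x|lebesgue. indicator (box c d) x * H' x)"
        by (subst integral_completion) (auto simp: set_lebesgue_integral_def)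
      also have "\<dots> = (LINT x|lebesgue. indicator (box c d) x * H x)" by (rule eq) auto
      also have "\<dots> = (LINT x|lebesgue. indicator (box c' d') x * G x)"
        unfolding H_def cd[symmetric] by (intro Bochner_Integration.integral_cong) (auto simp: indicator_def)
      also have "\<dots> = 0" by (rule sub) (use cd box_subset_cbox in blast)
      finally show "(LINT x:box c d|lborel. H' x) = 0" .
    next
      have "(LINT x|lborel. H' x) = (LINT x|lebesgue. indicator UNIV x * H' x)"
        by (subst integral_completion) auto
      also have "\<dots> = (LINT x|lebesgue. indicator UNIV x * H x)" by (rule eq) auto
      also have "\<dots> = (LINT x|lebesgue. indicator (box a b) x * G x)" by (simp add: H_def)
      also have "\<dots> = 0" by (rule sub) (rule box_subset_cbox)
      finally show "(LINT x|lborel. H' x) = 0" .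
    qed
    then have "AE x in lebesgue. H' x = 0" by (rule AE_completion)
    with AE show ?thesis
      by eventually_elim (use box_subset_cbox[of a b] in \<open>auto simp: H_def G_def indicator_def split: if_splits\<close>)
  qed
  \<comment> \<open>The countable cover of \<open>\<Omega>\<close> consists of closed boxes; their
    boundaries are null sets.\<close>
  have local': "AE x in lebesgue. x \<in> cbox a b \<longrightarrow> g x = 0" if "cbox a b \<subseteq> \<Omega>" for a b
  proof -
    have "AE x in lebesgue. x \<notin> cbox a b - box a b"
      using negligible_frontier_interval[of a b] unfolding negligible_iff_null_sets by (rule AE_not_in)
    with local[OF that] show ?thesis by eventually_elim auto
  qed
  obtain \<D> where \<D>: "countable \<D>" "\<D> \<subseteq> Pow \<Omega>" "\<And>X. X \<in> \<D> \<Longrightarrow> \<exists>a b. X = cbox a b" "\<Union>\<D> = \<Omega>"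
    using open_countable_Union_open_cbox[OF \<Omega>] by metis
  have "AE x in lebesgue. x \<in> X \<longrightarrow> g x = 0" if "X \<in> \<D>" for X
    using \<D>(2,3) that local' by blast
  then have "AE x in lebesgue. \<forall>X\<in>\<D>. x \<in> X \<longrightarrow> g x = 0"
    using \<D>(1) by (subst AE_ball_countable) auto
  then have "AE x in lebesgue. x \<in> \<Omega> \<longrightarrow> g x = 0"
    by eventually_elim (use \<D>(4) in blast)
  then show ?thesis using \<Omega>' by (subst AE_restrict_space_iff) auto
qed

section \<open>Integration by parts\<close>

lemma dir_deriv_outside_support:
  assumes "x \<notin> closure {x. g x \<noteq> 0}" shows "dir_deriv b g x = 0"
proof -
  have "((\<lambda>x. 0) has_derivative (\<lambda>b. 0)) (at x)" by simp
  then have "(g has_derivative (\<lambda>b. 0)) (at x)"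
    by (rule has_derivative_transform_within_open[where s = "- closure {x. g x \<noteq> 0}"])
       (use assms closure_subset[of "{x. g x \<noteq> 0}"] in auto)
  then show ?thesis unfolding dir_deriv_def using frechet_derivative_at by metis
qed

lemma test_functions_dir_deriv:
  assumes "\<phi> \<in> test_functions \<Omega>" "b \<in> Basis" shows "dir_deriv b \<phi> \<in> test_functions \<Omega>"
proof -
  have "closure {x. dir_deriv b \<phi> x \<noteq> 0} \<subseteq> closure {x. \<phi> x \<noteq> 0}"
    using dir_deriv_outside_support[of _ \<phi> b] by (intro closure_minimal) auto
  then show ?thesis
    using assms unfolding test_functions_def
    by (auto simp: smooth_dir_deriv compact_eq_bounded_closed intro: bounded_subset)
qed

lemma test_functions_norm_bound:
  assumes "\<phi> \<in> test_functions \<Omega>"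
  obtains B where "0 < B" "\<And>x. norm (\<phi> x) \<le> B"
proof -
  let ?K = "closure {x. \<phi> x \<noteq> 0}"
  have "compact (\<phi> ` ?K)"
    using assms by (intro compact_continuous_image smooth_continuous_on) (auto simp: test_functions_def)
  then obtain B where B: "0 < B" "\<And>y. y \<in> \<phi> ` ?K \<Longrightarrow> norm y \<le> B"
    using compact_imp_bounded bounded_pos by metis
  show ?thesis
  proof (rule that[OF B(1)])
    fix x show "norm (\<phi> x) \<le> B"
      using B closure_subset[of "{x. \<phi> x \<noteq> 0}"] by (cases "\<phi> x = 0") auto
  qed
qed

lemma test_functions_measurable:
  "\<phi> \<in> test_functions \<Omega> \<Longrightarrow> \<phi> \<in> borel_measurable borel"
  unfolding test_functions_def by (auto intro: borel_measurable_continuous_onI smooth_continuous_on)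

lemma test_functions_measurable_on:
  assumes "\<phi> \<in> test_functions \<Omega>" shows "\<phi> \<in> borel_measurable (lebesgue_on S)"
  using test_functions_measurable[OF assms]
  by (intro measurable_restrict_space1 measurable_completion) (simp add: measurable_lborel1)

text \<open>By translation invariance every difference quotient of \<open>\<phi>\<close> has
  integral zero, and the quotients converge to the derivative under a compactly supported
  bound.\<close>

lemma integral_dir_deriv_eq_0:
  fixes \<phi> :: "'a::euclidean_space \<Rightarrow> real"
  assumes \<phi>: "\<phi> \<in> test_functions UNIV" and b: "b \<in> Basis"
  shows "(LINT x|lebesgue. dir_deriv b \<phi> x) = 0"
proof -
  let ?d = "dir_deriv b \<phi>"
  let ?q = "\<lambda>n x. real (Suc n) * (\<phi> (b /\<^sub>R real (Suc n) + x) - \<phi> x)"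
  have sm: "smooth \<phi>" using \<phi> by (simp add: test_functions_def)
  have [measurable]: "\<phi> \<in> borel_measurable borel" "?d \<in> borel_measurable borel"
    using \<phi> test_functions_dir_deriv[OF \<phi> b] by (auto intro: test_functions_measurable)
  obtain B where B: "0 < B" "\<And>x. norm (?d x) \<le> B"
    using test_functions_norm_bound[OF test_functions_dir_deriv[OF \<phi> b]] by metis
  obtain R where "\<forall>x\<in>closure {x. \<phi> x \<noteq> 0}. norm x \<le> R"
    using \<phi> compact_imp_bounded[of "closure {x. \<phi> x \<noteq> 0}"] unfolding test_functions_def bounded_iff by blast
  then have R: "\<And>x. \<phi> x \<noteq> 0 \<Longrightarrow> norm x \<le> R"
    using closure_subset[of "{x. \<phi> x \<noteq> 0}"] by auto
  have cb: "integrable lborel (\<lambda>x::'a. indicator (cball 0 r) x * c)" for r c :: real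
    by (intro integrable_mult_left integrable_real_indicator emeasure_lborel_cball_finite) auto
  have int: "integrable lborel \<phi>"
  proof -
    obtain C where C: "\<And>x. norm (\<phi> x) \<le> C" using test_functions_norm_bound[OF \<phi>] by metis
    show ?thesis
    proof (rule Bochner_Integration.integrable_bound[OF cb[of R C]])
      show "AE x in lborel. norm (\<phi> x) \<le> norm (indicator (cball 0 R) x * C)"
      proof (rule AE_I2)
        fix x
        show "norm (\<phi> x) \<le> norm (indicator (cball 0 R) x * C)"
          using C[of x] R[of x] by (cases "\<phi> x = 0") auto
      qed
    qed simp
  qed
  have der: "((\<lambda>t. \<phi> (x + t *\<^sub>R b)) has_real_derivative ?d (x + t *\<^sub>R b)) (at t)" for x t
  proof -
    have "((\<lambda>t. x + t *\<^sub>R b) has_vector_derivative b) (at t)"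
      by (auto intro!: derivative_eq_intros)
    from vector_derivative_diff_chain_within[OF this, of \<phi>] show ?thesis
      using smooth_has_derivative[OF sm, of "x + t *\<^sub>R b"]
      by (auto simp: o_def has_real_derivative_iff_has_vector_derivative intro: has_derivative_at_withinI)
  qed
  have lim: "(\<lambda>n. LINT x|lborel. ?q n x) \<longlonglongrightarrow> (LINT x|lborel. ?d x)"
  \<comment> \<open>The steps have length at most 1, so outside the ball of radius
    \<open>R + 1\<close> both \<open>\<phi>\<close> and its translate vanish; inside, the mean value
    theorem bounds the quotient by \<open>B\<close>.\<close>
  proof (rule integral_dominated_convergence[where w = "\<lambda>x. indicator (cball 0 (R + 1)) x * B"])
    show "integrable lborel (\<lambda>x::'a. indicator (cball 0 (R + 1)) x * B)"
      by (rule cb)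
    show "AE x in lborel. (\<lambda>n. ?q n x) \<longlonglongrightarrow> ?d x"
    proof (rule AE_I2)
      fix x
      have "((\<lambda>t. (\<phi> (x + t *\<^sub>R b) - \<phi> x) / t) \<longlongrightarrow> ?d x) (at 0)"
        using der[of x 0] by (simp add: has_field_derivative_iff)
      moreover have "filterlim (\<lambda>n. inverse (real (Suc n))) (at 0) sequentially"
        by (intro filterlim_atI LIMSEQ_inverse_real_of_nat) auto
      ultimately have "(\<lambda>n. (\<phi> (x + inverse (real (Suc n)) *\<^sub>R b) - \<phi> x) / inverse (real (Suc n))) \<longlonglongrightarrow> ?d x"
        by (rule filterlim_compose)
      then show "(\<lambda>n. ?q n x) \<longlonglongrightarrow> ?d x" by (simp add: field_simps)
    qed
    show "AE x in lborel. norm (?q n x) \<le> indicator (cball 0 (R + 1)) x * B" for n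
    proof (rule AE_I2)
      fix x :: 'a
      let ?y = "b /\<^sub>R real (Suc n) + x"
      have nb: "norm (b /\<^sub>R real (Suc n)) = 1 / Suc n"
        using b by (simp add: divide_inverse)
      show "norm (?q n x) \<le> indicator (cball 0 (R + 1)) x * B"
      proof (cases "x \<in> cball 0 (R + 1)")
        case True
        define s where "s = 1 / real (Suc n)"
        have s: "0 < s" by (simp add: s_def)
        obtain z where "\<phi> (x + s *\<^sub>R b) - \<phi> (x + 0 *\<^sub>R b) = (s - 0) * ?d (x + z *\<^sub>R b)"
          using MVT2[OF s, of "\<lambda>t. \<phi> (x + t *\<^sub>R b)" "\<lambda>t. ?d (x + t *\<^sub>R b)"] der by blast
        moreover have "x + s *\<^sub>R b = ?y" by (simp add: s_def divide_inverse add.commute)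
        ultimately have "norm (\<phi> ?y - \<phi> x) \<le> s * B"
          using s B by (simp add: abs_mult)
        then have "real (Suc n) * norm (\<phi> ?y - \<phi> x) \<le> B"
          by (simp add: s_def field_simps)
        then show ?thesis using True by (simp add: abs_mult)
      next
        case False
        have "1 / real (Suc n) \<le> 1" by simp
        moreover have "norm x \<le> norm ?y + 1 / real (Suc n)"
          using norm_triangle_ineq4[of ?y "b /\<^sub>R real (Suc n)"] unfolding nb by simp
        ultimately have "\<not> norm x \<le> R" "\<not> norm ?y \<le> R"
          using False unfolding mem_cball_0 by linarith+
        then have "\<phi> x = 0" "\<phi> ?y = 0" using R by blast+
        then show ?thesis using False by simp
      qed
    qed
  qed (auto)
  have "(LINT x|lborel. ?q n x) = 0" for n
  proof -
    have tr: "integrable lborel (\<lambda>x. \<phi> (c + x))" "(LINT x|lborel. \<phi> (c + x)) = (LINT x|lborel. \<phi> x)" for c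
    proof -
      have d: "lborel = distr lborel borel ((+) c)" by (simp add: lborel_distr_plus)
      show "integrable lborel (\<lambda>x. \<phi> (c + x))"
        using int by (subst (asm) d, subst (asm) integrable_distr_eq) auto
      show "(LINT x|lborel. \<phi> (c + x)) = (LINT x|lborel. \<phi> x)"
        by (subst (2) d, subst integral_distr) auto
    qed
    show ?thesis
      using int tr[of "b /\<^sub>R real (Suc n)"] by simp
  qed
  with lim have "(LINT x|lborel. ?d x) = 0" by (simp add: LIMSEQ_const_iff)
  then show ?thesis by (subst integral_completion) auto
qed

lemma test_functionsI:
  assumes "smooth \<phi>" "compact K" "K \<subseteq> \<Omega>" "\<And>x. x \<notin> K \<Longrightarrow> \<phi> x = 0"
  shows "\<phi> \<in> test_functions \<Omega>"
proof -
  have "closure {x. \<phi> x \<noteq> 0} \<subseteq> K"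
    using assms(2,4) by (intro closure_minimal compact_imp_closed) blast
  moreover have "bounded (closure {x. \<phi> x \<noteq> 0})"
    using calculation assms(2) by (blast intro: bounded_subset compact_imp_bounded)
  ultimately show ?thesis
    using assms(1,3) by (auto simp: test_functions_def compact_eq_bounded_closed)
qed

text \<open>An arbitrary compact set off which the function vanishes passes through sums, products
  and linear maps more easily than the closed support.\<close>

lemma test_functions_iff:
  "\<phi> \<in> test_functions \<Omega> \<longleftrightarrow> smooth \<phi> \<and> (\<exists>K. compact K \<and> K \<subseteq> \<Omega> \<and> (\<forall>x. x \<notin> K \<longrightarrow> \<phi> x = 0))"
proof
  assume \<phi>: "\<phi> \<in> test_functions \<Omega>"
  then have 1: "smooth \<phi>" "compact (closure {x. \<phi> x \<noteq> 0})" "closure {x. \<phi> x \<noteq> 0} \<subseteq> \<Omega>"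
    by (simp_all add: test_functions_def)
  have 2: "\<forall>x. x \<notin> closure {x. \<phi> x \<noteq> 0} \<longrightarrow> \<phi> x = 0"
    using closure_subset[of "{x. \<phi> x \<noteq> 0}"] by auto
  show "smooth \<phi> \<and> (\<exists>K. compact K \<and> K \<subseteq> \<Omega> \<and> (\<forall>x. x \<notin> K \<longrightarrow> \<phi> x = 0))"
    by (intro conjI exI[of _ "closure {x. \<phi> x \<noteq> 0}"] 1 2)
next
  assume "smooth \<phi> \<and> (\<exists>K. compact K \<and> K \<subseteq> \<Omega> \<and> (\<forall>x. x \<notin> K \<longrightarrow> \<phi> x = 0))"
  then obtain K where "smooth \<phi>" "compact K" "K \<subseteq> \<Omega>" and 0: "\<forall>x. x \<notin> K \<longrightarrow> \<phi> x = 0" by auto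
  then show "\<phi> \<in> test_functions \<Omega>" by (intro test_functionsI[of _ K]) simp_all
qed

lemma test_functions_bounded_linear:
  assumes "bounded_linear T" "\<phi> \<in> test_functions \<Omega>" shows "(\<lambda>x. T (\<phi> x)) \<in> test_functions \<Omega>"
proof -
  obtain K where "smooth \<phi>" "compact K" "K \<subseteq> \<Omega>" "\<And>x. x \<notin> K \<Longrightarrow> \<phi> x = 0"
    using assms(2) unfolding test_functions_iff by auto
  then show ?thesis
    using smooth_bounded_linear[OF assms(1), of \<phi>] linear_0[OF bounded_linear.linear[OF assms(1)]]
    by (intro test_functionsI[of _ K]) auto
qed

lemma test_functions_add:
  assumes "\<phi> \<in> test_functions \<Omega>" "\<psi> \<in> test_functions \<Omega>" shows "(\<lambda>x. \<phi> x + \<psi> x) \<in> test_functions \<Omega>"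
proof -
  obtain K where "smooth \<phi>" "compact K" "K \<subseteq> \<Omega>" "\<And>x. x \<notin> K \<Longrightarrow> \<phi> x = 0"
    using assms(1) unfolding test_functions_iff by auto
  moreover obtain L where "smooth \<psi>" "compact L" "L \<subseteq> \<Omega>" "\<And>x. x \<notin> L \<Longrightarrow> \<psi> x = 0"
    using assms(2) unfolding test_functions_iff by auto
  ultimately show ?thesis
    by (intro test_functionsI[of _ "K \<union> L"] smooth_add compact_Un) auto
qed

lemmas test_functions_scaleR = test_functions_bounded_linear[OF bounded_linear_scaleR_right]

lemma test_functions_mult:
  fixes \<phi> \<psi> :: "'a::euclidean_space \<Rightarrow> real"
  assumes "\<phi> \<in> test_functions \<Omega>" "smooth \<psi>" shows "(\<lambda>x. \<phi> x * \<psi> x) \<in> test_functions \<Omega>"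
proof -
  obtain K where "smooth \<phi>" "compact K" "K \<subseteq> \<Omega>" "\<And>x. x \<notin> K \<Longrightarrow> \<phi> x = 0"
    using assms(1) unfolding test_functions_iff by auto
  then show ?thesis
    using assms(2) by (intro test_functionsI[of _ K] smooth_mult) auto
qed

lemma dir_deriv_bounded_linear:
  assumes "bounded_linear T" "smooth \<phi>"
  shows "dir_deriv b (\<lambda>x. T (\<phi> x)) = (\<lambda>x. T (dir_deriv b \<phi> x))"
  by (rule dir_deriv_eqI) (rule bounded_linear.has_derivative[OF assms(1) smooth_has_derivative[OF assms(2)]])

lemma dir_deriv_add:
  "smooth \<phi> \<Longrightarrow> smooth \<psi> \<Longrightarrow> dir_deriv b (\<lambda>x. \<phi> x + \<psi> x) = (\<lambda>x. dir_deriv b \<phi> x + dir_deriv b \<psi> x)"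
  by (rule dir_deriv_eqI) (intro has_derivative_add smooth_has_derivative)

lemma dir_deriv_mult:
  fixes \<phi> \<psi> :: "'a::euclidean_space \<Rightarrow> real"
  shows "smooth \<phi> \<Longrightarrow> smooth \<psi> \<Longrightarrow>
    dir_deriv b (\<lambda>x. \<phi> x * \<psi> x) = (\<lambda>x. \<phi> x * dir_deriv b \<psi> x + dir_deriv b \<phi> x * \<psi> x)"
  by (rule dir_deriv_eqI) (intro has_derivative_mult smooth_has_derivative)

lemma open_compact_sets_lebesgue: "open \<Omega> \<Longrightarrow> compact K \<Longrightarrow> \<Omega> \<in> sets lebesgue \<and> K \<in> sets lebesgue"
  by (simp add: borel_compact lebesgue_measurable_vimage_borel)

lemma locally_integrable_bounded_linear:
  assumes "bounded_linear T" "locally_integrable \<Omega> u" shows "locally_integrable \<Omega> (\<lambda>x. T (u x))"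
  using assms unfolding locally_integrable_def by (auto intro: integrable_bounded_linear)

lemma locally_integrable_add:
  "locally_integrable \<Omega> u \<Longrightarrow> locally_integrable \<Omega> v \<Longrightarrow> locally_integrable \<Omega> (\<lambda>x. u x + v x)"
  unfolding locally_integrable_def by auto

lemmas locally_integrable_scaleR = locally_integrable_bounded_linear[OF bounded_linear_scaleR_right]

lemma integrable_mult_test:
  fixes u \<phi> :: "'a::euclidean_space \<Rightarrow> real"
  assumes "open \<Omega>" "locally_integrable \<Omega> u" "\<phi> \<in> test_functions \<Omega>"
  shows "integrable (lebesgue_on \<Omega>) (\<lambda>x. u x * \<phi> x)"
proof -
  obtain K where K: "smooth \<phi>" "compact K" "K \<subseteq> \<Omega>" "\<And>x. x \<notin> K \<Longrightarrow> \<phi> x = 0"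
    using assms(3) unfolding test_functions_iff by auto
  obtain B where B: "0 < B" "\<And>x. norm (\<phi> x) \<le> B"
    using test_functions_norm_bound[OF assms(3)] by blast
  have u: "integrable (lebesgue_on K) u" using assms(2) K by (simp add: locally_integrable_def)
  have "integrable (lebesgue_on K) (\<lambda>x. u x * \<phi> x)"
  proof (rule Bochner_Integration.integrable_bound)
    show "integrable (lebesgue_on K) (\<lambda>x. B * u x)" using u by simp
    show "(\<lambda>x. u x * \<phi> x) \<in> borel_measurable (lebesgue_on K)"
      using u test_functions_measurable_on[OF assms(3)] by auto
    show "AE x in lebesgue_on K. norm (u x * \<phi> x) \<le> norm (B * u x)"
      using B by (auto simp: abs_mult mult.commute[of B] intro!: mult_left_mono)
  qed
  then show ?thesis
    using K open_compact_sets_lebesgue[OF assms(1) K(2)] by (subst integral_lebesgue_on_superset(2)[of K \<Omega>]) auto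
qed

lemma locally_integrable_test:
  assumes "\<phi> \<in> test_functions \<Omega>" shows "locally_integrable \<Omega>' \<phi>"
  unfolding locally_integrable_def
proof (intro allI impI)
  fix K assume K: "compact K \<and> K \<subseteq> \<Omega>'"
  obtain B where B: "\<And>x. norm (\<phi> x) \<le> B"
    using test_functions_norm_bound[OF assms] by blast
  have "K \<in> lmeasurable" using K by (simp add: lmeasurable_compact)
  then have "finite_measure (lebesgue_on K)"
    by (simp add: finite_measure_lebesgue_on)
  then show "integrable (lebesgue_on K) \<phi>"
    using B test_functions_measurable_on[OF assms]
    by (intro finite_measure.integrable_const_bound[of _ _ B]) auto
qed

section \<open>Weak gradients and weak divergences\<close>

lemma AE_eq_by_test_functions:
  fixes g g' :: "'a::euclidean_space \<Rightarrow> real"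
  assumes "open \<Omega>" "locally_integrable \<Omega> g" "locally_integrable \<Omega> g'"
    "\<And>\<phi>. \<phi> \<in> test_functions \<Omega> \<Longrightarrow> (LINT x|lebesgue_on \<Omega>. g x * \<phi> x) = (LINT x|lebesgue_on \<Omega>. g' x * \<phi> x)"
  shows "AE x in lebesgue_on \<Omega>. g x = g' x"
proof -
  have "AE x in lebesgue_on \<Omega>. g x - g' x = 0"
  proof (rule fundamental_lemma_calculus_of_variations[OF assms(1)])
    show "locally_integrable \<Omega> (\<lambda>x. g x - g' x)"
      using assms(2,3) unfolding locally_integrable_def by auto
  next
    fix \<phi> :: "'a \<Rightarrow> real" assume "\<phi> \<in> test_functions \<Omega>"
    then show "(LINT x|lebesgue_on \<Omega>. (g x - g' x) * \<phi> x) = 0"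
      using assms integrable_mult_test[OF assms(1)] by (simp add: left_diff_distrib)
  qed
  then show ?thesis by simp
qed

lemma bounded_linear_vec_nth2: "bounded_linear (\<lambda>G::real^'d^'m. G $ i $ j)"
  using bounded_linear_compose[OF bounded_linear_vec_nth bounded_linear_vec_nth] .

lemma has_weak_grad_unique:
  assumes "open \<Omega>" "has_weak_grad \<Omega> u G" "has_weak_grad \<Omega> u G'"
  shows "AE x in lebesgue_on \<Omega>. G x = G' x"
proof -
  have "AE x in lebesgue_on \<Omega>. G x $ i $ j = G' x $ i $ j" for i j
    using assms unfolding has_weak_grad_def
    by (intro AE_eq_by_test_functions locally_integrable_bounded_linear[OF bounded_linear_vec_nth2]) auto
  then have "AE x in lebesgue_on \<Omega>. \<forall>i j. G x $ i $ j = G' x $ i $ j"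
    by (simp add: AE_all_countable)
  then show ?thesis by eventually_elim (simp add: vec_eq_iff)
qed

lemma has_weak_grad_add:
  fixes u v :: "real^'d \<Rightarrow> real^'m"
  assumes \<Omega>: "open \<Omega>" and u: "has_weak_grad \<Omega> u G" and v: "has_weak_grad \<Omega> v H"
  shows "has_weak_grad \<Omega> (\<lambda>x. u x + v x) (\<lambda>x. G x + H x)"
  unfolding has_weak_grad_def
proof (intro conjI ballI allI)
  show "locally_integrable \<Omega> (\<lambda>x. u x + v x)" "locally_integrable \<Omega> (\<lambda>x. G x + H x)"
    using u v unfolding has_weak_grad_def by (auto intro: locally_integrable_add)
  fix \<phi> :: "real^'d \<Rightarrow> real" and i j assume \<phi>: "\<phi> \<in> test_functions \<Omega>"
  have d: "(\<lambda>x. grad \<phi> x $ j) \<in> test_functions \<Omega>"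
    using test_functions_dir_deriv[OF \<phi>, of "axis j 1"] by (simp add: grad_def axis_in_Basis_iff)
  have "integrable (lebesgue_on \<Omega>) (\<lambda>x. u x $ i * grad \<phi> x $ j)" "integrable (lebesgue_on \<Omega>) (\<lambda>x. v x $ i * grad \<phi> x $ j)"
    "integrable (lebesgue_on \<Omega>) (\<lambda>x. G x $ i $ j * \<phi> x)" "integrable (lebesgue_on \<Omega>) (\<lambda>x. H x $ i $ j * \<phi> x)"
    using u v unfolding has_weak_grad_def
    by (auto intro!: integrable_mult_test \<Omega> d \<phi> locally_integrable_bounded_linear[OF bounded_linear_vec_nth]
        locally_integrable_bounded_linear[OF bounded_linear_vec_nth2])
  then show "(LINT x|lebesgue_on \<Omega>. (u x + v x) $ i * grad \<phi> x $ j) = - (LINT x|lebesgue_on \<Omega>. (G x + H x) $ i $ j * \<phi> x)"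
    using u v \<phi> unfolding has_weak_grad_def by (simp add: distrib_right)
qed

lemma has_weak_grad_scaleR:
  assumes u: "has_weak_grad \<Omega> u G"
  shows "has_weak_grad \<Omega> (\<lambda>x. c *\<^sub>R u x) (\<lambda>x. c *\<^sub>R G x)"
  using assms unfolding has_weak_grad_def by (auto intro: locally_integrable_scaleR simp: mult.assoc)

definition jacobian :: "(real^'d \<Rightarrow> real^'m) \<Rightarrow> real^'d \<Rightarrow> real^'d^'m" where
  "jacobian h x = (\<chi> i j. dir_deriv (axis j 1) h x $ i)"

lemma jacobian_add: "smooth g \<Longrightarrow> smooth h \<Longrightarrow> jacobian (\<lambda>x. g x + h x) = (\<lambda>x. jacobian g x + jacobian h x)"
  by (auto simp: jacobian_def[abs_def] dir_deriv_add vec_eq_iff)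

lemma jacobian_scaleR: "smooth h \<Longrightarrow> jacobian (\<lambda>x. c *\<^sub>R h x) = (\<lambda>x. c *\<^sub>R jacobian h x)"
  by (auto simp: jacobian_def[abs_def] dir_deriv_bounded_linear[OF bounded_linear_scaleR_right] vec_eq_iff)

text \<open>The matrix is the sum of its columns, and each column is a bounded linear image of one
  partial derivative; test functions are stable under both operations.\<close>

lemma jacobian_test_function:
  fixes h :: "real^'d \<Rightarrow> real^'m"
  assumes "h \<in> test_functions \<Omega>" shows "jacobian h \<in> test_functions \<Omega>"
proof -
  have "jacobian h = (\<lambda>x. \<Sum>j\<in>UNIV. (\<chi> i. axis j (dir_deriv (axis j 1) h x $ i)))"
    by (auto simp: jacobian_def fun_eq_iff vec_eq_iff axis_def if_distrib cong: if_cong)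
  moreover have "(\<lambda>x. \<Sum>j\<in>J. (\<chi> i. axis j (dir_deriv (axis j 1) h x $ i))) \<in> test_functions \<Omega>"
    if "finite J" for J :: "'d set"
    using that
  proof (induction J)
    case empty
    show ?case by (rule test_functionsI[of _ "{}"]) (auto simp: smooth_const)
  next
    case (insert j J)
    have "bounded_linear (\<lambda>y::real^'m. (\<chi> i. axis j (y $ i)) :: real^'d^'m)"
      by (intro linear_conv_bounded_linear[THEN iffD1] linearI) (auto simp: vec_eq_iff axis_def)
    then have "(\<lambda>x. (\<chi> i. axis j (dir_deriv (axis j 1) h x $ i)) :: real^'d^'m) \<in> test_functions \<Omega>"
      by (rule test_functions_bounded_linear) (intro test_functions_dir_deriv assms, simp add: axis_in_Basis_iff)
    with insert show ?case by (simp add: test_functions_add)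
  qed
  ultimately show ?thesis by simp
qed

text \<open>The product of a component of \<open>h\<close> with \<open>\<phi>\<close> is again a
  test function, so the integral of its partial derivative vanishes; the product rule turns this
  into integration by parts.\<close>

lemma has_weak_grad_test_function:
  fixes h :: "real^'d \<Rightarrow> real^'m"
  assumes \<Omega>: "open \<Omega>" and h: "h \<in> test_functions \<Omega>" shows "has_weak_grad \<Omega> h (jacobian h)"
  unfolding has_weak_grad_def
proof (intro conjI ballI allI)
  show "locally_integrable \<Omega> h" "locally_integrable \<Omega> (jacobian h)"
    using locally_integrable_test jacobian_test_function h by blast+
  fix \<phi> :: "real^'d \<Rightarrow> real" and i j assume \<phi>: "\<phi> \<in> test_functions \<Omega>"
  let ?b = "axis j 1 :: real^'d"
  have b: "?b \<in> Basis" by (simp add: axis_in_Basis_iff)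
  have \<Omega>': "\<Omega> \<in> sets lebesgue" using \<Omega> by auto
  have sm: "smooth \<phi>" "smooth h" using \<phi> h by (auto simp: test_functions_def)
  have hi: "(\<lambda>x. h x $ i) \<in> test_functions \<Omega>" "(\<lambda>x. jacobian h x $ i $ j) \<in> test_functions \<Omega>"
    using test_functions_bounded_linear[OF bounded_linear_vec_nth h]
      test_functions_bounded_linear[OF bounded_linear_vec_nth2 jacobian_test_function[OF h]] by auto
  then have smi: "smooth (\<lambda>x. h x $ i)" by (simp add: test_functions_def)
  have d: "(\<lambda>x. grad \<phi> x $ j) \<in> test_functions \<Omega>"
    using test_functions_dir_deriv[OF \<phi> b] by (simp add: grad_def)
  have p: "(\<lambda>x. h x $ i * \<phi> x) \<in> test_functions \<Omega>"
    by (rule test_functions_mult[OF hi(1) sm(1)])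
  have eq: "dir_deriv ?b (\<lambda>x. h x $ i * \<phi> x) = (\<lambda>x. h x $ i * grad \<phi> x $ j + jacobian h x $ i $ j * \<phi> x)"
    unfolding dir_deriv_mult[OF smi sm(1)] dir_deriv_bounded_linear[OF bounded_linear_vec_nth sm(2)]
    by (simp add: grad_def jacobian_def)
  have "(LINT x|lebesgue_on \<Omega>. dir_deriv ?b (\<lambda>x. h x $ i * \<phi> x) x) = (LINT x|lebesgue. dir_deriv ?b (\<lambda>x. h x $ i * \<phi> x) x)"
  proof -
    have "dir_deriv ?b (\<lambda>x. h x $ i * \<phi> x) x = 0" if "x \<notin> \<Omega>" for x
      using p that by (intro dir_deriv_outside_support) (auto simp: test_functions_def)
    then have "(LINT x|lebesgue_on UNIV. dir_deriv ?b (\<lambda>x. h x $ i * \<phi> x) x) = (LINT x|lebesgue_on \<Omega>. dir_deriv ?b (\<lambda>x. h x $ i * \<phi> x) x)"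
      using \<Omega>' by (intro integral_lebesgue_on_superset(1)) auto
    then show ?thesis by (simp add: lebesgue_on_UNIV_eq)
  qed
  also have "\<dots> = 0"
    using p b by (intro integral_dir_deriv_eq_0) (auto simp: test_functions_def)
  finally have "(LINT x|lebesgue_on \<Omega>. h x $ i * grad \<phi> x $ j + jacobian h x $ i $ j * \<phi> x) = 0"
    unfolding eq .
  moreover have "integrable (lebesgue_on \<Omega>) (\<lambda>x. h x $ i * grad \<phi> x $ j)" "integrable (lebesgue_on \<Omega>) (\<lambda>x. jacobian h x $ i $ j * \<phi> x)"
    using hi d \<phi> by (auto intro!: integrable_mult_test[OF \<Omega>] locally_integrable_test)
  ultimately show "(LINT x|lebesgue_on \<Omega>. h x $ i * grad \<phi> x $ j) = - (LINT x|lebesgue_on \<Omega>. jacobian h x $ i $ j * \<phi> x)"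
    by simp
qed

text \<open>Uniqueness almost everywhere lets the choice behind \<open>weak_grad\<close> be replaced
  by any explicit weak gradient.\<close>

lemma weak_grad_AE_eq: "open \<Omega> \<Longrightarrow> has_weak_grad \<Omega> u G \<Longrightarrow> AE x in lebesgue_on \<Omega>. weak_grad \<Omega> u x = G x"
  unfolding weak_grad_def by (rule has_weak_grad_unique) (auto intro: someI[of "has_weak_grad \<Omega> u"])

lemma weak_div_AE_eq:
  assumes "open \<Omega>" "has_row_weak_div \<Omega> \<zeta> v" shows "AE x in lebesgue_on \<Omega>. weak_div \<Omega> \<zeta> x = v x"
proof -
  have "has_row_weak_div \<Omega> \<zeta> (weak_div \<Omega> \<zeta>)"
    unfolding weak_div_def by (rule someI[of "has_row_weak_div \<Omega> \<zeta>", OF assms(2)])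
  then have "AE x in lebesgue_on \<Omega>. weak_div \<Omega> \<zeta> x $ i = v x $ i" for i
    using assms unfolding has_row_weak_div_def has_weak_div_def
    by (intro AE_eq_by_test_functions) auto
  then have "AE x in lebesgue_on \<Omega>. \<forall>i. weak_div \<Omega> \<zeta> x $ i = v x $ i"
    by (simp add: AE_all_countable)
  then show ?thesis by eventually_elim (simp add: vec_eq_iff)
qed

section \<open>Sublinear functionals on function spaces\<close>

definition function_space :: "('x \<Rightarrow> 'y::real_vector) set \<Rightarrow> bool" where
  "function_space V \<longleftrightarrow> (\<lambda>x. 0) \<in> V \<and> (\<forall>f\<in>V. \<forall>g\<in>V. (\<lambda>x. f x + g x) \<in> V) \<and> (\<forall>f\<in>V. \<forall>c. (\<lambda>x. c *\<^sub>R f x) \<in> V)"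

definition sublinear_on :: "('x \<Rightarrow> 'y::real_vector) set \<Rightarrow> (('x \<Rightarrow> 'y) \<Rightarrow> real) \<Rightarrow> bool" where
  "sublinear_on V Q \<longleftrightarrow> (\<forall>f\<in>V. \<forall>g\<in>V. Q (\<lambda>x. f x + g x) \<le> Q f + Q g) \<and>
     (\<forall>f\<in>V. \<forall>c>0. Q (\<lambda>x. c *\<^sub>R f x) = c * Q f)"

lemma function_spaceD:
  assumes "function_space V"
  shows "(\<lambda>x. 0) \<in> V" "f \<in> V \<Longrightarrow> g \<in> V \<Longrightarrow> (\<lambda>x. f x + g x) \<in> V" "f \<in> V \<Longrightarrow> (\<lambda>x. c *\<^sub>R f x) \<in> V"
    "f \<in> V \<Longrightarrow> (\<lambda>x. - f x) \<in> V"
proof -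
  show "f \<in> V \<Longrightarrow> (\<lambda>x. - f x) \<in> V"
    using assms unfolding function_space_def by (metis (no_types, lifting) ext scaleR_minus1_left)
qed (use assms in \<open>auto simp: function_space_def\<close>)

lemma sublinear_onD:
  assumes "sublinear_on V Q"
  shows "f \<in> V \<Longrightarrow> g \<in> V \<Longrightarrow> Q (\<lambda>x. f x + g x) \<le> Q f + Q g" "f \<in> V \<Longrightarrow> 0 < c \<Longrightarrow> Q (\<lambda>x. c *\<^sub>R f x) = c * Q f"
  using assms by (auto simp: sublinear_on_def)

text \<open>Homogeneity is required for positive factors only; the factor 2 already gives
  \<open>Q 0 = 2 * Q 0\<close>.\<close>

lemma sublinear_on_zero:
  assumes "function_space V" "sublinear_on V Q" shows "Q (\<lambda>x. 0) = 0"
  using sublinear_onD(2)[OF assms(2) function_spaceD(1)[OF assms(1)], of 2] by simp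

lemma sublinear_on_neg:
  assumes "function_space V" "sublinear_on V Q" "f \<in> V" shows "- Q (\<lambda>x. - f x) \<le> Q f"
  using sublinear_onD(1)[OF assms(2,3) function_spaceD(4)[OF assms(1,3)]] sublinear_on_zero[OF assms(1,2)] by simp

text \<open>The reverse inequality is the assumed one for the factor \<open>1 / c\<close>, applied
  to \<open>c *\<^sub>R f\<close>.\<close>

lemma sublinear_onI:
  assumes "\<And>f g. f \<in> V \<Longrightarrow> g \<in> V \<Longrightarrow> Q (\<lambda>x. f x + g x) \<le> Q f + Q g"
    and le: "\<And>f c. f \<in> V \<Longrightarrow> 0 < c \<Longrightarrow> Q (\<lambda>x. c *\<^sub>R f x) \<le> c * Q f" and V: "function_space V"
  shows "sublinear_on V Q"
  unfolding sublinear_on_def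
proof (intro conjI ballI allI impI)
  fix f and c :: real assume f: "f \<in> V" and c: "0 < c"
  have "Q (\<lambda>x. (1 / c) *\<^sub>R (c *\<^sub>R f x)) \<le> (1 / c) * Q (\<lambda>x. c *\<^sub>R f x)"
    using c f by (intro le function_spaceD[OF V]) auto
  then have "c * Q f \<le> Q (\<lambda>x. c *\<^sub>R f x)" using c by (simp add: field_simps)
  with le[OF f c] show "Q (\<lambda>x. c *\<^sub>R f x) = c * Q f" by simp
qed (use assms in auto)

text \<open>Zorn's lemma, with the pointwise infimum as the bound of a chain. The infimum is finite
  because every sublinear \<open>Q \<le> P\<close> satisfies \<open>Q f \<ge> - P (- f)\<close>, a
  bound independent of \<open>Q\<close>.\<close>

lemma ex_minimal_sublinear:
  assumes V: "function_space V" and P: "sublinear_on V P"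
  obtains Q where "sublinear_on V Q" "\<And>f. f \<in> V \<Longrightarrow> Q f \<le> P f"
    "\<And>R. sublinear_on V R \<Longrightarrow> (\<And>f. f \<in> V \<Longrightarrow> R f \<le> Q f) \<Longrightarrow> (\<forall>f\<in>V. R f = Q f)"
proof -
  \<comment> \<open>Functionals are normalised to 0 outside \<open>V\<close>; otherwise the order on
    \<open>V\<close> would not be antisymmetric.\<close>
  define A where "A = {Q. sublinear_on V Q \<and> (\<forall>f\<in>V. Q f \<le> P f) \<and> (\<forall>f. f \<notin> V \<longrightarrow> Q f = 0)}"
  \<comment> \<open>The order is reversed, since Zorn yields maximal elements and a pointwise
    minimal functional is wanted.\<close>
  define le where "le Q R \<longleftrightarrow> (\<forall>f. R f \<le> Q f)" for Q R :: "('a \<Rightarrow> 'b) \<Rightarrow> real"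
  have cut: "(\<lambda>f. if f \<in> V then Q f else 0) \<in> A" if "sublinear_on V Q" "\<And>f. f \<in> V \<Longrightarrow> Q f \<le> P f" for Q
    using that function_spaceD(2,3)[OF V] by (auto simp: A_def sublinear_on_def)
  have "\<exists>m\<in>A. \<forall>a\<in>A. le m a \<longrightarrow> a = m"
  proof (rule predicate_Zorn)
    show "partial_order_on A (relation_of le A)"
      by (auto simp: partial_order_on_def preorder_on_def refl_on_def trans_def antisym_def relation_of_def le_def
          intro: order.trans intro!: ext antisym)
    fix C assume C: "C \<in> Chains (relation_of le A)"
    then have CA: "C \<subseteq> A" by (auto simp: Chains_def relation_of_def)
    have chain: "le Q R \<or> le R Q" if "Q \<in> C" "R \<in> C" for Q R
      using C that by (auto simp: Chains_def relation_of_def)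
    show "\<exists>u\<in>A. \<forall>a\<in>C. le a u"
    proof (cases "C = {}")
      case True
      then show ?thesis using cut[OF P] by blast
    next
      case False
      define u where "u f = (INF Q\<in>C. Q f)" for f
      have lb: "- P (\<lambda>x. - f x) \<le> Q f" if "Q \<in> C" "f \<in> V" for Q f
      proof -
        have "sublinear_on V Q" "Q (\<lambda>x. - f x) \<le> P (\<lambda>x. - f x)"
          using that CA function_spaceD(4)[OF V] unfolding A_def by auto
        then show ?thesis using sublinear_on_neg[OF V _ that(2), of Q] by linarith
      qed
      have u_le: "u f \<le> Q f" if "Q \<in> C" "f \<in> V" for Q f
        unfolding u_def using that lb by (intro cINF_lower bdd_belowI2) auto
      have le_u: "c \<le> u f" if "\<And>Q. Q \<in> C \<Longrightarrow> c \<le> Q f" for c f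
        unfolding u_def using False that by (intro cINF_greatest) auto
      have subl: "sublinear_on V Q" if "Q \<in> C" for Q using that CA by (auto simp: A_def)
      have "sublinear_on V u"
      proof (rule sublinear_onI[OF _ _ V])
        fix f g assume fg: "f \<in> V" "g \<in> V"
        have "u (\<lambda>x. f x + g x) \<le> Q f + R g" if QR: "Q \<in> C" "R \<in> C" for Q R
        proof -
          \<comment> \<open>Subadditivity of the infimum is where the chain property enters: one
            member lies below both \<open>Q\<close> and \<open>R\<close>.\<close>
          obtain S where S: "S \<in> C" "S f \<le> Q f" "S g \<le> R g"
            using chain[OF QR] QR unfolding le_def by blast
          have "u (\<lambda>x. f x + g x) \<le> S (\<lambda>x. f x + g x)"
            using S fg by (intro u_le function_spaceD[OF V]) auto
          also have "\<dots> \<le> S f + S g" using sublinear_onD(1)[OF subl[OF S(1)] fg] .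
          finally show ?thesis using S by linarith
        qed
        note le = this
        have "u (\<lambda>x. f x + g x) - Q f \<le> u g" if "Q \<in> C" for Q
          by (rule le_u) (use le[OF that] in \<open>simp add: diff_le_eq add.commute\<close>)
        then have "u (\<lambda>x. f x + g x) - u g \<le> u f" by (intro le_u) (simp add: diff_le_eq add.commute)
        then show "u (\<lambda>x. f x + g x) \<le> u f + u g" by simp
      next
        fix f and c :: real assume f: "f \<in> V" "0 < c"
        have "u (\<lambda>x. c *\<^sub>R f x) / c \<le> u f"
        proof (rule le_u)
          fix Q assume Q: "Q \<in> C"
          have "u (\<lambda>x. c *\<^sub>R f x) \<le> Q (\<lambda>x. c *\<^sub>R f x)" using Q f by (intro u_le function_spaceD[OF V]) auto
          also have "\<dots> = c * Q f" using sublinear_onD(2)[OF subl[OF Q] f] .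
          finally show "u (\<lambda>x. c *\<^sub>R f x) / c \<le> Q f" using f by (simp add: field_simps)
        qed
        then show "u (\<lambda>x. c *\<^sub>R f x) \<le> c * u f" using f by (simp add: field_simps)
      qed
      moreover have "u f \<le> P f" if "f \<in> V" for f
      proof -
        obtain Q where Q: "Q \<in> C" using False by blast
        then have "Q f \<le> P f" using CA that by (auto simp: A_def)
        then show ?thesis using u_le[OF Q that] by linarith
      qed
      ultimately have "(\<lambda>f. if f \<in> V then u f else 0) \<in> A" by (rule cut)
      moreover have "le Q (\<lambda>f. if f \<in> V then u f else 0)" if "Q \<in> C" for Q
        using that CA u_le by (auto simp: le_def A_def)
      ultimately show ?thesis by blast
    qed
  qed
  then obtain Q where Q: "Q \<in> A" "\<And>R. R \<in> A \<Longrightarrow> le Q R \<Longrightarrow> R = Q" by blast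
  show ?thesis
  proof (rule that)
    show "sublinear_on V Q" "f \<in> V \<Longrightarrow> Q f \<le> P f" for f using Q(1) by (auto simp: A_def)
    fix R assume R: "sublinear_on V R" "\<And>f. f \<in> V \<Longrightarrow> R f \<le> Q f"
    have "R f \<le> P f" if "f \<in> V" for f
      using R(2)[OF that] Q(1) that unfolding A_def by force
    then have "(\<lambda>f. if f \<in> V then R f else 0) \<in> A" by (intro cut R(1))
    moreover have "le Q (\<lambda>f. if f \<in> V then R f else 0)"
      using R(2) Q(1) by (auto simp: le_def A_def)
    ultimately have "(\<lambda>f. if f \<in> V then R f else 0) = Q" by (rule Q(2))
    then show "\<forall>f\<in>V. R f = Q f" by (metis (mono_tags))
  qed
qed

definition linear_on_functions :: "('x \<Rightarrow> 'y::real_vector) set \<Rightarrow> (('x \<Rightarrow> 'y) \<Rightarrow> real) \<Rightarrow> bool" where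
  "linear_on_functions V F \<longleftrightarrow> (\<forall>f\<in>V. \<forall>g\<in>V. F (\<lambda>x. f x + g x) = F f + F g) \<and>
     (\<forall>f\<in>V. \<forall>c. F (\<lambda>x. c *\<^sub>R f x) = c * F f)"

text \<open>A minimal sublinear functional is linear. Otherwise it could be lowered by discounting
  multiples of a fixed direction, so minimality forces superadditivity.\<close>

lemma Hahn_Banach_dominated:
  assumes V: "function_space V" and P: "sublinear_on V P"
  obtains F where "linear_on_functions V F" "\<And>f. f \<in> V \<Longrightarrow> F f \<le> P f"
proof -
  obtain Q where Q: "sublinear_on V Q" and QP: "\<And>f. f \<in> V \<Longrightarrow> Q f \<le> P f"
    and min: "\<And>R. sublinear_on V R \<Longrightarrow> (\<And>f. f \<in> V \<Longrightarrow> R f \<le> Q f) \<Longrightarrow> (\<forall>f\<in>V. R f = Q f)"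
    using ex_minimal_sublinear[OF V P] by blast
  note VD = function_spaceD[OF V] and QD = sublinear_onD[OF Q]
  have superadd: "Q f + Q g \<le> Q (\<lambda>x. f x + g x)" if fg: "f \<in> V" "g \<in> V" for f g
  proof -
    \<comment> \<open>This is sublinear and, with \<open>t = 0\<close>, lies below \<open>Q\<close>;
      minimality gives \<open>R = Q\<close> on \<open>V\<close>. Taking \<open>t = 1\<close> then
      yields the superadditivity.\<close>
    define R where "R f = (INF t\<in>{0..}. Q (\<lambda>x. f x + t *\<^sub>R g x) - t * Q g)" for f
    have tg: "Q (\<lambda>x. t *\<^sub>R g x) = t * Q g" if "0 \<le> t" for t
      using that QD(2)[OF fg(2), of t] sublinear_on_zero[OF V Q] by (cases "t = 0") auto
    have lb: "- Q (\<lambda>x. - f x) \<le> Q (\<lambda>x. f x + t *\<^sub>R g x) - t * Q g" if "f \<in> V" "0 \<le> t" for f t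
    proof -
      have "Q (\<lambda>x. (f x + t *\<^sub>R g x) + - f x) \<le> Q (\<lambda>x. f x + t *\<^sub>R g x) + Q (\<lambda>x. - f x)"
        using that fg by (intro QD VD)
      then show ?thesis using tg[OF that(2)] by simp
    qed
    have R_le: "R f \<le> Q (\<lambda>x. f x + t *\<^sub>R g x) - t * Q g" if "f \<in> V" "0 \<le> t" for f t
      unfolding R_def using that lb by (intro cINF_lower bdd_belowI2[where m = "- Q (\<lambda>x. - f x)"]) auto
    have le_R: "c \<le> R f" if "\<And>t. 0 \<le> t \<Longrightarrow> c \<le> Q (\<lambda>x. f x + t *\<^sub>R g x) - t * Q g" for c f
      unfolding R_def using that by (intro cINF_greatest) auto
    have "sublinear_on V R"
    proof (rule sublinear_onI[OF _ _ V])
      fix h k assume hk: "h \<in> V" "k \<in> V"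
      have "R (\<lambda>x. h x + k x) \<le> (Q (\<lambda>x. h x + s *\<^sub>R g x) - s * Q g) + (Q (\<lambda>x. k x + t *\<^sub>R g x) - t * Q g)"
        if "0 \<le> s" "0 \<le> t" for s t
      proof -
        have "R (\<lambda>x. h x + k x) \<le> Q (\<lambda>x. (h x + k x) + (s + t) *\<^sub>R g x) - (s + t) * Q g"
          using that hk by (intro R_le VD) auto
        also have "(\<lambda>x. (h x + k x) + (s + t) *\<^sub>R g x) = (\<lambda>x. (h x + s *\<^sub>R g x) + (k x + t *\<^sub>R g x))"
          by (simp add: algebra_simps)
        also have "Q \<dots> \<le> Q (\<lambda>x. h x + s *\<^sub>R g x) + Q (\<lambda>x. k x + t *\<^sub>R g x)"
          using hk fg by (intro QD VD)
        finally show ?thesis by (simp add: algebra_simps)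
      qed
      note le = this
      have le2: "R (\<lambda>x. h x + k x) - (Q (\<lambda>x. h x + s *\<^sub>R g x) - s * Q g) \<le> R k" if s: "0 \<le> s" for s
      proof (rule le_R)
        fix t :: real assume "0 \<le> t"
        from le[OF s this] show "R (\<lambda>x. h x + k x) - (Q (\<lambda>x. h x + s *\<^sub>R g x) - s * Q g) \<le> Q (\<lambda>x. k x + t *\<^sub>R g x) - t * Q g"
          by linarith
      qed
      have "R (\<lambda>x. h x + k x) - R k \<le> R h"
      proof (rule le_R)
        fix s :: real assume "0 \<le> s"
        from le2[OF this] show "R (\<lambda>x. h x + k x) - R k \<le> Q (\<lambda>x. h x + s *\<^sub>R g x) - s * Q g"
          by linarith
      qed
      then show "R (\<lambda>x. h x + k x) \<le> R h + R k" by simp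
    next
      fix h and c :: real assume h: "h \<in> V" "0 < c"
      have "R (\<lambda>x. c *\<^sub>R h x) / c \<le> R h"
      proof (rule le_R)
        fix t :: real assume t: "0 \<le> t"
        have "R (\<lambda>x. c *\<^sub>R h x) \<le> Q (\<lambda>x. c *\<^sub>R h x + (c * t) *\<^sub>R g x) - (c * t) * Q g"
          using t h by (intro R_le VD) auto
        also have "(\<lambda>x. c *\<^sub>R h x + (c * t) *\<^sub>R g x) = (\<lambda>x. c *\<^sub>R (h x + t *\<^sub>R g x))"
          by (simp add: algebra_simps)
        also have "Q \<dots> = c * Q (\<lambda>x. h x + t *\<^sub>R g x)" using h fg by (intro QD VD)
        finally show "R (\<lambda>x. c *\<^sub>R h x) / c \<le> Q (\<lambda>x. h x + t *\<^sub>R g x) - t * Q g"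
          using h by (simp add: field_simps)
      qed
      then show "R (\<lambda>x. c *\<^sub>R h x) \<le> c * R h" using h by (simp add: field_simps)
    qed
    moreover have "R h \<le> Q h" if "h \<in> V" for h using R_le[OF that, of 0] by simp
    ultimately have "R f = Q f" using min fg(1) by blast
    then show ?thesis using R_le[OF fg(1), of 1] by simp
  qed
  have add: "Q (\<lambda>x. f x + g x) = Q f + Q g" if "f \<in> V" "g \<in> V" for f g
    using superadd[OF that] QD(1)[OF that] by simp
  have neg: "Q (\<lambda>x. - f x) = - Q f" if "f \<in> V" for f
    using add[OF that VD(4)[OF that]] sublinear_on_zero[OF V Q] by simp
  have "Q (\<lambda>x. c *\<^sub>R f x) = c * Q f" if f: "f \<in> V" for c f
  proof (cases c "0 :: real" rule: linorder_cases)
    case less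
    then have "Q (\<lambda>x. - ((- c) *\<^sub>R f x)) = c * Q f"
      using neg[OF VD(3)[OF f, of "- c"]] QD(2)[OF f, of "- c"] by simp
    then show ?thesis by simp
  qed (use QD(2)[OF f] sublinear_on_zero[OF V Q] in auto)
  then show ?thesis using that[of Q] QP add unfolding linear_on_functions_def by blast
qed

text \<open>The infimum of \<open>P\<close> over translates by \<open>L\<close> is again sublinear,
  and is finite because \<open>0 \<le> P h \<le> P (f + h) + P (- f)\<close>. A linear functional
  below it is nonpositive on the subspace \<open>L\<close>, hence zero there.\<close>

lemma Hahn_Banach_annihilator:
  assumes V: "function_space V" and P: "sublinear_on V P"
    and L: "function_space L" "L \<subseteq> V" and nonneg: "\<And>h. h \<in> L \<Longrightarrow> 0 \<le> P h"
  obtains F where "linear_on_functions V F" "\<And>f. f \<in> V \<Longrightarrow> F f \<le> P f" "\<And>h. h \<in> L \<Longrightarrow> F h = 0"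
proof -
  note VD = function_spaceD[OF V] and LD = function_spaceD[OF L(1)] and PD = sublinear_onD[OF P]
  define R where "R f = (INF h\<in>L. P (\<lambda>x. f x + h x))" for f
  have lb: "- P (\<lambda>x. - f x) \<le> P (\<lambda>x. f x + h x)" if "f \<in> V" "h \<in> L" for f h
  proof -
    have "h \<in> V" using L(2) that(2) by auto
    then have "P (\<lambda>x. (f x + h x) + - f x) \<le> P (\<lambda>x. f x + h x) + P (\<lambda>x. - f x)"
      using that(1) by (intro PD VD)
    then show ?thesis using nonneg[OF that(2)] by simp
  qed
  have R_le: "R f \<le> P (\<lambda>x. f x + h x)" if "f \<in> V" "h \<in> L" for f h
    unfolding R_def using that lb by (intro cINF_lower bdd_belowI2[where m = "- P (\<lambda>x. - f x)"]) auto
  have le_R: "c \<le> R f" if "\<And>h. h \<in> L \<Longrightarrow> c \<le> P (\<lambda>x. f x + h x)" for c f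
    unfolding R_def using that LD(1) by (intro cINF_greatest) auto
  have "sublinear_on V R"
  proof (rule sublinear_onI[OF _ _ V])
    fix f g assume fg: "f \<in> V" "g \<in> V"
    have "R (\<lambda>x. f x + g x) \<le> P (\<lambda>x. f x + h x) + P (\<lambda>x. g x + k x)" if "h \<in> L" "k \<in> L" for h k
    proof -
      have hk: "h \<in> V" "k \<in> V" using L(2) that by auto
      have "R (\<lambda>x. f x + g x) \<le> P (\<lambda>x. (f x + g x) + (h x + k x))"
        using that fg by (intro R_le VD LD)
      also have "(\<lambda>x. (f x + g x) + (h x + k x)) = (\<lambda>x. (f x + h x) + (g x + k x))"
        by (simp add: algebra_simps)
      also have "P \<dots> \<le> P (\<lambda>x. f x + h x) + P (\<lambda>x. g x + k x)" using fg hk by (intro PD VD)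
      finally show ?thesis .
    qed
    note le = this
    have "R (\<lambda>x. f x + g x) - P (\<lambda>x. f x + h x) \<le> R g" if "h \<in> L" for h
      by (rule le_R) (use le[OF that] in \<open>simp add: diff_le_eq add.commute\<close>)
    then have "R (\<lambda>x. f x + g x) - R g \<le> R f" by (intro le_R) (simp add: diff_le_eq add.commute)
    then show "R (\<lambda>x. f x + g x) \<le> R f + R g" by simp
  next
    fix f and c :: real assume f: "f \<in> V" "0 < c"
    have "R (\<lambda>x. c *\<^sub>R f x) / c \<le> R f"
    proof (rule le_R)
      fix h assume h: "h \<in> L"
      then have hV: "h \<in> V" using L(2) by auto
      have "R (\<lambda>x. c *\<^sub>R f x) \<le> P (\<lambda>x. c *\<^sub>R f x + c *\<^sub>R h x)"
        using h f by (intro R_le VD LD)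
      also have "(\<lambda>x. c *\<^sub>R f x + c *\<^sub>R h x) = (\<lambda>x. c *\<^sub>R (f x + h x))" by (simp add: algebra_simps)
      also have "P \<dots> = c * P (\<lambda>x. f x + h x)" using f hV by (intro PD VD)
      finally show "R (\<lambda>x. c *\<^sub>R f x) / c \<le> P (\<lambda>x. f x + h x)" using f by (simp add: field_simps)
    qed
    then show "R (\<lambda>x. c *\<^sub>R f x) \<le> c * R f" using f by (simp add: field_simps)
  qed
  then obtain F where F: "linear_on_functions V F" "\<And>f. f \<in> V \<Longrightarrow> F f \<le> R f"
    using Hahn_Banach_dominated[OF V] by blast
  have nonpos: "F h \<le> 0" if h: "h \<in> L" for h
  proof -
    have "h \<in> V" using L(2) h by auto
    then have "F h \<le> R h" by (rule F)
    \<comment> \<open>The infimum is tested with \<open>- h\<close>, which also belongs to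
      \<open>L\<close>.\<close>
    also have "\<dots> \<le> P (\<lambda>x. h x + - h x)" using h \<open>h \<in> V\<close> by (intro R_le LD)
    also have "\<dots> = 0" using sublinear_on_zero[OF V P] by simp
    finally show ?thesis .
  qed
  have "F h = 0" if h: "h \<in> L" for h
  proof -
    have "h \<in> V" using L(2) h by auto
    then have "F (\<lambda>x. (- 1) *\<^sub>R h x) = (- 1) * F h"
      using F(1) unfolding linear_on_functions_def by blast
    moreover have "F (\<lambda>x. (- 1) *\<^sub>R h x) \<le> 0" using h by (intro nonpos LD)
    ultimately show ?thesis using nonpos[OF h] by linarith
  qed
  moreover have "F f \<le> P f" if "f \<in> V" for f
    using F(2)[OF that] R_le[OF that LD(1)] by simp
  ultimately show ?thesis using F(1) that by blast
qed

section \<open>Systems of convex inequalities\<close>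

text \<open>Separation of the origin from a convex set in the plane. The abstract
  \<open>comb\<close> stands for convex combinations, so that \<open>K\<close> may consist of
  functions.\<close>

lemma two_convex_inequalities:
  fixes s t :: "'k \<Rightarrow> real" and comb :: "real \<Rightarrow> 'k \<Rightarrow> 'k \<Rightarrow> 'k"
  assumes K: "\<And>f g c. f \<in> K \<Longrightarrow> g \<in> K \<Longrightarrow> 0 \<le> c \<Longrightarrow> c \<le> 1 \<Longrightarrow> comb c f g \<in> K"
    and s: "\<And>f g c. f \<in> K \<Longrightarrow> g \<in> K \<Longrightarrow> 0 \<le> c \<Longrightarrow> c \<le> 1 \<Longrightarrow> s (comb c f g) \<le> (1 - c) * s f + c * s g"
    and t: "\<And>f g c. f \<in> K \<Longrightarrow> g \<in> K \<Longrightarrow> 0 \<le> c \<Longrightarrow> c \<le> 1 \<Longrightarrow> t (comb c f g) \<le> (1 - c) * t f + c * t g"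
    and no: "\<And>f. f \<in> K \<Longrightarrow> 0 \<le> s f \<or> 0 \<le> t f"
  obtains c where "0 \<le> c" "c \<le> 1" "\<And>f. f \<in> K \<Longrightarrow> 0 \<le> (1 - c) * s f + c * t f"
proof (cases "K = {}")
  case True
  then show ?thesis using that[of 0] by simp
next
  case False
  \<comment> \<open>The set of pairs strictly above some \<open>(s f, t f)\<close> is convex
    although the image of \<open>K\<close> need not be, and it is closed upwards.\<close>
  define C where "C = {(a, b). \<exists>f\<in>K. s f < a \<and> t f < b}"
  have "convex C"
    unfolding convex_alt
  proof (intro ballI allI impI)
    fix p q :: "real \<times> real" and u :: real assume pq: "p \<in> C" "q \<in> C" and u: "0 \<le> u \<and> u \<le> 1"
    obtain f where f: "f \<in> K" "s f < fst p" "t f < snd p" using pq(1) by (auto simp: C_def)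
    obtain g where g: "g \<in> K" "s g < fst q" "t g < snd q" using pq(2) by (auto simp: C_def)
    have lt: "(1 - u) * a + u * b < (1 - u) * a' + u * b'" if "a < a'" "b < b'" for a b a' b' :: real
      using u that convex_bound_lt[of "a - a'" 0 "b - b'" "1 - u" u] by (simp add: algebra_simps)
    have "s (comb u f g) < (1 - u) * fst p + u * fst q" "t (comb u f g) < (1 - u) * snd p + u * snd q"
      using s[OF f(1) g(1)] t[OF f(1) g(1)] u lt[OF f(2) g(2)] lt[OF f(3) g(3)] by force+
    then show "(1 - u) *\<^sub>R p + u *\<^sub>R q \<in> C"
      using K[OF f(1) g(1)] u unfolding C_def by (auto simp: case_prod_unfold)
  qed
  moreover have "0 \<notin> C" using no by (force simp: C_def zero_prod_def)
  ultimately have "\<exists>n. n \<noteq> 0 \<and> (\<forall>p\<in>C. 0 \<le> n \<bullet> p)" by (rule separating_hyperplane_set_0)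
  then obtain n where n: "n \<noteq> 0" "\<And>p. p \<in> C \<Longrightarrow> 0 \<le> n \<bullet> p" by auto
  obtain a b where ab: "n = (a, b)" by fastforce
  have ge: "0 \<le> a * x + b * y" if "f \<in> K" "s f < x" "t f < y" for f x y
    using n(2)[of "(x, y)"] that unfolding C_def ab by auto
  obtain f0 where f0: "f0 \<in> K" using False by blast
  have "0 \<le> a"
  proof (rule ccontr)
    assume "\<not> 0 \<le> a"
    \<comment> \<open>Upward closedness excludes a negative entry of the normal: with the other
      coordinate fixed, \<open>z\<close> is large enough to make the inner product negative.\<close>
    moreover define z where "z = max (s f0 + 1) ((\<bar>b * (t f0 + 1)\<bar> + 1) / (- a))"
    ultimately have "\<bar>b * (t f0 + 1)\<bar> + 1 \<le> - a * z"
      by (simp add: field_simps max_def)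
    moreover have "0 \<le> a * z + b * (t f0 + 1)" using f0 by (intro ge[of f0]) (auto simp: z_def)
    ultimately show False by linarith
  qed
  have "0 \<le> b"
  proof (rule ccontr)
    assume "\<not> 0 \<le> b"
    moreover define z where "z = max (t f0 + 1) ((\<bar>a * (s f0 + 1)\<bar> + 1) / (- b))"
    ultimately have "\<bar>a * (s f0 + 1)\<bar> + 1 \<le> - b * z"
      by (simp add: field_simps max_def)
    moreover have "0 \<le> a * (s f0 + 1) + b * z" using f0 by (intro ge[of f0]) (auto simp: z_def)
    ultimately show False by linarith
  qed
  have pos: "0 < a + b" using n(1) \<open>0 \<le> a\<close> \<open>0 \<le> b\<close> by (auto simp: ab zero_prod_def)
  \<comment> \<open>Points of \<open>C\<close> lie strictly above \<open>(s f, t f)\<close>; raising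
    both coordinates by \<open>e / (a + b)\<close> costs exactly \<open>e\<close>.\<close>
  have "0 \<le> a * s f + b * t f" if "f \<in> K" for f
  proof (rule field_le_epsilon)
    fix e :: real assume "0 < e"
    then have "0 \<le> a * (s f + e / (a + b)) + b * (t f + e / (a + b))"
      using pos that by (intro ge) auto
    also have "\<dots> = a * s f + b * t f + (a + b) * (e / (a + b))"
      by (simp only: algebra_simps)
    also have "(a + b) * (e / (a + b)) = e" using pos by simp
    finally show "0 \<le> a * s f + b * t f + e" .
  qed
  moreover have "1 - b / (a + b) = a / (a + b)" using pos by (simp add: field_simps)
  ultimately have "0 \<le> (1 - b / (a + b)) * s f + b / (a + b) * t f" if "f \<in> K" for f
    using that pos by (simp add: add_divide_distrib[symmetric])
  then show ?thesis
    using that[of "b / (a + b)"] pos \<open>0 \<le> a\<close> \<open>0 \<le> b\<close> by (simp add: field_simps)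
qed

text \<open>A theorem of the alternative, by induction on the index set. On the convex part of
  \<open>K\<close> where \<open>s j\<close> is negative the other inequalities cannot all hold, so a
  combination of them is nonnegative there; this combination and \<open>s j\<close> form a system of
  two.\<close>

lemma convex_inequality_system:
  fixes s :: "'i \<Rightarrow> 'k \<Rightarrow> real" and comb :: "real \<Rightarrow> 'k \<Rightarrow> 'k \<Rightarrow> 'k"
  assumes "finite A" "A \<noteq> {}"
    and "\<And>f g c. f \<in> K \<Longrightarrow> g \<in> K \<Longrightarrow> 0 \<le> c \<Longrightarrow> c \<le> 1 \<Longrightarrow> comb c f g \<in> K"
    and "\<And>i f g c. i \<in> A \<Longrightarrow> f \<in> K \<Longrightarrow> g \<in> K \<Longrightarrow> 0 \<le> c \<Longrightarrow> c \<le> 1 \<Longrightarrow>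
      s i (comb c f g) \<le> (1 - c) * s i f + c * s i g"
    and "\<And>f. f \<in> K \<Longrightarrow> \<exists>i\<in>A. 0 \<le> s i f"
  shows "\<exists>lam. (\<forall>i\<in>A. 0 \<le> lam i) \<and> (\<Sum>i\<in>A. lam i) = 1 \<and> (\<forall>f\<in>K. 0 \<le> (\<Sum>i\<in>A. lam i * s i f))"
  using assms
proof (induction A arbitrary: K rule: finite_ne_induct)
  case (singleton i)
  then show ?case by (intro exI[of _ "\<lambda>_. 1"]) auto
next
  case (insert j A)
  note K = insert.prems(1) and conv = insert.prems(2) and no = insert.prems(3)
  let ?K = "{f\<in>K. s j f < 0}"
  have "\<exists>lam. (\<forall>i\<in>A. 0 \<le> lam i) \<and> (\<Sum>i\<in>A. lam i) = 1 \<and> (\<forall>f\<in>?K. 0 \<le> (\<Sum>i\<in>A. lam i * s i f))"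
  proof (rule insert.IH)
    fix f g c assume fg: "f \<in> ?K" "g \<in> ?K" "(0::real) \<le> c" "c \<le> 1"
    have "s j (comb c f g) \<le> (1 - c) * s j f + c * s j g" using fg by (intro conv) auto
    also have "\<dots> < 0" using fg convex_bound_lt[of "s j f" 0 "s j g" "1 - c" c] by simp
    finally show "comb c f g \<in> ?K" using K fg by auto
  next
    fix f assume "f \<in> ?K"
    then show "\<exists>i\<in>A. 0 \<le> s i f" using no[of f] by auto
  qed (use conv in auto)
  then obtain lam where lam: "\<And>i. i \<in> A \<Longrightarrow> 0 \<le> lam i" "(\<Sum>i\<in>A. lam i) = 1"
    "\<And>f. f \<in> ?K \<Longrightarrow> 0 \<le> (\<Sum>i\<in>A. lam i * s i f)" by blast
  obtain c where c: "0 \<le> c" "c \<le> 1" "\<And>f. f \<in> K \<Longrightarrow> 0 \<le> (1 - c) * s j f + c * (\<Sum>i\<in>A. lam i * s i f)"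
  proof (rule two_convex_inequalities[of K comb "s j" "\<lambda>f. \<Sum>i\<in>A. lam i * s i f"])
    fix f g c assume fg: "f \<in> K" "g \<in> K" "(0::real) \<le> c" "c \<le> 1"
    show "comb c f g \<in> K" "s j (comb c f g) \<le> (1 - c) * s j f + c * s j g"
      using K conv fg by auto
    have "(\<Sum>i\<in>A. lam i * s i (comb c f g)) \<le> (\<Sum>i\<in>A. lam i * ((1 - c) * s i f + c * s i g))"
      using conv fg lam(1) by (intro sum_mono mult_left_mono) auto
    also have "\<dots> = (1 - c) * (\<Sum>i\<in>A. lam i * s i f) + c * (\<Sum>i\<in>A. lam i * s i g)"
      by (simp add: sum_distrib_left sum.distrib algebra_simps sum_subtractf)
    finally show "(\<Sum>i\<in>A. lam i * s i (comb c f g)) \<le> (1 - c) * (\<Sum>i\<in>A. lam i * s i f) + c * (\<Sum>i\<in>A. lam i * s i g)" .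
  next
    fix f assume "f \<in> K"
    then show "0 \<le> s j f \<or> 0 \<le> (\<Sum>i\<in>A. lam i * s i f)" using lam(3)[of f] by (cases "s j f < 0") auto
  qed blast
  \<comment> \<open>The earlier multipliers are scaled by \<open>c\<close> to leave the weight
    \<open>1 - c\<close> for the new index; the total stays 1.\<close>
  define lam' where "lam' i = (if i = j then 1 - c else c * lam i)" for i
  have "(\<Sum>i\<in>A. lam' i * x i) = c * (\<Sum>i\<in>A. lam i * x i)" for x
    unfolding sum_distrib_left using insert.hyps by (intro sum.cong) (auto simp: lam'_def)
  from this this[of "\<lambda>_. 1"] show ?case
    using insert.hyps lam c by (intro exI[of _ lam']) (auto simp: lam'_def)
qed

section \<open>Integral representation\<close>

text \<open>Adding the integral of \<open>w\<close> makes \<open>a\<close> nonnegative and bounded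
  by twice that integral. This forces continuity at the empty set, hence countable additivity and
  absolute continuity; the Radon-Nikodym density minus \<open>w\<close> represents
  \<open>a\<close>.\<close>

lemma (in sigma_finite_measure) dominated_additive_set_function_density:
  fixes a :: "'a set \<Rightarrow> real" and w :: "'a \<Rightarrow> real"
  assumes w: "integrable M w" "\<And>x. 0 \<le> w x"
    and add: "\<And>A B. A \<in> sets M \<Longrightarrow> B \<in> sets M \<Longrightarrow> A \<inter> B = {} \<Longrightarrow> a (A \<union> B) = a A + a B"
    and bound: "\<And>A. A \<in> sets M \<Longrightarrow> \<bar>a A\<bar> \<le> (LINT x:A|M. w x)"
  obtains g where "integrable M g" "\<And>A. A \<in> sets M \<Longrightarrow> a A = (LINT x:A|M. g x)"
proof -
  define b where "b A = a A + (LINT x:A|M. w x)" for A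
  have wi: "set_integrable M A w" if "A \<in> sets M" for A
    unfolding set_integrable_def by (rule integrable_mult_indicator[OF that w(1)])
  have b0: "0 \<le> b A" "b A \<le> 2 * (LINT x:A|M. w x)" if "A \<in> sets M" for A
    using bound[OF that] unfolding b_def by auto
  have "countably_additive (sets M) (\<lambda>A. ennreal (b A))"
  proof (rule sets.empty_continuous_imp_countably_additive)
    have "a {} = 0" using add[of "{}" "{}"] by simp
    then show "positive (sets M) (\<lambda>A. ennreal (b A))" by (simp add: positive_def b_def set_lebesgue_integral_def)
    show "additive (sets M) (\<lambda>A. ennreal (b A))"
      using b0(1) wi by (auto simp: additive_def b_def add set_integral_Un ac_simps simp flip: ennreal_plus)
    show "\<forall>A\<in>sets M. ennreal (b A) \<noteq> \<infinity>" by simp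
    fix A :: "nat \<Rightarrow> 'a set" assume A: "range A \<subseteq> sets M" "decseq A" "(\<Inter>i. A i) = {}"
    then have mA: "A i \<in> sets M" for i by auto
    have "(\<lambda>i. LINT x:A i|M. w x) \<longlonglongrightarrow> (LINT x|M. 0)"
      unfolding set_lebesgue_integral_def
    proof (rule integral_dominated_convergence[where w = w])
      show "AE x in M. (\<lambda>i. indicator (A i) x *\<^sub>R w x) \<longlonglongrightarrow> 0"
      proof (rule AE_I2)
        fix x
        obtain i where "x \<notin> A i" using A(3) by auto
        then have "\<forall>j\<ge>i. x \<notin> A j" using A(2) by (auto dest: decseqD)
        then have "\<forall>\<^sub>F j in sequentially. indicator (A j) x *\<^sub>R w x = 0"
          unfolding eventually_sequentially by (intro exI[of _ i]) auto
        then show "(\<lambda>i. indicator (A i) x *\<^sub>R w x) \<longlonglongrightarrow> 0" by (rule tendsto_eventually)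
      qed
      show "AE x in M. norm (indicator (A i) x *\<^sub>R w x) \<le> w x" for i
        using w(2) by (auto simp: indicator_def)
    qed (use w mA integrable_mult_indicator[OF mA w(1)] in auto)
    then have "(\<lambda>i. 2 * (LINT x:A i|M. w x)) \<longlonglongrightarrow> 0"
      using tendsto_mult_right_zero[of _ _ 2] by simp
    then have "(\<lambda>i. b (A i)) \<longlonglongrightarrow> 0"
      by (rule tendsto_sandwich[OF _ _ tendsto_const, rotated 2]) (use b0 mA in auto)
    then show "(\<lambda>i. ennreal (b (A i))) \<longlonglongrightarrow> 0" using tendsto_ennrealI by fastforce
  qed
  moreover have "positive (sets M) (\<lambda>A. ennreal (b A))"
  proof -
    have "a {} = 0" using add[of "{}" "{}"] by simp
    then show ?thesis by (simp add: positive_def b_def set_lebesgue_integral_def)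
  qed
  moreover define N where "N = measure_of (space M) (sets M) (\<lambda>A. ennreal (b A))"
  ultimately have N: "emeasure N A = ennreal (b A)" if "A \<in> sets M" for A
    using that unfolding N_def by (intro emeasure_measure_of_sigma sets.sigma_algebra_axioms)
  have sN: "sets N = sets M" unfolding N_def by simp
  have "absolutely_continuous M N"
    unfolding absolutely_continuous_def
  proof
    fix A assume A: "A \<in> null_sets M"
    then have mA: "A \<in> sets M" by auto
    have "AE x in M. x \<notin> A" by (rule AE_not_in[OF A])
    then have "(LINT x:A|M. w x) = (LINT x|M. 0)"
      unfolding set_lebesgue_integral_def using mA w by (intro integral_cong_AE) (auto intro!: borel_measurable_scaleR borel_measurable_indicator)
    then have "b A = 0" using b0[OF mA] by simp
    then show "A \<in> null_sets N" using mA N sN by (auto intro: null_setsI)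
  qed
  then obtain f where f: "f \<in> borel_measurable M" "density M f = N"
    using Radon_Nikodym[OF _ sN] by blast
  have fA: "(\<integral>\<^sup>+x. f x * indicator A x \<partial>M) = ennreal (b A)" if "A \<in> sets M" for A
    using N[OF that] f that by (metis emeasure_density)
  have "(\<integral>\<^sup>+x. f x \<partial>M) \<noteq> \<infinity>"
    using fA[OF sets.top] by (simp cong: nn_integral_cong)
  then have fin: "AE x in M. f x \<noteq> \<infinity>" using f(1) by (rule nn_integral_PInf_AE[rotated])
  have fA': "(\<integral>\<^sup>+x. ennreal (enn2real (f x) * indicator A x) \<partial>M) = ennreal (b A)" if "A \<in> sets M" for A
    unfolding fA[OF that, symmetric]
    by (rule nn_integral_cong_AE) (use fin in eventually_elim, auto simp: indicator_def less_top)
  have fi: "integrable M (\<lambda>x. enn2real (f x))"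
    using fA'[OF sets.top] f(1) by (intro integrableI_nn_integral_finite) (auto cong: nn_integral_cong)
  have eq: "(LINT x:A|M. enn2real (f x)) = b A" if "A \<in> sets M" for A
    using fA'[OF that] b0(1)[OF that] that f(1) unfolding set_lebesgue_integral_def
    by (subst integral_eq_nn_integral) (auto simp: mult.commute)
  show ?thesis
  proof (rule that)
    show "integrable M (\<lambda>x. enn2real (f x) - w x)" using fi w by auto
    fix A assume A: "A \<in> sets M"
    have "set_integrable M A (\<lambda>x. enn2real (f x))"
      unfolding set_integrable_def by (rule integrable_mult_indicator[OF A fi])
    then show "a A = (LINT x:A|M. (enn2real (f x) - w x))"
      using eq[OF A] wi[OF A] by (simp add: b_def)
  qed
qed

lemma dense_le_imp_le:
  fixes f g :: "'y::euclidean_space \<Rightarrow> real"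
  assumes "continuous_on UNIV f" "continuous_on UNIV g" "\<And>X. open X \<Longrightarrow> X \<noteq> {} \<Longrightarrow> \<exists>d\<in>D. d \<in> X"
    and "\<And>d. d \<in> D \<Longrightarrow> f d \<le> g d"
  shows "f x \<le> g x"
proof (rule ccontr)
  assume "\<not> f x \<le> g x"
  moreover have "open {x. g x < f x}" using assms(1,2) by (rule open_Collect_less[rotated])
  ultimately obtain d where "d \<in> D" "g d < f d"
    using assms(3)[of "{x. g x < f x}"] by (auto simp: not_le)
  then show False using assms(4) by fastforce
qed

text \<open>The natural domain of the functional integrating \<open>\<sigma> x (\<eta> x)\<close>
  when \<open>\<bar>\<sigma> x y\<bar> \<le> \<rho> x * norm y\<close>. It takes the place of the
  Lebesgue spaces and their duals.\<close>

definition weighted_L1 :: "'a measure \<Rightarrow> ('a \<Rightarrow> real) \<Rightarrow> ('a \<Rightarrow> 'y::euclidean_space) set" where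
  "weighted_L1 M \<rho> = {\<eta> \<in> borel_measurable M. integrable M (\<lambda>x. \<rho> x * norm (\<eta> x))}"

lemma function_space_weighted_L1:
  assumes [measurable]: "\<rho> \<in> borel_measurable M" and \<rho>: "\<And>x. 0 \<le> \<rho> x"
  shows "function_space (weighted_L1 M \<rho>)"
  unfolding function_space_def weighted_L1_def
proof (intro conjI ballI allI CollectI)
  fix f g :: "'a \<Rightarrow> 'b" and c :: real
  assume f: "f \<in> {\<eta> \<in> borel_measurable M. integrable M (\<lambda>x. \<rho> x * norm (\<eta> x))}"
  then have [measurable]: "f \<in> borel_measurable M" by simp
  have "integrable M (\<lambda>x. \<bar>c\<bar> * (\<rho> x * norm (f x)))" using f by auto
  then show "integrable M (\<lambda>x. \<rho> x * norm (c *\<^sub>R f x))" by (simp add: mult.left_commute)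
  assume g: "g \<in> {\<eta> \<in> borel_measurable M. integrable M (\<lambda>x. \<rho> x * norm (\<eta> x))}"
  then have [measurable]: "g \<in> borel_measurable M" by simp
  show "integrable M (\<lambda>x. \<rho> x * norm (f x + g x))"
  proof (rule Bochner_Integration.integrable_bound)
    show "integrable M (\<lambda>x. \<rho> x * norm (f x) + \<rho> x * norm (g x))" using f g by auto
    show "AE x in M. norm (\<rho> x * norm (f x + g x)) \<le> norm (\<rho> x * norm (f x) + \<rho> x * norm (g x))"
    proof (rule AE_I2)
      fix x
      have "\<rho> x * norm (f x + g x) \<le> \<rho> x * (norm (f x) + norm (g x))"
        using \<rho> by (intro mult_left_mono norm_triangle_ineq)
      then show "norm (\<rho> x * norm (f x + g x)) \<le> norm (\<rho> x * norm (f x) + \<rho> x * norm (g x))"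
        using \<rho>[of x] by (simp add: algebra_simps)
    qed
  qed measurable
qed auto

text \<open>Multiplication by \<open>\<tau>\<close> brings constant vectors into the weighted space.
  A positive integrable function exists by sigma-finiteness, and dividing it by
  \<open>1 + \<rho>\<close> absorbs the factor \<open>\<rho>\<close>.\<close>

lemma (in sigma_finite_measure) ex_positive_weight:
  assumes [measurable]: "\<rho> \<in> borel_measurable M" and \<rho>: "\<And>x. 0 \<le> \<rho> x"
  obtains \<tau> :: "'a \<Rightarrow> real" where "\<tau> \<in> borel_measurable M" "\<And>x. x \<in> space M \<Longrightarrow> 0 < \<tau> x" "\<And>x. 0 \<le> \<tau> x"
    "integrable M (\<lambda>x. \<rho> x * \<tau> x)"
proof -
  obtain h where h[measurable]: "h \<in> borel_measurable M" and hf: "integral\<^sup>N M h \<noteq> \<infinity>" "\<And>x. x \<in> space M \<Longrightarrow> 0 < h x \<and> h x < \<infinity>"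
    using Ex_finite_integrable_function by blast
  have "integrable M (\<lambda>x. enn2real (h x))"
  proof (rule integrableI_nonneg)
    have "(\<integral>\<^sup>+x. ennreal (enn2real (h x)) \<partial>M) = integral\<^sup>N M h"
      using hf(2) by (intro nn_integral_cong) auto
    then show "(\<integral>\<^sup>+x. ennreal (enn2real (h x)) \<partial>M) < \<infinity>" using hf(1) by (simp add: less_top)
  qed auto
  then have "integrable M (\<lambda>x. \<rho> x * (enn2real (h x) / (1 + \<rho> x)))"
  proof (rule Bochner_Integration.integrable_bound)
    show "AE x in M. norm (\<rho> x * (enn2real (h x) / (1 + \<rho> x))) \<le> norm (enn2real (h x))"
    proof (rule AE_I2)
      fix x
      have "\<rho> x / (1 + \<rho> x) \<le> 1" "0 \<le> \<rho> x / (1 + \<rho> x)" using \<rho>[of x] by auto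
      then have "\<rho> x / (1 + \<rho> x) * enn2real (h x) \<le> 1 * enn2real (h x)" by (intro mult_right_mono) auto
      then show "norm (\<rho> x * (enn2real (h x) / (1 + \<rho> x))) \<le> norm (enn2real (h x))"
        using \<rho>[of x] by simp
    qed
  qed measurable
  moreover have "0 < enn2real (h x) / (1 + \<rho> x)" if "x \<in> space M" for x
    using hf(2)[OF that] \<rho>[of x] by (auto simp: enn2real_positive_iff intro!: divide_pos_pos)
  moreover have "0 \<le> enn2real (h x) / (1 + \<rho> x)" for x using \<rho>[of x] by auto
  ultimately show ?thesis using that[of "\<lambda>x. enn2real (h x) / (1 + \<rho> x)"] by auto
qed

text \<open>Along each basis vector, \<open>F\<close> on the fields \<open>T A k\<close> is an
  additive set function dominated by the integral of \<open>\<rho> * \<tau>\<close>, hence has a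
  density. The bound by \<open>\<sigma>\<close> implies \<open>norm (v x) \<le> \<rho> x\<close>,
  and this bound carries the formula for \<open>F\<close> from simple fields to all of the
  space.\<close>

lemma (in sigma_finite_measure) linear_functional_representation:
  fixes F :: "('a \<Rightarrow> 'y::euclidean_space) \<Rightarrow> real" and \<sigma> :: "'a \<Rightarrow> 'y \<Rightarrow> real"
  assumes m\<rho>[measurable]: "\<rho> \<in> borel_measurable M" and \<rho>: "\<And>x. 0 \<le> \<rho> x"
    and F: "linear_on_functions (weighted_L1 M \<rho>) F"
    and F_le: "\<And>\<eta>. \<eta> \<in> weighted_L1 M \<rho> \<Longrightarrow> F \<eta> \<le> (LINT x|M. \<sigma> x (\<eta> x))"
    and m\<sigma>: "\<And>\<eta>. \<eta> \<in> borel_measurable M \<Longrightarrow> (\<lambda>x. \<sigma> x (\<eta> x)) \<in> borel_measurable M"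
    and \<sigma>_bound: "\<And>x y. \<bar>\<sigma> x y\<bar> \<le> \<rho> x * norm y"
    and \<sigma>_hom: "\<And>x y c. 0 < c \<Longrightarrow> \<sigma> x (c *\<^sub>R y) = c * \<sigma> x y"
    and \<sigma>_cont: "\<And>x. continuous_on UNIV (\<sigma> x)"
  obtains v where "v \<in> borel_measurable M" "AE x in M. \<forall>y. v x \<bullet> y \<le> \<sigma> x y"
    "\<And>\<eta>. \<eta> \<in> weighted_L1 M \<rho> \<Longrightarrow> F \<eta> = (LINT x|M. v x \<bullet> \<eta> x)"
proof -
  let ?V = "weighted_L1 M \<rho> :: ('a \<Rightarrow> 'y) set"
  note VD = function_spaceD[OF function_space_weighted_L1[OF m\<rho> \<rho>]]
  have F_add: "F (\<lambda>x. f x + g x) = F f + F g" and F_scale: "F (\<lambda>x. c *\<^sub>R f x) = c * F f"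
    if "f \<in> ?V" "g \<in> ?V" for f g c using F that unfolding linear_on_functions_def by auto
  have F_zero: "F (\<lambda>x. 0) = 0" using F_scale[OF VD(1) VD(1), of 0] by simp
  have F_sum: "F (\<lambda>x. \<Sum>i\<in>I. f i x) = (\<Sum>i\<in>I. F (f i))" and V_sum: "(\<lambda>x. \<Sum>i\<in>I. f i x) \<in> ?V"
    if "\<And>i. i \<in> I \<Longrightarrow> f i \<in> ?V" for I :: "'y set" and f
  proof -
    have "F (\<lambda>x. \<Sum>i\<in>I. f i x) = (\<Sum>i\<in>I. F (f i)) \<and> (\<lambda>x. \<Sum>i\<in>I. f i x) \<in> ?V"
      using that by (induction I rule: infinite_finite_induct) (auto simp: F_zero F_add VD)
    then show "F (\<lambda>x. \<Sum>i\<in>I. f i x) = (\<Sum>i\<in>I. F (f i))" "(\<lambda>x. \<Sum>i\<in>I. f i x) \<in> ?V" by auto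
  qed
  have F_bound1: "F \<eta> \<le> (LINT x|M. \<rho> x * norm (\<eta> x))" if "\<eta> \<in> ?V" for \<eta>
  proof -
    have [measurable]: "\<eta> \<in> borel_measurable M" and i: "integrable M (\<lambda>x. \<rho> x * norm (\<eta> x))"
      using that by (auto simp: weighted_L1_def)
    have "integrable M (\<lambda>x. \<sigma> x (\<eta> x))"
      by (rule Bochner_Integration.integrable_bound[OF i]) (use m\<sigma> \<sigma>_bound \<rho> in \<open>auto simp: abs_mult\<close>)
    then have "(LINT x|M. \<sigma> x (\<eta> x)) \<le> (LINT x|M. \<rho> x * norm (\<eta> x))"
      using i \<sigma>_bound by (intro integral_mono) (auto intro: order.trans[OF abs_ge_self])
    with F_le[OF that] show ?thesis by linarith
  qed
  have F_bound: "\<bar>F \<eta>\<bar> \<le> (LINT x|M. \<rho> x * norm (\<eta> x))" if "\<eta> \<in> ?V" for \<eta>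
  proof -
    have "F (\<lambda>x. (- 1) *\<^sub>R \<eta> x) = - F \<eta>" using F_scale[OF that that, of "- 1"] by simp
    then show ?thesis using F_bound1[OF that] F_bound1[OF VD(3)[OF that, of "- 1"]] by simp
  qed
  have F_diff: "\<bar>F \<eta> - F \<theta>\<bar> \<le> (LINT x|M. \<rho> x * norm (\<eta> x - \<theta> x))" if "\<eta> \<in> ?V" "\<theta> \<in> ?V" for \<eta> \<theta>
  proof -
    have V': "(\<lambda>x. \<eta> x + (- 1) *\<^sub>R \<theta> x) \<in> ?V" by (intro VD that)
    have "F (\<lambda>x. \<eta> x + (- 1) *\<^sub>R \<theta> x) = F \<eta> - F \<theta>"
      using F_add[OF that(1) VD(3)[OF that(2), of "- 1"]] F_scale[OF that(2,2), of "- 1"] by simp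
    then show ?thesis using F_bound[OF V'] by simp
  qed
  obtain \<tau> :: "'a \<Rightarrow> real" where \<tau>[measurable]: "\<tau> \<in> borel_measurable M" and \<tau>_pos: "\<And>x. x \<in> space M \<Longrightarrow> 0 < \<tau> x"
    and \<tau>_nn: "\<And>x. 0 \<le> \<tau> x" and \<tau>_int: "integrable M (\<lambda>x. \<rho> x * \<tau> x)"
    using ex_positive_weight[OF m\<rho> \<rho>] by blast
  \<comment> \<open>Indicators alone need not lie in the weighted space; the weight
    \<open>\<tau>\<close> puts them there.\<close>
  define T where "T A k = (\<lambda>x. (indicator A x * \<tau> x) *\<^sub>R k)" for A and k :: 'y
  have T_V: "T A k \<in> ?V" if [measurable]: "A \<in> sets M" for A k
  proof -
    have "integrable M (\<lambda>x. norm k * (indicator A x *\<^sub>R (\<rho> x * \<tau> x)))"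
      by (intro integrable_mult_right integrable_mult_indicator that \<tau>_int)
    then have "integrable M (\<lambda>x. \<rho> x * norm (T A k x))"
      using \<tau>_nn by (simp add: T_def abs_mult mult_ac)
    then show ?thesis by (simp add: weighted_L1_def T_def)
  qed
  have T_norm: "(LINT x|M. \<rho> x * norm (T A k x)) = norm k * (LINT x:A|M. \<rho> x * \<tau> x)" if "A \<in> sets M" for A k
    unfolding set_lebesgue_integral_def integral_mult_right_zero[symmetric] using \<tau>_nn
    by (intro Bochner_Integration.integral_cong) (auto simp: T_def abs_mult)
  have "\<exists>g. integrable M g \<and> (\<forall>A\<in>sets M. F (T A k) = (LINT x:A|M. g x))" if k: "k \<in> Basis" for k
  proof (rule dominated_additive_set_function_density[of "\<lambda>x. \<rho> x * \<tau> x" "\<lambda>A. F (T A k)"])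
    show "integrable M (\<lambda>x. \<rho> x * \<tau> x)" by (rule \<tau>_int)
    show "0 \<le> \<rho> x * \<tau> x" for x using \<rho> \<tau>_nn by simp
    show "\<bar>F (T A k)\<bar> \<le> (LINT x:A|M. \<rho> x * \<tau> x)" if "A \<in> sets M" for A
      using F_bound[OF T_V[OF that, of k]] k unfolding T_norm[OF that] by simp
    fix A B assume AB: "A \<in> sets M" "B \<in> sets M" "A \<inter> B = {}"
    then have "T (A \<union> B) k = (\<lambda>x. T A k x + T B k x)"
      by (auto simp: T_def indicator_def fun_eq_iff)
    then show "F (T (A \<union> B) k) = F (T A k) + F (T B k)"
      using F_add[OF T_V[OF AB(1)] T_V[OF AB(2)]] by simp
  qed blast
  then obtain g where g: "\<And>k. k \<in> Basis \<Longrightarrow> integrable M (g k)"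
    "\<And>k A. k \<in> Basis \<Longrightarrow> A \<in> sets M \<Longrightarrow> F (T A k) = (LINT x:A|M. g k x)" by metis
  \<comment> \<open>The densities \<open>g k\<close> belong to the weighted fields, so
    \<open>\<tau>\<close> is divided out again.\<close>
  define v where "v x = (\<Sum>k\<in>Basis. (g k x / \<tau> x) *\<^sub>R k)" for x
  have [measurable]: "g k \<in> borel_measurable M" if "k \<in> Basis" for k using g(1)[OF that] by auto
  have mv[measurable]: "v \<in> borel_measurable M" unfolding v_def by measurable
  have v_inner: "\<tau> x * (v x \<bullet> y) = (\<Sum>k\<in>Basis. (y \<bullet> k) * g k x)" if "x \<in> space M" for x y
    using \<tau>_pos[OF that] unfolding v_def inner_sum_left sum_distrib_left
    by (intro sum.cong) (auto simp: inner_commute)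
  have v_int: "integrable M (\<lambda>x. \<tau> x * (v x \<bullet> y))" for y
  proof -
    have "integrable M (\<lambda>x. \<Sum>k\<in>Basis. (y \<bullet> k) * g k x)" using g(1) by auto
    then show ?thesis by (rule Bochner_Integration.integrable_cong[THEN iffD1, rotated 2]) (auto simp: v_inner)
  qed
  have F_T: "F (T A y) = (LINT x:A|M. \<tau> x * (v x \<bullet> y))" if A: "A \<in> sets M" for A y
  proof -
    have "a *\<^sub>R y = (\<Sum>k\<in>Basis. (y \<bullet> k) *\<^sub>R (a *\<^sub>R k))" for a
    proof -
      have "(\<Sum>k\<in>Basis. (y \<bullet> k) *\<^sub>R (a *\<^sub>R k)) = (\<Sum>k\<in>Basis. a *\<^sub>R ((y \<bullet> k) *\<^sub>R k))"
        by (intro sum.cong refl scaleR_left_commute)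
      also have "\<dots> = a *\<^sub>R y" unfolding scaleR_sum_right[symmetric] euclidean_representation ..
      finally show ?thesis by simp
    qed
    then have "T A y = (\<lambda>x. \<Sum>k\<in>Basis. (y \<bullet> k) *\<^sub>R T A k x)" unfolding T_def by blast
    then have "F (T A y) = (\<Sum>k\<in>Basis. (y \<bullet> k) * F (T A k))"
      using F_sum[of Basis "\<lambda>k x. (y \<bullet> k) *\<^sub>R T A k x"] VD(3)[OF T_V[OF A]] F_scale[OF T_V[OF A] T_V[OF A]] by simp
    also have "\<dots> = (LINT x:A|M. (\<Sum>k\<in>Basis. (y \<bullet> k) * g k x))"
    proof -
      have "set_integrable M A (\<lambda>x. (y \<bullet> k) * g k x)" if "k \<in> Basis" for k
        unfolding set_integrable_def by (intro integrable_mult_indicator A integrable_mult_right g(1)[OF that])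
      then have "(LINT x:A|M. (\<Sum>k\<in>Basis. (y \<bullet> k) * g k x)) = (\<Sum>k\<in>Basis. LINT x:A|M. (y \<bullet> k) * g k x)"
        unfolding set_lebesgue_integral_def set_integrable_def scaleR_sum_right
        by (intro Bochner_Integration.integral_sum)
      then show ?thesis using g(2) A by simp
    qed
    also have "\<dots> = (LINT x:A|M. \<tau> x * (v x \<bullet> y))"
      unfolding set_lebesgue_integral_def by (intro Bochner_Integration.integral_cong) (auto simp: v_inner)
    finally show ?thesis .
  qed
  have v_le: "AE x in M. v x \<bullet> y \<le> \<sigma> x y" for y
  proof -
    have m\<sigma>y[measurable]: "(\<lambda>x. \<sigma> x y) \<in> borel_measurable M" using m\<sigma>[of "\<lambda>_. y"] by simp
    have "integrable M (\<lambda>x. norm y * (\<rho> x * \<tau> x))" using \<tau>_int by simp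
    then have \<sigma>_int: "integrable M (\<lambda>x. \<tau> x * \<sigma> x y)"
    proof (rule Bochner_Integration.integrable_bound)
      show "AE x in M. norm (\<tau> x * \<sigma> x y) \<le> norm (norm y * (\<rho> x * \<tau> x))"
      proof (rule AE_I2)
        fix x
        have "\<tau> x * \<bar>\<sigma> x y\<bar> \<le> \<tau> x * (\<rho> x * norm y)" using \<tau>_nn \<sigma>_bound by (intro mult_left_mono)
        then show "norm (\<tau> x * \<sigma> x y) \<le> norm (norm y * (\<rho> x * \<tau> x))"
          using \<tau>_nn[of x] \<rho>[of x] by (simp add: abs_mult mult_ac)
      qed
    qed measurable
    \<comment> \<open>The set where the inequality fails for this \<open>y\<close>. Testing with
      \<open>T A y\<close> shows that the nonnegative excess over it has integral zero; homogeneity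
      of \<open>\<sigma>\<close> extracts \<open>\<tau>\<close>.\<close>
    define A where "A = {x \<in> space M. \<tau> x * \<sigma> x y < \<tau> x * (v x \<bullet> y)}"
    have [measurable]: "A \<in> sets M" unfolding A_def by measurable
    have i: "integrable M (\<lambda>x. indicator A x *\<^sub>R (\<tau> x * (v x \<bullet> y)))" "integrable M (\<lambda>x. indicator A x *\<^sub>R (\<tau> x * \<sigma> x y))"
      by (intro integrable_mult_indicator v_int \<sigma>_int; measurable)+
    have "(LINT x:A|M. \<tau> x * (v x \<bullet> y)) = F (T A y)" using F_T by simp
    also have "\<dots> \<le> (LINT x|M. \<sigma> x (T A y x))" by (intro F_le T_V) measurable
    also have "\<dots> = (LINT x:A|M. \<tau> x * \<sigma> x y)"
      unfolding set_lebesgue_integral_def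
    proof (intro Bochner_Integration.integral_cong refl)
      fix x assume "x \<in> space M"
      moreover have "\<sigma> x 0 = 0" using \<sigma>_bound[of x 0] by simp
      ultimately show "\<sigma> x (T A y x) = indicator A x *\<^sub>R (\<tau> x * \<sigma> x y)"
        using \<sigma>_hom \<tau>_pos by (auto simp: T_def indicator_def)
    qed
    finally have "(LINT x|M. indicator A x *\<^sub>R (\<tau> x * (v x \<bullet> y)) - indicator A x *\<^sub>R (\<tau> x * \<sigma> x y)) \<le> 0"
      using i by (simp add: set_lebesgue_integral_def)
    moreover have nn: "0 \<le> indicator A x *\<^sub>R (\<tau> x * (v x \<bullet> y)) - indicator A x *\<^sub>R (\<tau> x * \<sigma> x y)" for x
      by (auto simp: A_def indicator_def)
    ultimately have "(LINT x|M. indicator A x *\<^sub>R (\<tau> x * (v x \<bullet> y)) - indicator A x *\<^sub>R (\<tau> x * \<sigma> x y)) = 0"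
      by (intro antisym integral_nonneg) auto
    then have "AE x in M. indicator A x *\<^sub>R (\<tau> x * (v x \<bullet> y)) - indicator A x *\<^sub>R (\<tau> x * \<sigma> x y) = 0"
      using i nn by (subst (asm) integral_nonneg_eq_0_iff_AE) auto
    with AE_space show ?thesis
    proof eventually_elim
      case (elim x)
      then have "\<tau> x * (v x \<bullet> y) \<le> \<tau> x * \<sigma> x y"
        by (auto simp: A_def indicator_def not_less split: if_splits)
      then show ?case using \<tau>_pos[OF elim(1)] by simp
    qed
  qed
  obtain D :: "'y set" where D: "countable D" "\<And>X. open X \<Longrightarrow> X \<noteq> {} \<Longrightarrow> \<exists>d\<in>D. d \<in> X"
    by (erule countable_dense_setE)
  have "AE x in M. \<forall>y\<in>D. v x \<bullet> y \<le> \<sigma> x y"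
    using v_le by (subst AE_ball_countable[OF D(1)]) auto
  then have le: "AE x in M. \<forall>y. v x \<bullet> y \<le> \<sigma> x y"
  proof eventually_elim
    case (elim x)
    have "v x \<bullet> y \<le> \<sigma> x y" for y
      by (rule dense_le_imp_le[OF _ \<sigma>_cont D(2)]) (use elim in \<open>auto intro!: continuous_intros\<close>)
    then show ?case by blast
  qed
  then have v_bound: "AE x in M. norm (v x) \<le> \<rho> x"
  proof eventually_elim
    case (elim x)
    \<comment> \<open>The inequality is used in the direction \<open>v x\<close> itself.\<close>
    have "norm (v x) * norm (v x) \<le> \<rho> x * norm (v x)"
      using elim[rule_format, of "v x"] \<sigma>_bound[of x "v x"] by (simp add: dot_square_norm power2_eq_square)
    then show ?case using \<rho>[of x] by (cases "v x = 0") auto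
  qed
  have "F \<eta> = (LINT x|M. v x \<bullet> \<eta> x)" if \<eta>: "\<eta> \<in> ?V" for \<eta>
  proof -
    have [measurable]: "\<eta> \<in> borel_measurable M" and \<eta>_int: "integrable M (\<lambda>x. \<rho> x * norm (\<eta> x))"
      using \<eta> by (auto simp: weighted_L1_def)
    \<comment> \<open>Simple functions approximate \<open>\<eta> / \<tau>\<close> rather than
      \<open>\<eta>\<close>, because \<open>\<tau>\<close> times a simple function is a finite sum
      of fields \<open>T A y\<close>, on which \<open>F\<close> is known.\<close>
    have "(\<lambda>x. \<eta> x /\<^sub>R \<tau> x) \<in> borel_measurable M" by measurable
    from borel_measurable_implies_sequence_metric[OF this, of 0, unfolded dist_0_norm dist_norm diff_0_right]
    obtain s where s: "\<And>i. simple_function M (s i)" "\<And>x. x \<in> space M \<Longrightarrow> (\<lambda>i. s i x) \<longlonglongrightarrow> \<eta> x /\<^sub>R \<tau> x"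
      "\<And>i x. x \<in> space M \<Longrightarrow> norm (s i x) \<le> 2 * norm (\<eta> x /\<^sub>R \<tau> x)" by metis
    have [measurable]: "s i \<in> borel_measurable M" for i using s(1) by (rule borel_measurable_simple_function)
    define \<theta> where "\<theta> i x = \<tau> x *\<^sub>R s i x" for i x
    have \<theta>_lim: "(\<lambda>i. \<theta> i x) \<longlonglongrightarrow> \<eta> x" if "x \<in> space M" for x
      using tendsto_scaleR[OF tendsto_const s(2)[OF that], of "\<tau> x"] \<tau>_pos[OF that] by (simp add: \<theta>_def)
    have \<theta>_bound: "norm (\<theta> i x) \<le> 2 * norm (\<eta> x)" if "x \<in> space M" for i x
    proof -
      have "norm (\<theta> i x) \<le> \<tau> x * (2 * norm (\<eta> x /\<^sub>R \<tau> x))"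
        using s(3)[OF that, of i] \<tau>_pos[OF that] by (simp add: \<theta>_def)
      also have "\<dots> = 2 * norm (\<eta> x)" using \<tau>_pos[OF that] by simp
      finally show ?thesis .
    qed
    have [measurable]: "\<theta> i \<in> borel_measurable M" for i unfolding \<theta>_def by measurable
    have \<theta>_V: "\<theta> i \<in> ?V" for i
    proof -
      have "integrable M (\<lambda>x. 2 * (\<rho> x * norm (\<eta> x)))" using \<eta>_int by simp
      then have "integrable M (\<lambda>x. \<rho> x * norm (\<theta> i x))"
      proof (rule Bochner_Integration.integrable_bound)
        show "AE x in M. norm (\<rho> x * norm (\<theta> i x)) \<le> norm (2 * (\<rho> x * norm (\<eta> x)))"
        proof (rule AE_I2)
          fix x assume "x \<in> space M"
          then have "\<rho> x * norm (\<theta> i x) \<le> \<rho> x * (2 * norm (\<eta> x))"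
            using \<rho> \<theta>_bound by (intro mult_left_mono) auto
          then show "norm (\<rho> x * norm (\<theta> i x)) \<le> norm (2 * (\<rho> x * norm (\<eta> x)))"
            using \<rho>[of x] by (simp add: abs_mult)
        qed
      qed measurable
      then show ?thesis by (simp add: weighted_L1_def)
    qed
    have F\<theta>: "F (\<theta> i) = (LINT x|M. v x \<bullet> \<theta> i x)" for i
    proof -
      let ?Y = "s i ` space M" and ?A = "\<lambda>y. s i -` {y} \<inter> space M"
      have fin: "finite ?Y" using s(1) by (rule simple_functionD)
      have A: "?A y \<in> sets M" for y using s(1) by (rule simple_functionD)
      have eq: "\<theta> i x = (\<Sum>y\<in>?Y. T (?A y) y x)" if "x \<in> space M" for x
      proof -
        have "(\<Sum>y\<in>?Y. T (?A y) y x) = (\<Sum>y\<in>{s i x}. T (?A y) y x)"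
          using fin that by (intro sum.mono_neutral_right) (auto simp: T_def)
        then show ?thesis using that by (simp add: T_def \<theta>_def)
      qed
      \<comment> \<open>The two functions agree on \<open>space M\<close> only, so their values
        under \<open>F\<close> are identified through the integral bound on differences.\<close>
      have "\<bar>F (\<theta> i) - F (\<lambda>x. \<Sum>y\<in>?Y. T (?A y) y x)\<bar> \<le> (LINT x|M. \<rho> x * norm (\<theta> i x - (\<Sum>y\<in>?Y. T (?A y) y x)))"
        by (intro F_diff \<theta>_V V_sum T_V A)
      also have "\<dots> = (LINT x|M. 0)" by (intro Bochner_Integration.integral_cong) (auto simp: eq)
      finally have "F (\<theta> i) = F (\<lambda>x. \<Sum>y\<in>?Y. T (?A y) y x)" by simp
      also have "\<dots> = (\<Sum>y\<in>?Y. LINT x:?A y|M. \<tau> x * (v x \<bullet> y))"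
        by (subst F_sum) (auto simp: T_V A F_T)
      also have "\<dots> = (LINT x|M. (\<Sum>y\<in>?Y. indicator (?A y) x *\<^sub>R (\<tau> x * (v x \<bullet> y))))"
        unfolding set_lebesgue_integral_def
        by (subst Bochner_Integration.integral_sum) (auto intro!: integrable_mult_indicator A v_int simp del: real_scaleR_def)
      also have "\<dots> = (LINT x|M. v x \<bullet> \<theta> i x)"
        by (intro Bochner_Integration.integral_cong) (auto simp: eq inner_sum_right T_def mult_ac)
      finally show ?thesis .
    qed
    have "(\<lambda>i. LINT x|M. v x \<bullet> \<theta> i x) \<longlonglongrightarrow> (LINT x|M. v x \<bullet> \<eta> x)"
    proof (rule integral_dominated_convergence[where w = "\<lambda>x. 2 * (\<rho> x * norm (\<eta> x))"])
      show "AE x in M. (\<lambda>i. v x \<bullet> \<theta> i x) \<longlonglongrightarrow> v x \<bullet> \<eta> x"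
        using \<theta>_lim by (auto intro!: tendsto_inner)
      show "AE x in M. norm (v x \<bullet> \<theta> i x) \<le> 2 * (\<rho> x * norm (\<eta> x))" for i
        using v_bound AE_space
      proof eventually_elim
        case (elim x)
        have "\<bar>v x \<bullet> \<theta> i x\<bar> \<le> norm (v x) * norm (\<theta> i x)" by (rule Cauchy_Schwarz_ineq2)
        also have "\<dots> \<le> \<rho> x * (2 * norm (\<eta> x))" using elim \<theta>_bound \<rho> by (intro mult_mono) auto
        finally show ?case by simp
      qed
    qed (use \<eta>_int in auto)
    moreover have "(\<lambda>i. F (\<theta> i)) \<longlonglongrightarrow> F \<eta>"
    proof (rule LIM_zero_cancel, rule tendsto_rabs_zero_cancel, rule tendsto_sandwich[OF _ _ tendsto_const])
      have "(\<lambda>i. LINT x|M. \<rho> x * norm (\<theta> i x - \<eta> x)) \<longlonglongrightarrow> (LINT x|M. 0)"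
      proof (rule integral_dominated_convergence[where w = "\<lambda>x. 3 * (\<rho> x * norm (\<eta> x))"])
        show "AE x in M. (\<lambda>i. \<rho> x * norm (\<theta> i x - \<eta> x)) \<longlonglongrightarrow> 0"
          using \<theta>_lim by (auto intro!: tendsto_mult_right_zero tendsto_norm_zero LIM_zero)
        show "AE x in M. norm (\<rho> x * norm (\<theta> i x - \<eta> x)) \<le> 3 * (\<rho> x * norm (\<eta> x))" for i
        proof (rule AE_I2)
          fix x assume "x \<in> space M"
          then have "norm (\<theta> i x - \<eta> x) \<le> 3 * norm (\<eta> x)"
            using \<theta>_bound[of x i] norm_triangle_ineq4[of "\<theta> i x" "\<eta> x"] by linarith
          then have "\<rho> x * norm (\<theta> i x - \<eta> x) \<le> \<rho> x * (3 * norm (\<eta> x))"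
            using \<rho> by (intro mult_left_mono)
          then show "norm (\<rho> x * norm (\<theta> i x - \<eta> x)) \<le> 3 * (\<rho> x * norm (\<eta> x))"
            using \<rho>[of x] by (simp add: abs_mult)
        qed
      qed (use \<eta>_int in auto)
      then show "(\<lambda>i. LINT x|M. \<rho> x * norm (\<theta> i x - \<eta> x)) \<longlonglongrightarrow> 0" by simp
    qed (use F_diff[OF \<theta>_V \<eta>] in auto)
    ultimately show ?thesis using F\<theta> LIMSEQ_unique by (metis (no_types, lifting) ext)
  qed
  then show ?thesis using that[OF mv le] by blast
qed

section \<open>Support functions\<close>

definition support_fun :: "'a::euclidean_space set \<Rightarrow> 'a \<Rightarrow> real" where
  "support_fun S y = (SUP v\<in>S. v \<bullet> y)"

lemma bdd_above_inner_image:
  fixes S :: "'a::euclidean_space set"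
  assumes "compact S" shows "bdd_above ((\<lambda>v. v \<bullet> y) ` S)"
  using assms
  by (intro bounded_imp_bdd_above compact_imp_bounded compact_continuous_image continuous_intros)

lemma support_fun_ge: "compact S \<Longrightarrow> v \<in> S \<Longrightarrow> v \<bullet> y \<le> support_fun S y"
  unfolding support_fun_def by (intro cSUP_upper bdd_above_inner_image)

lemma support_fun_le: "S \<noteq> {} \<Longrightarrow> (\<And>v. v \<in> S \<Longrightarrow> v \<bullet> y \<le> c) \<Longrightarrow> support_fun S y \<le> c"
  unfolding support_fun_def by (intro cSUP_least)

lemma support_fun_attained:
  assumes "compact S" "S \<noteq> {}" obtains v where "v \<in> S" "support_fun S y = v \<bullet> y"
proof -
  have "continuous_on S (\<lambda>v. v \<bullet> y)" by (intro continuous_intros)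
  from continuous_attains_sup[OF assms this] obtain v where v: "v \<in> S" "\<And>w. w \<in> S \<Longrightarrow> w \<bullet> y \<le> v \<bullet> y"
    by auto
  have "support_fun S y = v \<bullet> y"
    using v assms by (intro antisym support_fun_le support_fun_ge)
  then show ?thesis using that v by blast
qed

lemma support_fun_hom:
  assumes "compact S" "S \<noteq> {}" "0 < c" shows "support_fun S (c *\<^sub>R y) = c * support_fun S y"
proof (rule antisym)
  show "support_fun S (c *\<^sub>R y) \<le> c * support_fun S y"
    using assms by (intro support_fun_le) (auto intro!: mult_left_mono support_fun_ge)
  obtain v where "v \<in> S" "support_fun S y = v \<bullet> y" using support_fun_attained[OF assms(1,2)] .
  then show "c * support_fun S y \<le> support_fun S (c *\<^sub>R y)"
    using support_fun_ge[OF assms(1), of v "c *\<^sub>R y"] by simp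
qed

lemma support_fun_add:
  assumes "compact S" "S \<noteq> {}" shows "support_fun S (y + z) \<le> support_fun S y + support_fun S z"
  using assms by (intro support_fun_le) (auto simp: inner_add_right intro!: add_mono support_fun_ge)

lemma support_fun_zero: "S \<noteq> {} \<Longrightarrow> support_fun S 0 = 0"
  by (simp add: support_fun_def)

lemma support_fun_bound:
  assumes S: "compact S" "S \<noteq> {}" and r: "\<And>v. v \<in> S \<Longrightarrow> norm v \<le> r"
  shows "\<bar>support_fun S y\<bar> \<le> r * norm y"
proof -
  obtain v where v: "v \<in> S" "support_fun S y = v \<bullet> y" using support_fun_attained[OF S] .
  have "\<bar>v \<bullet> y\<bar> \<le> norm v * norm y" by (rule Cauchy_Schwarz_ineq2)
  also have "\<dots> \<le> r * norm y" using r[OF v(1)] by (intro mult_right_mono) auto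
  finally show ?thesis using v by simp
qed

lemma support_fun_continuous:
  assumes S: "compact S" "S \<noteq> {}" shows "continuous_on T (support_fun S)"
proof -
  obtain r where r: "0 < r" "\<And>v. v \<in> S \<Longrightarrow> norm v \<le> r"
    using compact_imp_bounded[OF S(1)] bounded_pos by metis
  have le: "support_fun S y - support_fun S z \<le> r * norm (y - z)" for y z
    using support_fun_add[OF S, of z "y - z"] support_fun_bound[OF S r(2), of "y - z"] by simp
  have "r-lipschitz_on T (support_fun S)"
  proof (rule lipschitz_onI)
    fix y z
    show "dist (support_fun S y) (support_fun S z) \<le> r * dist y z"
      using le[of y z] le[of z y] by (simp add: dist_norm norm_minus_commute abs_le_iff)
  qed (use r in simp)
  then show ?thesis by (rule lipschitz_on_continuous_on)
qed

text \<open>A point outside \<open>S\<close> would be strictly separated from it, and the reversed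
  normal violates the inequality.\<close>

lemma support_fun_mem:
  assumes "closed S" "convex S" "compact S" "\<And>y. v \<bullet> y \<le> support_fun S y" "S \<noteq> {}" shows "v \<in> S"
proof (rule ccontr)
  assume "v \<notin> S"
  then obtain a b where ab: "a \<bullet> v < b" "\<And>w. w \<in> S \<Longrightarrow> b < a \<bullet> w"
    using separating_hyperplane_closed_point[OF assms(2,1)] by metis
  have "support_fun S (- a) \<le> - b"
    using assms(5) ab(2) by (intro support_fun_le) (auto simp: inner_commute intro: less_imp_le)
  with assms(4)[of "- a"] ab(1) show False by (simp add: inner_commute)
qed

lemma compact_set_sum:
  fixes S :: "'i \<Rightarrow> 'a::real_normed_vector set"
  assumes "finite A" "\<And>i. i \<in> A \<Longrightarrow> compact (S i)" shows "compact (\<Sum>i\<in>A. S i)"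
  using assms
proof (induction A rule: finite_induct)
  case (insert i A)
  then have "compact {x + y |x y. x \<in> S i \<and> y \<in> (\<Sum>i\<in>A. S i)}" by (intro compact_sums) auto
  also have "{x + y |x y. x \<in> S i \<and> y \<in> (\<Sum>i\<in>A. S i)} = S i + (\<Sum>i\<in>A. S i)"
    unfolding set_plus_def by blast
  finally show ?case using insert by simp
qed simp

text \<open>The weighted Minkowski sum \<open>W\<close> is compact and convex. In each direction the
  weighted sum of maximisers lies in \<open>W\<close>, so the right-hand side is at most the support
  function of \<open>W\<close>, and separation applies.\<close>

lemma mem_weighted_sum_if_support_fun_le:
  fixes S :: "'i \<Rightarrow> 'a::euclidean_space set"
  assumes A: "finite A" and S: "\<And>i. i \<in> A \<Longrightarrow> compact (S i)" "\<And>i. i \<in> A \<Longrightarrow> convex (S i)" "\<And>i. i \<in> A \<Longrightarrow> S i \<noteq> {}"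
    and lam: "\<And>i. i \<in> A \<Longrightarrow> 0 \<le> lam i"
    and le: "\<And>y. v \<bullet> y \<le> (\<Sum>i\<in>A. lam i * support_fun (S i) y)"
  obtains c where "\<And>i. i \<in> A \<Longrightarrow> c i \<in> S i" "v = (\<Sum>i\<in>A. lam i *\<^sub>R c i)"
proof -
  define W where "W = (\<Sum>i\<in>A. (*\<^sub>R) (lam i) ` S i)"
  have W: "W = {\<Sum>i\<in>A. lam i *\<^sub>R c i | c. \<forall>i\<in>A. c i \<in> S i}"
    unfolding W_def set_sum_alt[OF A]
  proof (intro equalityI subsetI)
    fix w assume "w \<in> {sum s A |s. \<forall>i\<in>A. s i \<in> (*\<^sub>R) (lam i) ` S i}"
    then obtain s where s: "w = sum s A" "\<forall>i\<in>A. s i \<in> (*\<^sub>R) (lam i) ` S i" by blast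
    then have "\<forall>i\<in>A. \<exists>c. s i = lam i *\<^sub>R c \<and> c \<in> S i" by blast
    then obtain c where "\<forall>i\<in>A. s i = lam i *\<^sub>R c i \<and> c i \<in> S i" by metis
    with s(1) show "w \<in> {\<Sum>i\<in>A. lam i *\<^sub>R c i | c. \<forall>i\<in>A. c i \<in> S i}" by auto
  qed blast
  have "compact W" unfolding W_def using A S by (intro compact_set_sum compact_scaling) auto
  moreover have "convex W" unfolding W_def using S by (intro convex_set_sum convex_scaling) auto
  moreover have "W \<noteq> {}"
  proof -
    have "\<forall>i\<in>A. \<exists>c. c \<in> S i" using S(3) by auto
    then obtain c where "\<forall>i\<in>A. c i \<in> S i" by metis
    then show ?thesis unfolding W by blast
  qed
  moreover have "v \<bullet> y \<le> support_fun W y" for y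
  proof -
    have "\<forall>i\<in>A. \<exists>c. c \<in> S i \<and> support_fun (S i) y = c \<bullet> y" using support_fun_attained S by metis
    then obtain c where c: "\<forall>i\<in>A. c i \<in> S i \<and> support_fun (S i) y = c i \<bullet> y" by metis
    then have "(\<Sum>i\<in>A. lam i * support_fun (S i) y) = (\<Sum>i\<in>A. lam i *\<^sub>R c i) \<bullet> y"
      by (simp add: inner_sum_left)
    also have "\<dots> \<le> support_fun W y"
      using c by (intro support_fun_ge \<open>compact W\<close>) (auto simp: W)
    finally show ?thesis using le[of y] by linarith
  qed
  ultimately have "v \<in> W" by (intro support_fun_mem compact_imp_closed)
  then show ?thesis using that unfolding W by auto
qed

section \<open>Multipliers for systems of integral sublinear inequalities\<close>

text \<open>Abstract form of the multiplier rule, with \<open>L\<close> in the role of the jets of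
  test functions. The alternative for convex inequalities gives the multipliers, an annihilating
  functional exists by Hahn-Banach, and its density is decomposed pointwise.\<close>

lemma (in sigma_finite_measure) integral_sublinear_system_multipliers:
  fixes S :: "'i \<Rightarrow> 'a \<Rightarrow> 'y::euclidean_space set" and L :: "('a \<Rightarrow> 'y) set"
  assumes A: "finite A" "A \<noteq> {}"
    and m\<rho>: "\<rho> \<in> borel_measurable M" and \<rho>: "\<And>x. 0 \<le> \<rho> x"
    and S: "\<And>i x. i \<in> A \<Longrightarrow> compact (S i x)" "\<And>i x. i \<in> A \<Longrightarrow> convex (S i x)" "\<And>i x. i \<in> A \<Longrightarrow> S i x \<noteq> {}"
    and S_bound: "\<And>i x v. i \<in> A \<Longrightarrow> v \<in> S i x \<Longrightarrow> norm v \<le> \<rho> x"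
    and S_meas: "\<And>i \<eta>. i \<in> A \<Longrightarrow> \<eta> \<in> borel_measurable M \<Longrightarrow>
      (\<lambda>x. support_fun (S i x) (\<eta> x)) \<in> borel_measurable M"
    and L: "function_space L" "L \<subseteq> weighted_L1 M \<rho>"
    and no: "\<And>h. h \<in> L \<Longrightarrow> \<exists>i\<in>A. 0 \<le> (LINT x|M. support_fun (S i x) (h x))"
  obtains lam v where "\<And>i. i \<in> A \<Longrightarrow> 0 \<le> lam i" "(\<Sum>i\<in>A. lam i) = 1" "v \<in> borel_measurable M"
    "AE x in M. \<exists>c. (\<forall>i\<in>A. c i \<in> S i x) \<and> v x = (\<Sum>i\<in>A. lam i *\<^sub>R c i)"
    "\<And>h. h \<in> L \<Longrightarrow> (LINT x|M. v x \<bullet> h x) = 0"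
proof -
  let ?V = "weighted_L1 M \<rho> :: ('a \<Rightarrow> 'y) set"
  note V = function_space_weighted_L1[OF m\<rho> \<rho>]
  note VD = function_spaceD[OF V] and LD = function_spaceD[OF L(1)]
  define s where "s i h = (LINT x|M. support_fun (S i x) (h x))" for i and h :: "'a \<Rightarrow> 'y"
  have s_int: "integrable M (\<lambda>x. support_fun (S i x) (h x))" if i: "i \<in> A" and h: "h \<in> ?V" for i h
  proof (rule Bochner_Integration.integrable_bound)
    show "integrable M (\<lambda>x. \<rho> x * norm (h x))" using h by (simp add: weighted_L1_def)
    show "(\<lambda>x. support_fun (S i x) (h x)) \<in> borel_measurable M"
      using h by (intro S_meas i) (simp add: weighted_L1_def)
    show "AE x in M. norm (support_fun (S i x) (h x)) \<le> norm (\<rho> x * norm (h x))"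
      using support_fun_bound[OF S(1,3)[OF i] S_bound[OF i]] \<rho> by (auto simp: abs_mult)
  qed
  have s_add: "s i (\<lambda>x. f x + g x) \<le> s i f + s i g" if i: "i \<in> A" and fg: "f \<in> ?V" "g \<in> ?V" for i f g
  proof -
    have "s i (\<lambda>x. f x + g x) \<le> (LINT x|M. support_fun (S i x) (f x) + support_fun (S i x) (g x))"
      unfolding s_def
      by (intro integral_mono s_int VD fg i Bochner_Integration.integrable_add support_fun_add S)
    then show ?thesis using s_int[OF i] fg by (simp add: s_def)
  qed
  have s_hom: "s i (\<lambda>x. c *\<^sub>R f x) = c * s i f" if i: "i \<in> A" and "0 < c" for i f c
    using that S by (simp add: s_def support_fun_hom)
  have s_zero: "s i (\<lambda>x. 0) = 0" if "i \<in> A" for i using that S by (simp add: s_def support_fun_zero)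
  have s_hom0: "s i (\<lambda>x. c *\<^sub>R f x) = c * s i f" if "i \<in> A" "0 \<le> c" for i f c
    using that s_hom s_zero by (cases "c = 0") auto
  have "\<exists>lam. (\<forall>i\<in>A. 0 \<le> lam i) \<and> (\<Sum>i\<in>A. lam i) = 1 \<and> (\<forall>f\<in>L. 0 \<le> (\<Sum>i\<in>A. lam i * s i f))"
  proof (rule convex_inequality_system[OF A, where comb = "\<lambda>c f g x. (1 - c) *\<^sub>R f x + c *\<^sub>R g x"])
    fix f g and c :: real assume fg: "f \<in> L" "g \<in> L" and c: "0 \<le> c" "c \<le> 1"
    show "(\<lambda>x. (1 - c) *\<^sub>R f x + c *\<^sub>R g x) \<in> L" by (intro LD fg)
    fix i assume i: "i \<in> A"
    have "f \<in> ?V" "g \<in> ?V" using fg L(2) by auto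
    then have "s i (\<lambda>x. (1 - c) *\<^sub>R f x + c *\<^sub>R g x) \<le> s i (\<lambda>x. (1 - c) *\<^sub>R f x) + s i (\<lambda>x. c *\<^sub>R g x)"
      by (intro s_add i VD)
    then show "s i (\<lambda>x. (1 - c) *\<^sub>R f x + c *\<^sub>R g x) \<le> (1 - c) * s i f + c * s i g"
      using s_hom0[OF i] c by simp
  qed (use no in \<open>simp add: s_def\<close>)
  then obtain lam where lam: "\<And>i. i \<in> A \<Longrightarrow> 0 \<le> lam i" "(\<Sum>i\<in>A. lam i) = 1"
    "\<And>f. f \<in> L \<Longrightarrow> 0 \<le> (\<Sum>i\<in>A. lam i * s i f)" by auto
  define P where "P f = (\<Sum>i\<in>A. lam i * s i f)" for f
  define \<sigma> where "\<sigma> x y = (\<Sum>i\<in>A. lam i * support_fun (S i x) y)" for x y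
  have subP: "sublinear_on ?V P"
    unfolding sublinear_on_def
  proof (intro conjI ballI allI impI)
    fix f g assume "f \<in> ?V" "g \<in> ?V"
    then have "P (\<lambda>x. f x + g x) \<le> (\<Sum>i\<in>A. lam i * (s i f + s i g))"
      unfolding P_def using s_add lam(1) by (intro sum_mono mult_left_mono)
    then show "P (\<lambda>x. f x + g x) \<le> P f + P g" by (simp add: P_def sum.distrib distrib_left)
  next
    fix f and c :: real assume "0 < c"
    then show "P (\<lambda>x. c *\<^sub>R f x) = c * P f"
      by (simp add: P_def s_hom sum_distrib_left mult.left_commute)
  qed
  have "0 \<le> P h" if "h \<in> L" for h unfolding P_def by (rule lam(3)[OF that])
  from Hahn_Banach_annihilator[OF V subP L this]
  obtain F where F: "linear_on_functions ?V F" "\<And>f. f \<in> ?V \<Longrightarrow> F f \<le> P f" "\<And>h. h \<in> L \<Longrightarrow> F h = 0"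
    by blast
  obtain v where v: "v \<in> borel_measurable M" "AE x in M. \<forall>y. v x \<bullet> y \<le> \<sigma> x y"
    "\<And>\<eta>. \<eta> \<in> ?V \<Longrightarrow> F \<eta> = (LINT x|M. v x \<bullet> \<eta> x)"
  proof (rule linear_functional_representation[OF m\<rho> \<rho> F(1), of \<sigma>])
    fix \<eta> assume \<eta>: "\<eta> \<in> ?V"
    have "P \<eta> = (LINT x|M. \<sigma> x (\<eta> x))"
      unfolding P_def \<sigma>_def s_def using s_int \<eta> by (subst Bochner_Integration.integral_sum) auto
    with F(2)[OF \<eta>] show "F \<eta> \<le> (LINT x|M. \<sigma> x (\<eta> x))" by simp
  next
    fix \<eta> :: "'a \<Rightarrow> 'y" assume "\<eta> \<in> borel_measurable M"
    then show "(\<lambda>x. \<sigma> x (\<eta> x)) \<in> borel_measurable M"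
      unfolding \<sigma>_def using S_meas by (intro borel_measurable_sum borel_measurable_times) auto
  next
    fix x y
    have "\<bar>\<sigma> x y\<bar> \<le> (\<Sum>i\<in>A. \<bar>lam i * support_fun (S i x) y\<bar>)" unfolding \<sigma>_def by (rule sum_abs)
    also have "\<dots> \<le> (\<Sum>i\<in>A. lam i * (\<rho> x * norm y))"
      using lam(1) support_fun_bound[OF S(1,3) S_bound] by (intro sum_mono) (auto simp: abs_mult intro!: mult_left_mono)
    \<comment> \<open>Normalised multipliers keep the weighted support function below the bound of
      each single one.\<close>
    also have "\<dots> = \<rho> x * norm y" using lam(2) by (simp add: sum_distrib_right[symmetric])
    finally show "\<bar>\<sigma> x y\<bar> \<le> \<rho> x * norm y" .
  next
    fix x y and c :: real assume "0 < c"
    then show "\<sigma> x (c *\<^sub>R y) = c * \<sigma> x y"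
      using S by (simp add: \<sigma>_def support_fun_hom sum_distrib_left mult.left_commute)
  next
    fix x show "continuous_on UNIV (\<sigma> x)"
      unfolding \<sigma>_def using S by (intro continuous_intros support_fun_continuous)
  qed blast
  have "AE x in M. \<exists>c. (\<forall>i\<in>A. c i \<in> S i x) \<and> v x = (\<Sum>i\<in>A. lam i *\<^sub>R c i)"
    using v(2)
  proof eventually_elim
    case (elim x)
    obtain c where "\<And>i. i \<in> A \<Longrightarrow> c i \<in> S i x" "v x = (\<Sum>i\<in>A. lam i *\<^sub>R c i)"
      using mem_weighted_sum_if_support_fun_le[OF A(1), of "\<lambda>i. S i x" lam "v x"] S lam(1) elim
      unfolding \<sigma>_def by blast
    then show ?case by blast
  qed
  moreover have "(LINT x|M. v x \<bullet> h x) = 0" if "h \<in> L" for h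
    using v(3)[of h] F(3)[OF that] L(2) that by auto
  ultimately show ?thesis using that lam(1,2) v(1) by blast
qed

section \<open>Pointwise estimates from codifferentials\<close>

text \<open>Continuous induction: the times at which the bound with \<open>c + e\<close> holds form
  a compact set, and the right estimate at its largest element would push beyond it unless that
  element is 1.\<close>

lemma right_increment_bound:
  fixes g :: "real \<Rightarrow> real"
  assumes cont: "continuous_on {0..1} g"
    and right: "\<And>t e. 0 \<le> t \<Longrightarrow> t < 1 \<Longrightarrow> 0 < e \<Longrightarrow> \<forall>\<^sub>F s in at_right 0. \<bar>g (t + s) - g t\<bar> \<le> (c + e) * s"
  shows "\<bar>g 1 - g 0\<bar> \<le> c"
proof (rule field_le_epsilon)
  fix e :: real assume e: "0 < e"
  define T where "T = {t\<in>{0..1}. \<bar>g t - g 0\<bar> \<le> (c + e) * t}"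
  have "closed T"
    unfolding T_def by (intro continuous_on_closed_Collect_le continuous_intros cont)
  moreover have "bounded T" by (rule bounded_subset[of "{0..1}"]) (auto simp: T_def)
  ultimately have "compact T" by (simp add: compact_eq_bounded_closed)
  moreover have "0 \<in> T" by (simp add: T_def)
  ultimately obtain m where m: "m \<in> T" "\<And>t. t \<in> T \<Longrightarrow> t \<le> m"
    using compact_attains_sup[of T] by blast
  have "m = 1"
  proof (rule ccontr)
    assume "m \<noteq> 1"
    with m(1) have m1: "0 \<le> m" "m < 1" by (auto simp: T_def)
    have "\<forall>\<^sub>F s in at_right 0. \<bar>g (m + s) - g m\<bar> \<le> (c + e) * s" using right[OF m1 e] .
    moreover have "\<forall>\<^sub>F s in at_right 0. s < 1 - m" using m1 by (intro eventually_at_right_real[THEN eventually_mono]) auto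
    moreover have "\<forall>\<^sub>F s in at_right (0::real). 0 < s" by (rule eventually_at_right_less)
    ultimately have "\<forall>\<^sub>F s in at_right (0::real). False"
    proof eventually_elim
      case (elim s)
      have "\<bar>g (m + s) - g 0\<bar> \<le> (c + e) * (m + s)"
        using elim(1) m(1) by (auto simp: T_def algebra_simps)
      then have "m + s \<in> T" using elim m1 by (auto simp: T_def)
      then show False using m(2)[of "m + s"] elim by simp
    qed
    then show False by simp
  qed
  then show "\<bar>g 1 - g 0\<bar> \<le> c + e" using m(1) by (simp add: T_def)
qed

text \<open>Under the normalisation \<open>hypo_max A 0 = 0\<close> this is the face of greatest
  height of a compact convex \<open>A\<close>, that is, the subdifferential of
  \<open>hypo_max A\<close> at 0.\<close>

definition zero_slice :: "(real \<times> 'a) set \<Rightarrow> 'a set" where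
  "zero_slice A = {v. (0, v) \<in> A}"

text \<open>Reading the maximum of affine functions as a support function in one more dimension
  makes homogeneity and Lipschitz bounds available, and lets the first coordinate of the direction
  vary.\<close>

lemma hypo_max_eq_support_fun: "hypo_max A h = support_fun A (1, h)"
  by (simp add: hypo_max_def support_fun_def case_prod_unfold inner_prod_def)

context
  fixes A :: "(real \<times> 'a::euclidean_space) set"
  assumes A: "compact A" "convex A" "A \<noteq> {}" and A0: "hypo_max A 0 = 0"
begin

lemma hypo_max_nonpos: "(a, v) \<in> A \<Longrightarrow> a \<le> 0"
  using support_fun_ge[OF A(1), of "(a, v)" "(1, 0)"] A0 by (simp add: hypo_max_eq_support_fun)

lemma zero_slice_nonempty: "zero_slice A \<noteq> {}"
  using support_fun_attained[OF A(1,3), of "(1, 0)"] A0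
  by (force simp: hypo_max_eq_support_fun zero_slice_def)

lemma zero_slice_compact: "compact (zero_slice A)"
proof -
  have "zero_slice A = snd ` (A \<inter> {p. fst p = 0})" by (force simp: zero_slice_def)
  moreover have "closed {p::real \<times> 'a. fst p = 0}" by (intro closed_Collect_eq continuous_intros)
  ultimately show ?thesis
    by (simp only:) (intro compact_continuous_image compact_Int_closed A(1) continuous_intros)
qed

lemma zero_slice_convex: "convex (zero_slice A)"
proof (rule convexI)
  fix x y :: 'a and u v :: real
  assume "x \<in> zero_slice A" "y \<in> zero_slice A" "0 \<le> u" "0 \<le> v" "u + v = 1"
  then have "u *\<^sub>R (0, x) + v *\<^sub>R (0, y) \<in> A"
    by (intro convexD[OF A(2)]) (auto simp: zero_slice_def)
  then show "u *\<^sub>R x + v *\<^sub>R y \<in> zero_slice A" by (simp add: zero_slice_def)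
qed

lemma support_fun_zero_slice_le: "support_fun (zero_slice A) y \<le> support_fun A (c, y)"
  using zero_slice_nonempty by (intro support_fun_le) (auto simp: zero_slice_def dest: support_fun_ge[OF A(1), of _ "(c, y)"])

text \<open>From above, heights contribute nothing positive because
  \<open>a \<le> 0 \<le> c\<close>; from below, the slice at height zero bounds the value
  independently of \<open>c\<close>.\<close>

lemma support_fun_bounds:
  assumes r: "\<And>a v. (a, v) \<in> A \<Longrightarrow> norm v \<le> r" and c: "0 \<le> c"
  shows "\<bar>support_fun A (c, y)\<bar> \<le> r * norm y"
proof -
  have "support_fun A (c, y) \<le> r * norm y"
  proof (rule support_fun_le[OF A(3)])
    fix p assume p: "p \<in> A"
    obtain a v where av: "p = (a, v)" by fastforce
    have "v \<bullet> y \<le> norm v * norm y" by (rule norm_cauchy_schwarz)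
    also have "\<dots> \<le> r * norm y" using r p av by (intro mult_right_mono) auto
    finally show "p \<bullet> (c, y) \<le> r * norm y"
      using hypo_max_nonpos[of a v] p av c mult_nonpos_nonneg[of a c] by auto
  qed
  moreover have "\<bar>support_fun (zero_slice A) y\<bar> \<le> r * norm y"
    using zero_slice_compact zero_slice_nonempty r by (intro support_fun_bound) (auto simp: zero_slice_def)
  ultimately show ?thesis using support_fun_zero_slice_le[of y c] by linarith
qed

text \<open>The directional derivative of the hypodifferential part only sees the slice at height zero.\<close>

lemma support_fun_tendsto_zero_slice:
  "(\<lambda>n. support_fun A (real n, y)) \<longlonglongrightarrow> support_fun (zero_slice A) y"
proof -
  let ?s = "support_fun (zero_slice A) y" and ?f = "\<lambda>n. support_fun A (real n, y)"
  \<comment> \<open>Heights are at most 0, so the values decrease with \<open>n\<close>; one index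
    close to the limit then controls all later ones.\<close>
  have dec: "?f n \<le> ?f m" if "m \<le> n" for m n
  proof (rule support_fun_le[OF A(3)])
    fix p assume p: "p \<in> A"
    obtain a v where av: "p = (a, v)" by fastforce
    have "a * real n \<le> a * real m"
      using hypo_max_nonpos[of a v] p av that by (intro mult_left_mono_neg) auto
    then have "p \<bullet> (real n, y) \<le> p \<bullet> (real m, y)" by (simp add: av)
    also have "\<dots> \<le> ?f m" by (rule support_fun_ge[OF A(1) p])
    finally show "p \<bullet> (real n, y) \<le> ?f m" .
  qed
  have ge: "?s \<le> ?f n" for n by (rule support_fun_zero_slice_le)
  have "\<forall>n. \<exists>p. p \<in> A \<and> ?f n = p \<bullet> (real n, y)" using support_fun_attained[OF A(1,3)] by metis
  then obtain p where p: "\<And>n. p n \<in> A" "\<And>n. ?f n = p n \<bullet> (real n, y)" by metis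
  \<comment> \<open>A cluster point of the maximisers. Its height is 0, since a negative limit
    height times \<open>n\<close> would push the values below their lower bound
    \<open>?s\<close>.\<close>
  obtain q \<phi> where q: "q \<in> A" "strict_mono \<phi>" "(p \<circ> \<phi>) \<longlonglongrightarrow> q"
    using A(1) p(1) unfolding compact_eq_seq_compact_metric seq_compact_def by metis
  have lim1: "(\<lambda>n. fst (p (\<phi> n))) \<longlonglongrightarrow> fst q" and lim2: "(\<lambda>n. snd (p (\<phi> n)) \<bullet> y) \<longlonglongrightarrow> snd q \<bullet> y"
    using q(3) by (auto intro!: tendsto_intros simp: o_def)
  obtain r where r: "\<And>x. x \<in> A \<Longrightarrow> norm x \<le> r" using compact_imp_bounded[OF A(1)] bounded_iff by metis
  have "fst q = 0"
  proof (rule antisym)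
    show "fst q \<le> 0" using hypo_max_nonpos[of "fst q" "snd q"] q(1) by simp
    \<comment> \<open>The bound \<open>?s\<close> keeps the height of a maximiser above a constant
      divided by its index; \<open>Suc n\<close> makes that index positive.\<close>
    have "(\<lambda>n. (?s - r * norm y) * inverse (real (\<phi> (Suc n)))) \<longlonglongrightarrow> (?s - r * norm y) * 0"
    proof (intro tendsto_intros)
      have "filterlim (\<lambda>n. real (\<phi> (Suc n))) at_top sequentially"
        using q(2) by (intro filterlim_compose[OF filterlim_real_sequentially] filterlim_subseq)
          (auto simp: strict_mono_def)
      then show "(\<lambda>n. inverse (real (\<phi> (Suc n)))) \<longlonglongrightarrow> 0" by (rule tendsto_inverse_0_at_top)
    qed
    then have low: "(\<lambda>n. (?s - r * norm y) * inverse (real (\<phi> (Suc n)))) \<longlonglongrightarrow> 0" by simp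
    have "(?s - r * norm y) * inverse (real (\<phi> (Suc n))) \<le> fst (p (\<phi> (Suc n)))" for n
    proof -
      let ?k = "\<phi> (Suc n)"
      have k: "0 < real ?k" using seq_suble[OF q(2), of "Suc n"] by simp
      have "snd (p ?k) \<bullet> y \<le> norm (snd (p ?k)) * norm y" by (rule norm_cauchy_schwarz)
      also have "\<dots> \<le> r * norm y"
        using r[OF p(1)[of ?k]] norm_snd_le[of "snd (p ?k)" "fst (p ?k)"] by (intro mult_right_mono) auto
      finally have "?s \<le> fst (p ?k) * real ?k + r * norm y"
        using ge[of ?k] unfolding p(2) by (simp add: inner_prod_def)
      then show ?thesis using k by (simp add: field_simps)
    qed
    then show "0 \<le> fst q" by (intro LIMSEQ_le[OF low LIMSEQ_Suc[OF lim1]]) auto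
  qed
  then have "snd q \<in> zero_slice A" using q(1) by (cases q) (auto simp: zero_slice_def)
  then have qs: "snd q \<bullet> y \<le> ?s" by (rule support_fun_ge[OF zero_slice_compact])
  show ?thesis
  proof (rule LIMSEQ_I)
    fix e :: real assume e: "0 < e"
    have "\<forall>\<^sub>F n in sequentially. snd (p (\<phi> n)) \<bullet> y < snd q \<bullet> y + e"
      using e by (intro order_tendstoD(2)[OF lim2]) simp
    then obtain n where n: "snd (p (\<phi> n)) \<bullet> y < snd q \<bullet> y + e" by (auto simp: eventually_sequentially)
    have "?f (\<phi> n) = fst (p (\<phi> n)) * real (\<phi> n) + snd (p (\<phi> n)) \<bullet> y"
      unfolding p(2) by (simp add: inner_prod_def)
    moreover have "fst (p (\<phi> n)) * real (\<phi> n) \<le> 0"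
      using hypo_max_nonpos[of "fst (p (\<phi> n))" "snd (p (\<phi> n))"] p(1)[of "\<phi> n"] by (intro mult_nonpos_nonneg) auto
    ultimately have "?f (\<phi> n) < ?s + e" using n qs by linarith
    then have "norm (?f m - ?s) < e" if "\<phi> n \<le> m" for m
      using ge[of m] dec[OF that] by (simp add: abs_less_iff)
    then show "\<exists>n0. \<forall>m\<ge>n0. norm (?f m - ?s) < e" by blast
  qed
qed

end

text \<open>The negative of an upper component is a hypodifferential of the same normalised kind, so
  each estimate for lower components also serves the upper ones.\<close>

lemma hyper_min_eq_support_fun:
  "hyper_min B h = - support_fun (uminus ` B) (1, h)"
proof -
  have "support_fun (uminus ` B) (1, h) = (SUP p\<in>B. - (fst p + snd p \<bullet> h))"
    unfolding support_fun_def image_image by (simp add: inner_prod_def)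
  then show ?thesis unfolding hyper_min_def by (simp add: case_prod_unfold Inf_real_def image_image)
qed

lemma
  fixes A B :: "(real \<times> 'a::euclidean_space) set"
  assumes cod: "is_codifferential F y A B"
  shows is_codifferential_lower: "compact A" "convex A" "A \<noteq> {}" "hypo_max A 0 = 0"
    and is_codifferential_upper: "compact (uminus ` B)" "convex (uminus ` B)" "uminus ` B \<noteq> {}" "hypo_max (uminus ` B) 0 = 0"
    and is_codifferential_limit: "((\<lambda>\<alpha>. (1 / \<alpha>) * \<bar>F (y + \<alpha> *\<^sub>R h) - F y - hypo_max A (\<alpha> *\<^sub>R h) - hyper_min B (\<alpha> *\<^sub>R h)\<bar>) \<longlongrightarrow> 0) (at_right 0)"
  using cod unfolding is_codifferential_def
  by (auto simp: compact_negations convex_negations hyper_min_eq_support_fun hypo_max_eq_support_fun)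

text \<open>Each of the two components contributes \<open>r * norm h\<close>, whence the factor 2;
  \<open>e\<close> absorbs the remainder in the limit.\<close>

lemma is_codifferential_increment:
  assumes cod: "is_codifferential F y A B"
    and r: "\<And>a v. (a, v) \<in> A \<Longrightarrow> norm v \<le> r" "\<And>b w. (b, w) \<in> B \<Longrightarrow> norm w \<le> r" and e: "0 < e"
  shows "\<forall>\<^sub>F \<alpha> in at_right 0. \<bar>F (y + \<alpha> *\<^sub>R h) - F y\<bar> \<le> (2 * r * norm h + e) * \<alpha>"
proof -
  have "\<forall>\<^sub>F \<alpha> in at_right 0. (1 / \<alpha>) * \<bar>F (y + \<alpha> *\<^sub>R h) - F y - hypo_max A (\<alpha> *\<^sub>R h) - hyper_min B (\<alpha> *\<^sub>R h)\<bar> < e"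
    by (rule order_tendstoD(2)[OF is_codifferential_limit[OF cod] e])
  moreover have "\<forall>\<^sub>F \<alpha> in at_right (0::real). 0 < \<alpha>" by (rule eventually_at_right_less)
  ultimately show ?thesis
  proof eventually_elim
    case (elim \<alpha>)
    have "\<bar>hypo_max A (\<alpha> *\<^sub>R h)\<bar> \<le> r * (\<alpha> * norm h)"
      using support_fun_bounds[OF is_codifferential_lower[OF cod] r(1), where y = "\<alpha> *\<^sub>R h" and c = 1] elim
      by (simp add: hypo_max_eq_support_fun)
    moreover have "\<bar>hyper_min B (\<alpha> *\<^sub>R h)\<bar> \<le> r * (\<alpha> * norm h)"
      using support_fun_bounds[OF is_codifferential_upper[OF cod], where r = r and y = "\<alpha> *\<^sub>R h" and c = 1] elim r(2)
      by (force simp: hyper_min_eq_support_fun)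
    moreover have "\<bar>F (y + \<alpha> *\<^sub>R h) - F y - hypo_max A (\<alpha> *\<^sub>R h) - hyper_min B (\<alpha> *\<^sub>R h)\<bar> < e * \<alpha>"
      using elim by (simp add: field_simps)
    ultimately have "\<bar>F (y + \<alpha> *\<^sub>R h) - F y\<bar> \<le> 2 * (r * (\<alpha> * norm h)) + e * \<alpha>" by linarith
    then show ?case by (simp add: algebra_simps)
  qed
qed

text \<open>At each point of the segment the codifferential controls increments to the right only;
  together with continuity this bounds the total increment.\<close>

lemma codifferentiable_lipschitz:
  assumes cont: "continuous_on UNIV F"
    and cod: "\<And>t. 0 \<le> t \<Longrightarrow> t \<le> 1 \<Longrightarrow> is_codifferential F (y + t *\<^sub>R h) (A t) (B t)"
    and r: "\<And>t a v. 0 \<le> t \<Longrightarrow> t \<le> 1 \<Longrightarrow> (a, v) \<in> A t \<Longrightarrow> norm v \<le> r"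
      "\<And>t b w. 0 \<le> t \<Longrightarrow> t \<le> 1 \<Longrightarrow> (b, w) \<in> B t \<Longrightarrow> norm w \<le> r"
  shows "\<bar>F (y + h) - F y\<bar> \<le> 2 * r * norm h"
proof -
  have "\<bar>F (y + 1 *\<^sub>R h) - F (y + 0 *\<^sub>R h)\<bar> \<le> 2 * r * norm h"
  proof (rule right_increment_bound[where g = "\<lambda>t. F (y + t *\<^sub>R h)"])
    show "continuous_on {0..1} (\<lambda>t. F (y + t *\<^sub>R h))"
      by (intro continuous_on_compose2[OF cont] continuous_intros) auto
    fix t e :: real assume t: "0 \<le> t" "t < 1" and e: "0 < e"
    have "\<forall>\<^sub>F s in at_right 0. \<bar>F ((y + t *\<^sub>R h) + s *\<^sub>R h) - F (y + t *\<^sub>R h)\<bar> \<le> (2 * r * norm h + e) * s"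
      by (rule is_codifferential_increment[OF cod _ _ e, of t]) (use t r in auto)
    then show "\<forall>\<^sub>F s in at_right 0. \<bar>F (y + (t + s) *\<^sub>R h) - F (y + t *\<^sub>R h)\<bar> \<le> (2 * r * norm h + e) * s"
      by (simp add: scaleR_add_left add.assoc)
  qed
  then show ?thesis by simp
qed

text \<open>Fixing one element \<open>(0, w)\<close> of the upper component bounds the minimum from
  above only, so just the positive part of the error tends to 0.\<close>

lemma is_codifferential_directional_upper:
  assumes cod: "is_codifferential F y A B" and w: "(0, w) \<in> B"
  shows "(\<lambda>n. max 0 (real (Suc n) * (F (y + h /\<^sub>R real (Suc n)) - F y) - (support_fun (zero_slice A) h + w \<bullet> h))) \<longlonglongrightarrow> 0"
proof -
  note A = is_codifferential_lower[OF cod] and B = is_codifferential_upper[OF cod]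
  let ?k = "\<lambda>n. real (Suc n)" and ?s = "support_fun (zero_slice A) h"
  have "filterlim (\<lambda>n. inverse (?k n)) (at_right 0) sequentially"
    unfolding filterlim_at by (intro conjI LIMSEQ_inverse_real_of_nat) auto
  from filterlim_compose[OF is_codifferential_limit[OF cod, of h] this]
  have lim: "(\<lambda>n. ?k n * \<bar>F (y + h /\<^sub>R ?k n) - F y - hypo_max A (h /\<^sub>R ?k n) - hyper_min B (h /\<^sub>R ?k n)\<bar>) \<longlonglongrightarrow> 0"
    (is "?E \<longlonglongrightarrow> 0") by (simp add: divide_inverse)
  have "(\<lambda>n. support_fun A (?k n, h) - ?s) \<longlonglongrightarrow> 0"
    using LIMSEQ_Suc[OF support_fun_tendsto_zero_slice[OF A]] by (rule LIM_zero)
  from tendsto_add[OF lim this]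
  have "(\<lambda>n. ?E n + (support_fun A (?k n, h) - ?s)) \<longlonglongrightarrow> 0" by simp
  then show ?thesis
  proof (rule tendsto_sandwich[OF _ _ tendsto_const, rotated 2])
    show "\<forall>\<^sub>F n in sequentially. max 0 (?k n * (F (y + h /\<^sub>R ?k n) - F y) - (?s + w \<bullet> h)) \<le> ?E n + (support_fun A (?k n, h) - ?s)"
    proof (intro always_eventually allI)
      fix n
      \<comment> \<open>Homogeneity moves the factor \<open>?k n\<close> into the height coordinate,
        where the limit towards the slice applies.\<close>
      have "support_fun A (?k n *\<^sub>R (1, h /\<^sub>R ?k n)) = ?k n * support_fun A (1, h /\<^sub>R ?k n)"
        by (rule support_fun_hom[OF A(1,3)]) simp
      then have 1: "?k n * hypo_max A (h /\<^sub>R ?k n) = support_fun A (?k n, h)"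
        by (simp add: hypo_max_eq_support_fun del: of_nat_Suc)
      have "(- (0, w)) \<bullet> (1 :: real, h /\<^sub>R ?k n) \<le> support_fun (uminus ` B) (1, h /\<^sub>R ?k n)"
        by (rule support_fun_ge[OF B(1) imageI[OF w]])
      then have "hyper_min B (h /\<^sub>R ?k n) \<le> w \<bullet> h / ?k n"
        by (simp add: hyper_min_eq_support_fun divide_inverse mult.commute)
      then have 2: "?k n * hyper_min B (h /\<^sub>R ?k n) \<le> w \<bullet> h" by (simp add: field_simps del: of_nat_Suc)
      have "?k n * (F (y + h /\<^sub>R ?k n) - F y) \<le> ?E n + ?k n * hypo_max A (h /\<^sub>R ?k n) + ?k n * hyper_min B (h /\<^sub>R ?k n)"
        unfolding distrib_left[symmetric] by (intro mult_left_mono) auto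
      moreover have "0 \<le> ?E n" by simp
      moreover have "?s \<le> support_fun A (?k n, h)" by (rule support_fun_zero_slice_le[OF A])
      ultimately show "max 0 (?k n * (F (y + h /\<^sub>R ?k n) - F y) - (?s + w \<bullet> h)) \<le> ?E n + (support_fun A (?k n, h) - ?s)"
        using 1 2 by (simp del: of_nat_Suc)
    qed
  qed auto
qed

section \<open>Superposition with measurable functions\<close>

lemma complete_measure_lebesgue_on:
  assumes "S \<in> sets lebesgue" shows "complete_measure (lebesgue_on S)"
proof
  fix A B assume "B \<subseteq> A" "A \<in> null_sets (lebesgue_on S)"
  then have "A \<subseteq> S" "A \<in> null_sets lebesgue" using assms by (auto simp: null_sets_restrict_space)
  then have "B \<in> sets lebesgue" using \<open>B \<subseteq> A\<close> completion.complete by blast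
  then show "B \<in> sets (lebesgue_on S)"
    using \<open>B \<subseteq> A\<close> \<open>A \<subseteq> S\<close> assms by (auto simp: sets_restrict_space_iff)
qed

context complete_measure
begin

text \<open>Completeness of the measure absorbs the exceptional null set, whatever the values
  there.\<close>

lemma borel_measurable_AE_eq:
  fixes f g :: "'a \<Rightarrow> 'b::topological_space"
  assumes f: "f \<in> borel_measurable M" and eq: "AE x in M. f x = g x"
  shows "g \<in> borel_measurable M"
proof (rule borel_measurableI)
  fix S :: "'b set" assume S: "open S"
  show "g -` S \<inter> space M \<in> sets M"
  proof (rule in_sets_AE)
    show "AE x in M. x \<in> f -` S \<inter> space M \<longleftrightarrow> x \<in> g -` S \<inter> space M"
      using eq by eventually_elim auto
    show "f -` S \<inter> space M \<in> sets M" using f S by (intro measurable_sets) auto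
  qed auto
qed

lemma borel_measurable_AE_LIMSEQ:
  fixes f :: "nat \<Rightarrow> 'a \<Rightarrow> real"
  assumes "\<And>i. f i \<in> borel_measurable M" "AE x in M. (\<lambda>i. f i x) \<longlonglongrightarrow> g x"
  shows "g \<in> borel_measurable M"
proof (rule borel_measurable_AE_eq)
  show "(\<lambda>x. lim (\<lambda>i. f i x)) \<in> borel_measurable M" using assms(1) by measurable
  show "AE x in M. lim (\<lambda>i. f i x) = g x" using assms(2) by eventually_elim (rule limI)
qed

text \<open>For a simple function inserted as second argument the superposition is glued from
  finitely many measurable pieces; continuity carries this to limits of simple functions.\<close>

lemma caratheodory_superposition:
  fixes g :: "'a \<Rightarrow> 'z::{metric_space, second_countable_topology} \<Rightarrow> real"
  assumes g: "\<And>z. (\<lambda>x. g x z) \<in> borel_measurable M" and cont: "AE x in M. continuous_on UNIV (g x)"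
    and \<zeta>: "\<zeta> \<in> borel_measurable M"
  shows "(\<lambda>x. g x (\<zeta> x)) \<in> borel_measurable M"
proof -
  obtain s where s: "\<And>i. simple_function M (s i)" "\<And>x. x \<in> space M \<Longrightarrow> (\<lambda>i. s i x) \<longlonglongrightarrow> \<zeta> x"
    using borel_measurable_implies_sequence_metric[OF \<zeta>] by metis
  show ?thesis
  proof (rule borel_measurable_AE_LIMSEQ)
    fix i
    show "(\<lambda>x. g x (s i x)) \<in> borel_measurable M"
    proof (rule measurable_compose_countable'[where f = "\<lambda>z x. g x z" and I = "s i ` space M"])
      show "s i \<in> measurable M (count_space (s i ` space M))"
        using s(1)[of i] by (auto simp: measurable_count_space_eq2 simple_function_def)
      show "countable (s i ` space M)" using s(1)[of i] by (simp add: simple_functionD(1) countable_finite)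
    qed (rule g)
  next
    show "AE x in M. (\<lambda>i. g x (s i x)) \<longlonglongrightarrow> g x (\<zeta> x)"
      using cont AE_space
    proof eventually_elim
      case (elim x)
      then show ?case using s(2)[of x] by (auto intro: continuous_on_tendsto_compose)
    qed
  qed
qed

end

text \<open>Each point of \<open>A\<close> has a nearest point in \<open>B\<close> at distance at
  most the Hausdorff distance.\<close>

lemma support_fun_hausdorff_le:
  fixes A B :: "'a::euclidean_space set"
  assumes A: "compact A" "A \<noteq> {}" and B: "compact B" "B \<noteq> {}"
  shows "support_fun A q \<le> support_fun B q + hausdorff_dist A B * norm q"
proof (rule support_fun_le[OF A(2)])
  fix p assume p: "p \<in> A"
  obtain b where b: "b \<in> B" "infdist p B = dist p b"
    using infdist_attains_inf[OF compact_imp_closed[OF B(1)] B(2)] by metis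
  have "bdd_above ((\<lambda>a. infdist a B) ` A)"
    using A by (intro bounded_imp_bdd_above compact_imp_bounded compact_continuous_image continuous_intros)
  then have "infdist p B \<le> hausdorff_dist A B"
    unfolding hausdorff_dist_def using p by (intro max.coboundedI1 cSUP_upper)
  then have "norm (p - b) * norm q \<le> hausdorff_dist A B * norm q"
    using b by (intro mult_right_mono) (auto simp: dist_norm)
  moreover have "(p - b) \<bullet> q \<le> norm (p - b) * norm q" by (rule norm_cauchy_schwarz)
  moreover have "b \<bullet> q \<le> support_fun B q" by (rule support_fun_ge[OF B(1) b(1)])
  ultimately show "p \<bullet> q \<le> support_fun B q + hausdorff_dist A B * norm q" by (simp add: inner_diff_left)
qed

lemma hausdorff_dist_commute: "hausdorff_dist A B = hausdorff_dist B A"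
  by (simp add: hausdorff_dist_def max.commute)

lemma support_fun_hausdorff_abs_le:
  fixes A B :: "'a::euclidean_space set"
  assumes "compact A" "A \<noteq> {}" "compact B" "B \<noteq> {}"
  shows "\<bar>support_fun A q - support_fun B q\<bar> \<le> hausdorff_dist A B * norm q"
  using support_fun_hausdorff_le[OF assms, of q] support_fun_hausdorff_le[OF assms(3,4,1,2), of q]
  by (simp add: hausdorff_dist_commute[of B A])

lemma hausdorff_dist_self: "A \<noteq> {} \<Longrightarrow> hausdorff_dist A A = 0"
  by (simp add: hausdorff_dist_def)

text \<open>The increment splits into the change of the set at a fixed direction, controlled by the
  Hausdorff distance times the norm of the direction, and the change of the direction at a fixed
  set.\<close>

lemma continuous_support_fun_hausdorff:
  fixes G :: "'b::metric_space \<Rightarrow> 'a::euclidean_space set"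
  assumes G: "\<And>y. compact (G y)" "\<And>y. G y \<noteq> {}"
    and lim: "\<And>y. ((\<lambda>y'. hausdorff_dist (G y') (G y)) \<longlongrightarrow> 0) (at y)"
  shows "continuous_on UNIV (\<lambda>(y, q). support_fun (G y) q)"
  unfolding continuous_on_def
proof
  fix z :: "'b \<times> 'a"
  obtain y q where z: "z = (y, q)" by fastforce
  have "filterlim (\<lambda>y'. hausdorff_dist (G y') (G y)) (nhds 0) (nhds y)"
    using lim[of y] tendsto_at_iff_tendsto_nhds[of "\<lambda>y'. hausdorff_dist (G y') (G y)" y]
    by (simp add: hausdorff_dist_self G)
  moreover have "filterlim fst (nhds y) (at z)" using tendsto_fst[OF tendsto_ident_at, of z UNIV] by (simp add: z)
  ultimately have "((\<lambda>p. hausdorff_dist (G (fst p)) (G y)) \<longlongrightarrow> 0) (at z)" by (rule filterlim_compose)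
  moreover have snd_lim: "(snd \<longlongrightarrow> q) (at z)" using tendsto_snd[OF tendsto_ident_at, of z UNIV] by (simp add: z)
  ultimately have 1: "((\<lambda>p. hausdorff_dist (G (fst p)) (G y) * norm (snd p)) \<longlongrightarrow> 0 * norm q) (at z)"
    by (intro tendsto_intros)
  have "isCont (support_fun (G y)) q"
    using support_fun_continuous[OF G, of UNIV y] by (simp add: continuous_on_eq_continuous_at)
  then have 2: "((\<lambda>p. support_fun (G y) (snd p)) \<longlongrightarrow> support_fun (G y) q) (at z)"
    using snd_lim by (rule isCont_tendsto_compose)
  have "((\<lambda>p. support_fun (G (fst p)) (snd p) - support_fun (G y) (snd p)) \<longlongrightarrow> 0) (at z)"
    by (rule Lim_null_comparison[OF _ 1[simplified]])
       (auto intro!: always_eventually support_fun_hausdorff_abs_le G)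
  from tendsto_add[OF this 2]
  show "((\<lambda>(y, q). support_fun (G y) q) \<longlongrightarrow> (case z of (y, q) \<Rightarrow> support_fun (G y) q)) (at z within UNIV)"
    by (simp add: z case_prod_unfold)
qed

section \<open>Directional derivatives of integral functionals\<close>

text \<open>The support function exceeds \<open>c\<close> exactly when the set meets an open
  half-space, which links measurability of the multifunction to that of real functions. Joint
  continuity in the point and the direction then allows both to depend on \<open>x\<close>.\<close>

lemma (in complete_measure) borel_measurable_support_fun_superposition:
  fixes G :: "'a \<Rightarrow> 'b::{metric_space, second_countable_topology} \<Rightarrow> 'c::euclidean_space set"
  assumes G: "\<And>y V. open V \<Longrightarrow> {x\<in>space M. G x y \<inter> V \<noteq> {}} \<in> sets M"
    and compact: "AE x in M. \<forall>y. compact (G x y) \<and> G x y \<noteq> {}"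
    and cont: "AE x in M. \<forall>y. ((\<lambda>y'. hausdorff_dist (G x y') (G x y)) \<longlongrightarrow> 0) (at y)"
    and y: "y \<in> borel_measurable M" and q: "q \<in> borel_measurable M"
  shows "(\<lambda>x. support_fun (G x (y x)) (q x)) \<in> borel_measurable M"
proof -
  have "(\<lambda>x. case (y x, q x) of (y, q) \<Rightarrow> support_fun (G x y) q) \<in> borel_measurable M"
  proof (rule caratheodory_superposition[where g = "\<lambda>x (y, q). support_fun (G x y) q" and \<zeta> = "\<lambda>x. (y x, q x)"])
    fix z :: "'b \<times> 'c"
    obtain y q where z: "z = (y, q)" by fastforce
    have "(\<lambda>x. support_fun (G x y) q) \<in> borel_measurable M"
      unfolding borel_measurable_iff_greater
    proof
      fix c :: real
      show "{x\<in>space M. c < support_fun (G x y) q} \<in> sets M"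
      proof (rule in_sets_AE)
        have "open {p. c < p \<bullet> q}" by (intro open_Collect_less continuous_intros)
        then show "{x\<in>space M. G x y \<inter> {p. c < p \<bullet> q} \<noteq> {}} \<in> sets M" by (rule G)
        show "AE x in M. x \<in> {x\<in>space M. G x y \<inter> {p. c < p \<bullet> q} \<noteq> {}} \<longleftrightarrow> x \<in> {x\<in>space M. c < support_fun (G x y) q}"
          using compact
        proof eventually_elim
          case (elim x)
          then have "compact (G x y)" "G x y \<noteq> {}" by auto
          then have "G x y \<inter> {p. c < p \<bullet> q} \<noteq> {} \<longleftrightarrow> c < support_fun (G x y) q"
            using support_fun_attained[of "G x y" q] support_fun_ge[of "G x y" _ q]
            by (metis (no_types, lifting) IntE IntI emptyE ex_in_conv mem_Collect_eq order_less_le_trans)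
          then show ?case by simp
        qed
      qed auto
    qed
    then show "(\<lambda>x. case z of (y, q) \<Rightarrow> support_fun (G x y) q) \<in> borel_measurable M"
      by (simp add: z)
  next
    show "AE x in M. continuous_on UNIV (\<lambda>(y, q). support_fun (G x y) q)"
      using compact cont by eventually_elim (intro continuous_support_fun_hausdorff; blast)
    show "(\<lambda>x. (y x, q x)) \<in> borel_measurable M" using y q by (rule borel_measurable_Pair)
  qed
  then show ?thesis by simp
qed

text \<open>Measurability is inherited from the unsliced sets, because the support function of the
  slice is the limit of theirs in the directions \<open>(real n, h x)\<close>.\<close>

lemma (in complete_measure) borel_measurable_support_fun_zero_slice:
  fixes G :: "'a \<Rightarrow> 'b::{metric_space, second_countable_topology} \<Rightarrow> (real \<times> 'c::euclidean_space) set"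
  assumes G: "\<And>y V. open V \<Longrightarrow> {x\<in>space M. G x y \<inter> V \<noteq> {}} \<in> sets M"
    and hypo: "AE x in M. \<forall>y. compact (G x y) \<and> convex (G x y) \<and> G x y \<noteq> {} \<and> hypo_max (G x y) 0 = 0"
    and cont: "AE x in M. \<forall>y. ((\<lambda>y'. hausdorff_dist (G x y') (G x y)) \<longlongrightarrow> 0) (at y)"
    and y: "y \<in> borel_measurable M" and h: "h \<in> borel_measurable M"
  shows "(\<lambda>x. support_fun (zero_slice (G x (y x))) (h x)) \<in> borel_measurable M"
proof (rule borel_measurable_AE_LIMSEQ)
  show "(\<lambda>x. support_fun (G x (y x)) (real n, h x)) \<in> borel_measurable M" for n
  proof (rule borel_measurable_support_fun_superposition[OF G _ cont y])
    show "AE x in M. \<forall>y. compact (G x y) \<and> G x y \<noteq> {}" using hypo by eventually_elim blast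
    show "(\<lambda>x. (real n, h x)) \<in> borel_measurable M" using h by (intro borel_measurable_Pair) auto
  qed
  show "AE x in M. (\<lambda>n. support_fun (G x (y x)) (real n, h x)) \<longlonglongrightarrow> support_fun (zero_slice (G x (y x))) (h x)"
    using hypo by eventually_elim (rule support_fun_tendsto_zero_slice; blast)
qed

text \<open>All three follow from the Lipschitz estimate on the segment from \<open>y x\<close> to
  \<open>y x + t *\<^sub>R h x\<close>, which stays in the ball of radius \<open>norm (h x)\<close>
  on which \<open>R x\<close> bounds the codifferentials.\<close>

lemma (in complete_measure)
  fixes f :: "'a \<Rightarrow> 'y::euclidean_space \<Rightarrow> real" and dl du :: "'a \<Rightarrow> 'y \<Rightarrow> (real \<times> 'y) set"
  assumes f: "\<And>y. (\<lambda>x. f x y) \<in> borel_measurable M" "AE x in M. continuous_on UNIV (f x)"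
    and cod: "AE x in M. \<forall>y. is_codifferential (f x) y (dl x y) (du x y)"
    and y: "y \<in> borel_measurable M" and h: "h \<in> borel_measurable M"
    and R: "AE x in M. \<forall>z. norm z \<le> norm (h x) \<longrightarrow>
      (\<forall>(a, v)\<in>dl x (y x + z). norm v \<le> R x) \<and> (\<forall>(b, w)\<in>du x (y x + z). norm w \<le> R x)"
    and R_int: "integrable M (\<lambda>x. R x * norm (h x))"
    and f_int: "integrable M (\<lambda>x. f x (y x))" and t: "0 \<le> t" "t \<le> 1"
  shows AE_increment: "AE x in M. \<bar>f x (y x + t *\<^sub>R h x) - f x (y x)\<bar> \<le> t * (2 * (R x * norm (h x)))"
    and integrable_increment: "integrable M (\<lambda>x. f x (y x + t *\<^sub>R h x))"
    and integral_increment_bound: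
      "\<bar>(LINT x|M. f x (y x + t *\<^sub>R h x)) - (LINT x|M. f x (y x))\<bar> \<le> t * (LINT x|M. 2 * (R x * norm (h x)))"
proof -
  show le: "AE x in M. \<bar>f x (y x + t *\<^sub>R h x) - f x (y x)\<bar> \<le> t * (2 * (R x * norm (h x)))"
    using f(2) cod R
  proof eventually_elim
    case (elim x)
    have small: "norm (s *\<^sub>R t *\<^sub>R h x) \<le> norm (h x)" if "0 \<le> s" "s \<le> 1" for s
    proof -
      have "s * t \<le> 1" using that t by (intro mult_le_one)
      then show ?thesis using that t by (simp add: mult_left_le_one_le)
    qed
    have "\<bar>f x (y x + t *\<^sub>R h x) - f x (y x)\<bar> \<le> 2 * R x * norm (t *\<^sub>R h x)"
    proof (rule codifferentiable_lipschitz[OF elim(1), where A = "\<lambda>s. dl x (y x + s *\<^sub>R t *\<^sub>R h x)" and B = "\<lambda>s. du x (y x + s *\<^sub>R t *\<^sub>R h x)"])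
      show "is_codifferential (f x) (y x + s *\<^sub>R t *\<^sub>R h x) (dl x (y x + s *\<^sub>R t *\<^sub>R h x)) (du x (y x + s *\<^sub>R t *\<^sub>R h x))" for s
        using elim(2) by blast
    qed (use elim(3) small in blast)+
    then show ?case using t by (simp add: algebra_simps)
  qed
  have my: "(\<lambda>x. y x + t *\<^sub>R h x) \<in> borel_measurable M" using y h by measurable
  have mf: "(\<lambda>x. f x (y x + t *\<^sub>R h x)) \<in> borel_measurable M" "(\<lambda>x. f x (y x)) \<in> borel_measurable M"
    by (rule caratheodory_superposition[OF f my] caratheodory_superposition[OF f y])+
  have i2: "integrable M (\<lambda>x. t * (2 * (R x * norm (h x))))" using R_int by simp
  have d: "integrable M (\<lambda>x. f x (y x + t *\<^sub>R h x) - f x (y x))"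
  proof (rule Bochner_Integration.integrable_bound[OF i2])
    show "AE x in M. norm (f x (y x + t *\<^sub>R h x) - f x (y x)) \<le> norm (t * (2 * (R x * norm (h x))))"
      using le by eventually_elim (auto intro: order.trans[OF _ abs_ge_self])
  qed (use mf in auto)
  from Bochner_Integration.integrable_add[OF d f_int]
  show i: "integrable M (\<lambda>x. f x (y x + t *\<^sub>R h x))" by simp
  have "\<bar>LINT x|M. f x (y x + t *\<^sub>R h x) - f x (y x)\<bar> \<le> (LINT x|M. \<bar>f x (y x + t *\<^sub>R h x) - f x (y x)\<bar>)"
    by (rule integral_abs_bound)
  also have "\<dots> \<le> (LINT x|M. t * (2 * (R x * norm (h x))))"
    using le d i2 by (intro integral_mono_AE) auto
  finally show "\<bar>(LINT x|M. f x (y x + t *\<^sub>R h x)) - (LINT x|M. f x (y x))\<bar> \<le> t * (LINT x|M. 2 * (R x * norm (h x)))"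
    using i f_int by simp
qed

text \<open>The difference quotients exceed \<open>\<sigma>\<close> by a positive part that tends to
  0 and is dominated, so their integrals are eventually below 0 whenever the integral of
  \<open>\<sigma>\<close> is negative.\<close>

lemma (in complete_measure) integral_directional_upper:
  fixes f :: "'a \<Rightarrow> 'y::euclidean_space \<Rightarrow> real" and dl du :: "'a \<Rightarrow> 'y \<Rightarrow> (real \<times> 'y) set"
  assumes f: "\<And>y. (\<lambda>x. f x y) \<in> borel_measurable M" "AE x in M. continuous_on UNIV (f x)"
    and cod: "AE x in M. \<forall>y. is_codifferential (f x) y (dl x y) (du x y)"
    and dl: "\<And>y V. open V \<Longrightarrow> {x\<in>space M. dl x y \<inter> V \<noteq> {}} \<in> sets M"
      "AE x in M. \<forall>y. ((\<lambda>y'. hausdorff_dist (dl x y') (dl x y)) \<longlongrightarrow> 0) (at y)"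
    and y: "y \<in> borel_measurable M" and h: "h \<in> borel_measurable M"
    and w: "w \<in> borel_measurable M" "AE x in M. (0, w x) \<in> du x (y x)"
    and R: "AE x in M. \<forall>z. norm z \<le> norm (h x) \<longrightarrow>
      (\<forall>(a, v)\<in>dl x (y x + z). norm v \<le> R x) \<and> (\<forall>(b, w)\<in>du x (y x + z). norm w \<le> R x)"
    and R_int: "integrable M (\<lambda>x. R x * norm (h x))"
    and f_int: "integrable M (\<lambda>x. f x (y x))"
    and neg: "(LINT x|M. support_fun (zero_slice (dl x (y x))) (h x) + w x \<bullet> h x) < 0"
  shows "\<forall>\<^sub>F n in sequentially. (LINT x|M. f x (y x + h x /\<^sub>R real (Suc n))) < (LINT x|M. f x (y x))"
proof -
  let ?k = "\<lambda>n. real (Suc n)"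
  define \<sigma> where "\<sigma> x = support_fun (zero_slice (dl x (y x))) (h x) + w x \<bullet> h x" for x
  define q where "q n x = ?k n * (f x (y x + h x /\<^sub>R ?k n) - f x (y x))" for n x
  have hypo: "AE x in M. \<forall>y. compact (dl x y) \<and> convex (dl x y) \<and> dl x y \<noteq> {} \<and> hypo_max (dl x y) 0 = 0"
    using cod by eventually_elim (blast dest: is_codifferential_lower)
  have m\<sigma>[measurable]: "\<sigma> \<in> borel_measurable M"
    unfolding \<sigma>_def using w(1) h borel_measurable_support_fun_zero_slice[OF dl(1) hypo dl(2) y h] by measurable
  have \<sigma>_bound: "AE x in M. \<bar>\<sigma> x\<bar> \<le> 2 * (R x * norm (h x))"
    using hypo R w(2)
  proof eventually_elim
    case (elim x)
    then have A: "compact (dl x (y x))" "convex (dl x (y x))" "dl x (y x) \<noteq> {}" "hypo_max (dl x (y x)) 0 = 0" by auto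
    have 1: "norm v \<le> R x" if "v \<in> zero_slice (dl x (y x))" for v
      using elim(2)[rule_format, of 0] that by (auto simp: zero_slice_def)
    have 2: "norm (w x) \<le> R x"
      using elim(2)[rule_format, of 0] elim(3) by auto
    have "\<bar>w x \<bullet> h x\<bar> \<le> norm (w x) * norm (h x)" by (rule Cauchy_Schwarz_ineq2)
    also have "\<dots> \<le> R x * norm (h x)" using 2 by (intro mult_right_mono) auto
    finally show ?case
      using support_fun_bound[OF zero_slice_compact[OF A] zero_slice_nonempty[OF A] 1, of "h x"] unfolding \<sigma>_def by linarith
  qed
  have i2: "integrable M (\<lambda>x. 2 * (R x * norm (h x)))" using R_int by simp
  have \<sigma>_int: "integrable M \<sigma>"
    by (rule Bochner_Integration.integrable_bound[OF i2 m\<sigma>])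
       (use \<sigma>_bound in eventually_elim, auto intro: order.trans[OF _ abs_ge_self])
  have t: "0 \<le> inverse (?k n)" "inverse (?k n) \<le> 1" for n by (auto simp: inverse_le_1_iff)
  have fi: "integrable M (\<lambda>x. f x (y x + h x /\<^sub>R ?k n))" for n
    by (rule integrable_increment[OF f cod y h R R_int f_int t])
  have q_int: "integrable M (q n)" for n
    unfolding q_def using fi f_int by (intro integrable_mult_right Bochner_Integration.integrable_diff)
  have q_bound: "AE x in M. \<bar>q n x\<bar> \<le> 2 * (R x * norm (h x))" for n
    using AE_increment[OF f cod y h R R_int f_int t[of n]]
  proof eventually_elim
    case (elim x)
    then have "?k n * \<bar>f x (y x + h x /\<^sub>R ?k n) - f x (y x)\<bar> \<le> ?k n * (inverse (?k n) * (2 * (R x * norm (h x))))"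
      by (intro mult_left_mono) auto
    also have "\<dots> = 2 * (R x * norm (h x))" by (simp del: of_nat_Suc)
    finally show ?case by (simp add: q_def abs_mult del: of_nat_Suc)
  qed
  have "(\<lambda>n. LINT x|M. max 0 (q n x - \<sigma> x)) \<longlonglongrightarrow> (LINT x|M. 0)"
  \<comment> \<open>The quotient and \<open>\<sigma>\<close> are each bounded by
    \<open>2 * (R x * norm (h x))\<close>.\<close>
  proof (rule integral_dominated_convergence[where w = "\<lambda>x. 4 * (R x * norm (h x))"])
    show "AE x in M. (\<lambda>n. max 0 (q n x - \<sigma> x)) \<longlonglongrightarrow> 0"
      using cod w(2)
    proof eventually_elim
      case (elim x)
      then show ?case
        unfolding q_def \<sigma>_def by (intro is_codifferential_directional_upper[of "f x" "y x" "dl x (y x)" "du x (y x)"]) auto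
    qed
    show "AE x in M. norm (max 0 (q n x - \<sigma> x)) \<le> 4 * (R x * norm (h x))" for n
      using q_bound[of n] \<sigma>_bound by eventually_elim (auto simp: max_def)
    show "(\<lambda>x. max 0 (q n x - \<sigma> x)) \<in> borel_measurable M" for n using q_int[of n] by measurable
  qed (use R_int in auto)
  then have lim: "(\<lambda>n. LINT x|M. max 0 (q n x - \<sigma> x)) \<longlonglongrightarrow> 0" by simp
  have "(LINT x|M. \<sigma> x) < 0" unfolding \<sigma>_def by (rule neg)
  then have "0 < - (LINT x|M. \<sigma> x)" by linarith
  from order_tendstoD(2)[OF lim this]
  have "\<forall>\<^sub>F n in sequentially. (LINT x|M. max 0 (q n x - \<sigma> x)) < - (LINT x|M. \<sigma> x)" .
  then show ?thesis
  proof eventually_elim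
    case (elim n)
    have "integrable M (\<lambda>x. max 0 (q n x - \<sigma> x))" using q_int \<sigma>_int by (intro integrable_max) auto
    then have "(LINT x|M. q n x) \<le> (LINT x|M. \<sigma> x + max 0 (q n x - \<sigma> x))"
      using q_int \<sigma>_int by (intro integral_mono Bochner_Integration.integrable_add) auto
    also have "\<dots> = (LINT x|M. \<sigma> x) + (LINT x|M. max 0 (q n x - \<sigma> x))"
      using \<sigma>_int \<open>integrable M (\<lambda>x. max 0 (q n x - \<sigma> x))\<close> by simp
    also have "\<dots> < 0" using elim by simp
    also have "(LINT x|M. q n x) = ?k n * ((LINT x|M. f x (y x + h x /\<^sub>R ?k n)) - (LINT x|M. f x (y x)))"
      unfolding q_def using fi f_int by simp
    finally show ?case by (simp add: mult_less_0_iff del: of_nat_Suc)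
  qed
qed

section \<open>Lebesgue and Sobolev spaces\<close>

lemma enn2real_ge_1: "1 \<le> p \<Longrightarrow> p \<noteq> top \<Longrightarrow> 1 \<le> enn2real p"
  by (cases p) (auto simp: ennreal_1[symmetric] simp del: ennreal_1)

lemma Lp_space_measurable: "u \<in> Lp_space p \<Omega> \<Longrightarrow> u \<in> borel_measurable (lebesgue_on \<Omega>)"
  by (simp add: Lp_space_def)

lemma Lp_space_top_iff:
  "u \<in> Lp_space top \<Omega> \<longleftrightarrow> u \<in> borel_measurable (lebesgue_on \<Omega>) \<and> (\<exists>N. AE x in lebesgue_on \<Omega>. norm (u x) \<le> N)"
proof -
  have "(\<exists>N. AE x in lebesgue_on \<Omega>. norm (u x) \<le> N)"
    if "esssup (lebesgue_on \<Omega>) (\<lambda>x. ereal (norm (u x))) < \<infinity>"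
  proof -
    have "esssup (lebesgue_on \<Omega>) (\<lambda>x. ereal (norm (u x))) \<noteq> \<infinity>" using that by simp
    then obtain N :: nat where N: "esssup (lebesgue_on \<Omega>) (\<lambda>x. ereal (norm (u x))) < ereal (real N)"
      unfolding less_PInf_Ex_of_nat by blast
    have "AE x in lebesgue_on \<Omega>. norm (u x) \<le> real N"
      using esssup_AE[of "\<lambda>x. ereal (norm (u x))" "lebesgue_on \<Omega>"]
    proof eventually_elim
      case (elim x)
      then have "ereal (norm (u x)) < ereal (real N)" using N by (rule order.strict_trans1)
      then show ?case by simp
    qed
    then show ?thesis by blast
  qed
  moreover have "esssup (lebesgue_on \<Omega>) (\<lambda>x. ereal (norm (u x))) < \<infinity>"
    if "u \<in> borel_measurable (lebesgue_on \<Omega>)" "AE x in lebesgue_on \<Omega>. norm (u x) \<le> N" for N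
  proof -
    have "esssup (lebesgue_on \<Omega>) (\<lambda>x. ereal (norm (u x))) \<le> ereal N"
      using that by (intro esssup_I) auto
    then show ?thesis by (rule order.strict_trans1) simp
  qed
  ultimately show ?thesis by (auto simp: Lp_space_def)
qed

lemma Lp_space_finite_iff:
  "p \<noteq> top \<Longrightarrow> u \<in> Lp_space p \<Omega> \<longleftrightarrow> u \<in> borel_measurable (lebesgue_on \<Omega>) \<and>
    integrable (lebesgue_on \<Omega>) (\<lambda>x. norm (u x) powr enn2real p)"
  by (simp add: Lp_space_def)

lemma Lp_space_dominated:
  fixes u :: "'a::euclidean_space \<Rightarrow> 'b::euclidean_space" and v :: "'a \<Rightarrow> 'c::euclidean_space"
  assumes u: "u \<in> Lp_space p \<Omega>" and v: "v \<in> borel_measurable (lebesgue_on \<Omega>)"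
    and le: "AE x in lebesgue_on \<Omega>. norm (v x) \<le> norm (u x)"
  shows "v \<in> Lp_space p \<Omega>"
proof (cases "p = top")
  case True
  then obtain N where "AE x in lebesgue_on \<Omega>. norm (u x) \<le> N" using u by (auto simp: Lp_space_top_iff)
  with le have "AE x in lebesgue_on \<Omega>. norm (v x) \<le> N" by eventually_elim simp
  then show ?thesis using True v by (auto simp: Lp_space_top_iff)
next
  case False
  have "integrable (lebesgue_on \<Omega>) (\<lambda>x. norm (v x) powr enn2real p)"
  proof (rule Bochner_Integration.integrable_bound)
    show "integrable (lebesgue_on \<Omega>) (\<lambda>x. norm (u x) powr enn2real p)" using u False by (simp add: Lp_space_finite_iff)
    show "AE x in lebesgue_on \<Omega>. norm (norm (v x) powr enn2real p) \<le> norm (norm (u x) powr enn2real p)"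
      using le by eventually_elim (simp add: powr_mono2)
  qed (use v in measurable)
  then show ?thesis using v False by (simp add: Lp_space_finite_iff)
qed

lemma Lp_space_scaleR:
  assumes "u \<in> Lp_space p \<Omega>" shows "(\<lambda>x. c *\<^sub>R u x) \<in> Lp_space p \<Omega>"
proof (cases "p = top")
  case True
  then obtain N where "AE x in lebesgue_on \<Omega>. norm (u x) \<le> N" using assms by (auto simp: Lp_space_top_iff)
  then have "AE x in lebesgue_on \<Omega>. norm (c *\<^sub>R u x) \<le> \<bar>c\<bar> * N" by eventually_elim (simp add: mult_left_mono)
  then show ?thesis using True Lp_space_measurable[OF assms] by (auto simp: Lp_space_top_iff)
next
  case False
  then show ?thesis using assms by (auto simp: Lp_space_finite_iff powr_mult)
qed

lemma Lp_space_add: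
  fixes u v :: "'a::euclidean_space \<Rightarrow> 'b::euclidean_space"
  assumes "u \<in> Lp_space p \<Omega>" "v \<in> Lp_space p \<Omega>" shows "(\<lambda>x. u x + v x) \<in> Lp_space p \<Omega>"
proof (cases "p = top")
  case True
  then obtain N N' where "AE x in lebesgue_on \<Omega>. norm (u x) \<le> N" "AE x in lebesgue_on \<Omega>. norm (v x) \<le> N'"
    using assms by (auto simp: Lp_space_top_iff)
  then have "AE x in lebesgue_on \<Omega>. norm (u x + v x) \<le> N + N'"
    by eventually_elim (rule norm_triangle_mono)
  then show ?thesis using True assms[THEN Lp_space_measurable] by (auto simp: Lp_space_top_iff)
next
  case False
  let ?r = "enn2real p"
  note [measurable] = assms[THEN Lp_space_measurable]
  have "integrable (lebesgue_on \<Omega>) (\<lambda>x. norm (u x + v x) powr ?r)"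
  proof (rule Bochner_Integration.integrable_bound)
    show "integrable (lebesgue_on \<Omega>) (\<lambda>x. 2 powr ?r * (norm (u x) powr ?r + norm (v x) powr ?r))"
      using assms False by (auto simp: Lp_space_finite_iff)
    show "AE x in lebesgue_on \<Omega>. norm (norm (u x + v x) powr ?r) \<le> norm (2 powr ?r * (norm (u x) powr ?r + norm (v x) powr ?r))"
    proof (rule AE_I2)
      fix x
      let ?m = "max (norm (u x)) (norm (v x))"
      have "norm (u x + v x) \<le> 2 * ?m" using norm_triangle_ineq[of "u x" "v x"] by linarith
      then have "norm (u x + v x) powr ?r \<le> (2 * ?m) powr ?r" by (intro powr_mono2) auto
      also have "\<dots> = 2 powr ?r * ?m powr ?r" by (simp add: powr_mult)
      also have "\<dots> \<le> 2 powr ?r * (norm (u x) powr ?r + norm (v x) powr ?r)"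
        by (intro mult_left_mono) (auto simp: max_def)
      finally show "norm (norm (u x + v x) powr ?r) \<le> norm (2 powr ?r * (norm (u x) powr ?r + norm (v x) powr ?r))" by simp
    qed
  qed measurable
  then show ?thesis using False by (simp add: Lp_space_finite_iff)
qed

lemma Lp_space_one_integrable:
  fixes u :: "'a::euclidean_space \<Rightarrow> real"
  assumes "u \<in> Lp_space 1 \<Omega>" shows "integrable (lebesgue_on \<Omega>) u"
proof -
  have "integrable (lebesgue_on \<Omega>) (\<lambda>x. norm (u x))" using assms by (auto simp: Lp_space_finite_iff)
  then show ?thesis using Lp_space_measurable[OF assms] by (rule integrable_norm_cancel)
qed

lemma test_functions_Lp_space:
  assumes \<Omega>: "open \<Omega>" and h: "h \<in> test_functions \<Omega>" shows "h \<in> Lp_space p \<Omega>"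
proof -
  note [measurable] = test_functions_measurable_on[OF h]
  obtain B where B: "0 < B" "\<And>x. norm (h x) \<le> B" using test_functions_norm_bound[OF h] by blast
  show ?thesis
  proof (cases "p = top")
    case True
    then show ?thesis using B by (auto simp: Lp_space_top_iff)
  next
    case False
    obtain K where K: "compact K" "K \<subseteq> \<Omega>" "\<And>x. x \<notin> K \<Longrightarrow> h x = 0"
      using h unfolding test_functions_iff by blast
    then have "finite_measure (lebesgue_on K)" by (simp add: lmeasurable_compact finite_measure_lebesgue_on)
    then have "integrable (lebesgue_on K) (\<lambda>x. norm (h x) powr enn2real p)"
      by (rule finite_measure.integrable_const_bound[where B = "B powr enn2real p"])
         (use B in \<open>auto intro!: AE_I2 powr_mono2\<close>)
    then have "integrable (lebesgue_on \<Omega>) (\<lambda>x. norm (h x) powr enn2real p)"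
      using K open_compact_sets_lebesgue[OF \<Omega> K(1)] by (subst integral_lebesgue_on_superset(2)[of K \<Omega>]) auto
    then show ?thesis using False by (simp add: Lp_space_finite_iff)
  qed
qed

text \<open>On a compact set constants are integrable, and a norm is at most 1 plus its power with
  exponent at least 1.\<close>

lemma Lp_space_locally_integrable:
  fixes \<rho> :: "'a::euclidean_space \<Rightarrow> 'b::euclidean_space"
  assumes \<Omega>: "open \<Omega>" and \<rho>: "\<rho> \<in> Lp_space q \<Omega>" and q: "1 \<le> q" shows "locally_integrable \<Omega> \<rho>"
  unfolding locally_integrable_def
proof (intro allI impI)
  fix K assume "compact K \<and> K \<subseteq> \<Omega>"
  then have K: "compact K" "K \<subseteq> \<Omega>" "K \<in> sets lebesgue" "\<Omega> \<in> sets lebesgue"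
    using open_compact_sets_lebesgue[OF \<Omega>] by auto
  have fin: "finite_measure (lebesgue_on K)" using K by (simp add: lmeasurable_compact finite_measure_lebesgue_on)
  have m: "\<rho> \<in> borel_measurable (lebesgue_on K)"
    using measurable_restrict_mono[OF Lp_space_measurable[OF \<rho>] K(2)] .
  show "integrable (lebesgue_on K) \<rho>"
  proof (cases "q = top")
    case True
    then obtain N where "AE x in lebesgue_on \<Omega>. norm (\<rho> x) \<le> N" using \<rho> by (auto simp: Lp_space_top_iff)
    then have "AE x in lebesgue_on K. norm (\<rho> x) \<le> N"
      using K by (auto simp: AE_restrict_space_iff elim: eventually_mono)
    then show ?thesis using finite_measure.integrable_const_bound[OF fin _ m] by blast
  next
    case False
    have r: "1 \<le> enn2real q" using q False by (rule enn2real_ge_1)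
    have "integrable (lebesgue_on \<Omega>) (\<lambda>x. norm (\<rho> x) powr enn2real q)" using \<rho> False by (simp add: Lp_space_finite_iff)
    then have "integrable lebesgue (\<lambda>x. indicator K x *\<^sub>R (indicator \<Omega> x *\<^sub>R (norm (\<rho> x) powr enn2real q)))"
      using K(4) by (intro integrable_mult_indicator[OF K(3)]) (simp only: integrable_lebesgue_on_iff)
    moreover have "(\<lambda>x. indicator K x *\<^sub>R (indicator \<Omega> x *\<^sub>R (norm (\<rho> x) powr enn2real q)))
        = (\<lambda>x. indicator K x *\<^sub>R (norm (\<rho> x) powr enn2real q))"
      using K(2) by (auto simp: indicator_def fun_eq_iff)
    ultimately have "integrable (lebesgue_on K) (\<lambda>x. norm (\<rho> x) powr enn2real q)"
      using K(3) by (simp only: integrable_lebesgue_on_iff)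
    then have "integrable (lebesgue_on K) (\<lambda>x. 1 + norm (\<rho> x) powr enn2real q)"
      using fin by (simp add: finite_measure.integrable_const)
    then show ?thesis
    proof (rule Bochner_Integration.integrable_bound[OF _ m], intro AE_I2)
      fix x
      have "norm (\<rho> x) \<le> 1 + norm (\<rho> x) powr enn2real q"
      proof (cases "norm (\<rho> x) \<le> 1")
        case True
        then show ?thesis using powr_ge_zero[of "norm (\<rho> x)" "enn2real q"] by linarith
      next
        case False
        then have "norm (\<rho> x) powr 1 \<le> norm (\<rho> x) powr enn2real q" using r by (intro powr_mono) auto
        then show ?thesis using False by simp
      qed
      then show "norm (\<rho> x) \<le> norm (1 + norm (\<rho> x) powr enn2real q)" by simp
    qed
  qed
qed

text \<open>The constant \<open>c\<close> is kept apart from \<open>\<rho>\<close>: over a set of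
  infinite measure it may fail to lie in the Lebesgue space of \<open>\<rho>\<close>, but against a
  bounded function of compact support local integrability suffices.\<close>

lemma integrable_locally_integrable_mult_norm_test:
  fixes \<rho> :: "'a::euclidean_space \<Rightarrow> real" and h :: "'a \<Rightarrow> 'b::euclidean_space"
  assumes \<Omega>: "open \<Omega>" and \<rho>: "locally_integrable \<Omega> \<rho>"
    and h: "h \<in> borel_measurable (lebesgue_on \<Omega>)" "\<And>x. norm (h x) \<le> B" "compact K" "K \<subseteq> \<Omega>" "\<And>x. x \<notin> K \<Longrightarrow> h x = 0"
  shows "integrable (lebesgue_on \<Omega>) (\<lambda>x. (\<rho> x + c) * norm (h x))"
proof -
  have fin: "finite_measure (lebesgue_on K)" using h by (simp add: lmeasurable_compact finite_measure_lebesgue_on)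
  have m: "h \<in> borel_measurable (lebesgue_on K)" using measurable_restrict_mono[OF h(1,4)] .
  have \<rho>K: "integrable (lebesgue_on K) (\<lambda>x. B * (\<rho> x + c))"
    using \<rho> h fin by (simp add: locally_integrable_def finite_measure.integrable_const)
  have "0 \<le> B" using h(2)[of undefined] norm_ge_zero order.trans by blast
  have "integrable (lebesgue_on K) (\<lambda>x. (\<rho> x + c) * norm (h x))"
  proof (rule Bochner_Integration.integrable_bound[OF \<rho>K], goal_cases)
    case 1
    have "\<rho> \<in> borel_measurable (lebesgue_on K)" using \<rho> h unfolding locally_integrable_def by auto
    then show ?case using m by measurable
  next
    case 2
    show ?case
      using h(2) \<open>0 \<le> B\<close> by (intro AE_I2) (auto simp: abs_mult mult.commute[of B] intro!: mult_left_mono)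
  qed
  then show ?thesis
    using h open_compact_sets_lebesgue[OF \<Omega> h(3)] by (subst integral_lebesgue_on_superset(2)[of K \<Omega>]) auto
qed

lemma sigma_finite_measure_lebesgue_on:
  assumes "S \<in> sets lebesgue" shows "sigma_finite_measure (lebesgue_on S)"
proof (rule sigma_finite_measure_restrict_space[OF _ assms])
  obtain A :: "'a set set" where A: "countable A" "A \<subseteq> sets lborel" "\<Union>A = space lborel" "\<forall>a\<in>A. emeasure lborel a \<noteq> \<infinity>"
    using lborel.sigma_finite_countable by blast
  then have "\<forall>a\<in>A. emeasure lebesgue a \<noteq> \<infinity>" by auto
  then show "sigma_finite_measure (lebesgue :: 'a measure)"
    using A by (intro sigma_finite_measure.intro exI[of _ A]) (auto intro: sets_completionI_sets)
qed

lemma Lp_norm_scaleR: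
  assumes "0 < c" "1 \<le> p" shows "Lp_norm p \<Omega> (\<lambda>x. c *\<^sub>R u x) = c * Lp_norm p \<Omega> u"
proof (cases "p = top")
  case True
  have "esssup (lebesgue_on \<Omega>) (\<lambda>x. ereal (norm (c *\<^sub>R u x))) = ereal c * esssup (lebesgue_on \<Omega>) (\<lambda>x. ereal (norm (u x)))"
    using esssup_cmult[OF assms(1), of "lebesgue_on \<Omega>" "\<lambda>x. ereal (norm (u x))"] assms(1) by simp
  then show ?thesis using True by (simp add: Lp_norm_def)
next
  case False
  have r: "1 \<le> enn2real p" using assms(2) False by (rule enn2real_ge_1)
  have "(LINT x|lebesgue_on \<Omega>. norm (c *\<^sub>R u x) powr enn2real p) = c powr enn2real p * (LINT x|lebesgue_on \<Omega>. norm (u x) powr enn2real p)"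
    using assms(1) by (simp add: powr_mult)
  then show ?thesis using False assms(1) r by (simp add: Lp_norm_def powr_mult powr_powr)
qed

lemma Lp_norm_cong_AE:
  assumes m: "u \<in> borel_measurable (lebesgue_on \<Omega>)" "v \<in> borel_measurable (lebesgue_on \<Omega>)"
    and eq: "AE x in lebesgue_on \<Omega>. u x = v x"
  shows "Lp_norm p \<Omega> u = Lp_norm p \<Omega> v"
proof -
  have "esssup (lebesgue_on \<Omega>) (\<lambda>x. ereal (norm (u x))) = esssup (lebesgue_on \<Omega>) (\<lambda>x. ereal (norm (v x)))"
    using eq m by (intro esssup_AE_cong) (auto elim: eventually_mono)
  moreover have "(LINT x|lebesgue_on \<Omega>. norm (u x) powr enn2real p) = (LINT x|lebesgue_on \<Omega>. norm (v x) powr enn2real p)"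
    using eq m by (intro integral_cong_AE) (auto elim: eventually_mono)
  ultimately show ?thesis by (simp add: Lp_norm_def)
qed

text \<open>The representative picked by \<open>weak_grad\<close> differs from \<open>G\<close> on a
  null set, which completeness makes harmless.\<close>

lemma weak_grad_measurable:
  assumes "open \<Omega>" "has_weak_grad \<Omega> u G" "G \<in> borel_measurable (lebesgue_on \<Omega>)"
  shows "weak_grad \<Omega> u \<in> borel_measurable (lebesgue_on \<Omega>)"
proof -
  have "AE x in lebesgue_on \<Omega>. G x = weak_grad \<Omega> u x"
    using weak_grad_AE_eq[OF assms(1,2)] by eventually_elim simp
  moreover have "complete_measure (lebesgue_on \<Omega>)" using assms(1) by (intro complete_measure_lebesgue_on) auto
  ultimately show ?thesis using complete_measure.borel_measurable_AE_eq assms(3) by blast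
qed

text \<open>This brings the perturbations \<open>us + t *\<^sub>R h\<close> into the neighbourhood
  of local optimality for small \<open>t\<close>. Scaling commutes with the chosen weak gradients
  only almost everywhere.\<close>

lemma sobolev_norm_scaleR_test_function:
  assumes \<Omega>: "open \<Omega>" and h: "h \<in> test_functions \<Omega>" and c: "0 < c" and p: "1 \<le> p"
  shows "sobolev_norm p \<Omega> (\<lambda>x. c *\<^sub>R h x) = c * sobolev_norm p \<Omega> h"
proof -
  note g = has_weak_grad_test_function[OF \<Omega> h] and mj = test_functions_measurable_on[OF jacobian_test_function[OF h]]
  note cg = has_weak_grad_scaleR[OF g, of c]
  have "AE x in lebesgue_on \<Omega>. weak_grad \<Omega> (\<lambda>x. c *\<^sub>R h x) x = c *\<^sub>R weak_grad \<Omega> h x"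
    using weak_grad_AE_eq[OF \<Omega> g] weak_grad_AE_eq[OF \<Omega> cg] by eventually_elim simp
  then have "Lp_norm p \<Omega> (weak_grad \<Omega> (\<lambda>x. c *\<^sub>R h x)) = Lp_norm p \<Omega> (\<lambda>x. c *\<^sub>R weak_grad \<Omega> h x)"
    using weak_grad_measurable[OF \<Omega> g mj] weak_grad_measurable[OF \<Omega> cg] mj by (intro Lp_norm_cong_AE) auto
  then have eq: "Lp_norm p \<Omega> (weak_grad \<Omega> (\<lambda>x. c *\<^sub>R h x)) = c * Lp_norm p \<Omega> (weak_grad \<Omega> h)"
    using Lp_norm_scaleR[OF c p] by simp
  show ?thesis
  proof (cases "p = top")
    case True
    then show ?thesis using c eq Lp_norm_scaleR[OF c p, of \<Omega> h] by (simp add: sobolev_norm_def max_mult_distrib_left)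
  next
    case False
    have r: "1 \<le> enn2real p" using p False by (rule enn2real_ge_1)
    have nn: "0 \<le> Lp_norm p \<Omega> h" "0 \<le> Lp_norm p \<Omega> (weak_grad \<Omega> h)" using False by (auto simp: Lp_norm_def)
    have "(c * Lp_norm p \<Omega> h) powr enn2real p + (c * Lp_norm p \<Omega> (weak_grad \<Omega> h)) powr enn2real p
        = c powr enn2real p * (Lp_norm p \<Omega> h powr enn2real p + Lp_norm p \<Omega> (weak_grad \<Omega> h) powr enn2real p)"
      using c nn by (simp add: powr_mult distrib_left)
    then show ?thesis using False c r Lp_norm_scaleR[OF c p, of \<Omega> h] by (simp add: sobolev_norm_def eq powr_mult powr_powr)
  qed
qed

lemma sobolevI:
  assumes \<Omega>: "open \<Omega>" and "u \<in> Lp_space p \<Omega>" and G: "has_weak_grad \<Omega> u G" "G \<in> Lp_space p \<Omega>"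
  shows "u \<in> sobolev p \<Omega>"
proof -
  have "weak_grad \<Omega> u \<in> borel_measurable (lebesgue_on \<Omega>)"
    using weak_grad_measurable[OF \<Omega> G(1) Lp_space_measurable[OF G(2)]] .
  then have "weak_grad \<Omega> u \<in> Lp_space p \<Omega>"
    by (rule Lp_space_dominated[OF G(2)]) (use weak_grad_AE_eq[OF \<Omega> G(1)] in eventually_elim, simp)
  then show ?thesis using assms by (auto simp: sobolev_def)
qed

lemma sobolevD:
  assumes "u \<in> sobolev p \<Omega>"
  shows "u \<in> Lp_space p \<Omega>" "has_weak_grad \<Omega> u (weak_grad \<Omega> u)" "weak_grad \<Omega> u \<in> Lp_space p \<Omega>"
  using assms someI_ex[of "has_weak_grad \<Omega> u"] by (auto simp: sobolev_def weak_grad_def)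

lemma sobolev_add:
  assumes \<Omega>: "open \<Omega>" and uv: "u \<in> sobolev p \<Omega>" "v \<in> sobolev p \<Omega>" shows "(\<lambda>x. u x + v x) \<in> sobolev p \<Omega>"
proof (rule sobolevI[OF \<Omega>])
  show "has_weak_grad \<Omega> (\<lambda>x. u x + v x) (\<lambda>x. weak_grad \<Omega> u x + weak_grad \<Omega> v x)"
    using uv by (intro has_weak_grad_add[OF \<Omega>] sobolevD)
qed (use uv in \<open>auto intro: Lp_space_add sobolevD\<close>)

lemma test_functions_sobolev:
  assumes \<Omega>: "open \<Omega>" and h: "h \<in> test_functions \<Omega>" shows "h \<in> sobolev p \<Omega>"
  by (rule sobolevI[OF \<Omega> test_functions_Lp_space[OF \<Omega> h] has_weak_grad_test_function[OF \<Omega> h]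
      test_functions_Lp_space[OF \<Omega> jacobian_test_function[OF h]]])

text \<open>Shifting the approximating test functions by \<open>h\<close> leaves the distances
  unchanged.\<close>

lemma sobolev0_add_test_function:
  fixes u h :: "real^'d \<Rightarrow> real^'m"
  assumes \<Omega>: "open \<Omega>" and u: "u \<in> sobolev0 p \<Omega>" and h: "h \<in> test_functions \<Omega>"
  shows "(\<lambda>x. u x + h x) \<in> sobolev0 p \<Omega>"
  unfolding sobolev0_def
proof (intro CollectI conjI allI impI)
  show "(\<lambda>x. u x + h x) \<in> sobolev p \<Omega>"
    using u by (intro sobolev_add[OF \<Omega> _ test_functions_sobolev[OF \<Omega> h]]) (simp add: sobolev0_def)
  fix \<epsilon> :: real assume "0 < \<epsilon>"
  then obtain \<phi> where \<phi>: "\<phi> \<in> test_functions \<Omega>" "sobolev_norm p \<Omega> (\<lambda>x. u x - \<phi> x) < \<epsilon>"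
    using u by (auto simp: sobolev0_def)
  then show "\<exists>\<psi>\<in>test_functions \<Omega>. sobolev_norm p \<Omega> (\<lambda>x. u x + h x - \<psi> x) < \<epsilon>"
    by (intro bexI[of _ "\<lambda>x. \<phi> x + h x"] test_functions_add h) auto
qed

section \<open>Growth conditions along Sobolev functions\<close>

lemma conj_exp_ge_1:
  assumes "1 \<le> p" shows "1 \<le> conj_exp p"
proof (cases "p = 1 \<or> p = top")
  case False
  then have "1 \<le> enn2real p" using assms by (auto intro: enn2real_ge_1)
  moreover have "enn2real p \<noteq> 1" using False by (cases p) auto
  ultimately have "1 < enn2real p" by linarith
  then have "1 \<le> enn2real p / (enn2real p - 1)" by (simp add: le_divide_eq)
  then have "ennreal 1 \<le> ennreal (enn2real p / (enn2real p - 1))" by (rule ennreal_leI)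
  then show ?thesis using False by (simp add: conj_exp_def)
qed (auto simp: conj_exp_def)

text \<open>For the conjugate exponent p' one has (p - 1) p' = p.\<close>

lemma Lp_space_powr_conj_exp:
  fixes u :: "'a::euclidean_space \<Rightarrow> 'b::euclidean_space"
  assumes u: "u \<in> Lp_space p \<Omega>" and p: "p \<noteq> top" "1 < enn2real p"
  shows "(\<lambda>x. norm (u x) powr (enn2real p - 1)) \<in> Lp_space (conj_exp p) \<Omega>"
proof -
  have "p \<noteq> 1" using p(2) by auto
  then have q: "conj_exp p = ennreal (enn2real p / (enn2real p - 1))" using p by (simp add: conj_exp_def)
  then have "enn2real (conj_exp p) = enn2real p / (enn2real p - 1)" using p by simp
  then have "norm (norm (u x) powr (enn2real p - 1)) powr enn2real (conj_exp p) = norm (u x) powr enn2real p" for x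
    using p \<open>p \<noteq> 1\<close> by (simp add: powr_powr)
  moreover have "conj_exp p \<noteq> top" using q by simp
  ultimately show ?thesis using u p Lp_space_measurable[OF u] by (simp add: Lp_space_finite_iff)
qed

lemma norm_add_powr_le:
  fixes a z :: "'e::real_normed_vector"
  assumes "norm z \<le> B" "0 \<le> s"
  shows "norm (a + z) powr s \<le> 2 powr s * (norm a powr s + B powr s)"
proof -
  have B: "0 \<le> B" using assms(1) norm_ge_zero order.trans by blast
  have "norm (a + z) \<le> 2 * max (norm a) B" using norm_triangle_ineq[of a z] assms(1) by linarith
  then have "norm (a + z) powr s \<le> (2 * max (norm a) B) powr s" using assms(2) by (intro powr_mono2) auto
  also have "\<dots> = 2 powr s * max (norm a) B powr s" using B by (simp add: powr_mult)
  also have "\<dots> \<le> 2 powr s * (norm a powr s + B powr s)" by (intro mult_left_mono) (auto simp: max_def)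
  finally show ?thesis .
qed

lemma norm_Pair_le_if:
  assumes "norm a \<le> c" "norm b \<le> c" shows "norm (a, b) \<le> 2 * c"
  using norm_Pair_le[of a b] assms by linarith

text \<open>The growth condition speaks of pairs from both components, so an element of one needs a
  partner in the other. The factor 2 comes from
  \<open>norm (v1, v2) \<le> norm v1 + norm v2\<close>.\<close>

lemma norm_bounds_of_pairwise_Max:
  fixes A B :: "(real \<times> 'u::real_normed_vector \<times> 'v::real_normed_vector) set"
  assumes le: "\<And>a v1 v2 b w1 w2. (a, v1, v2) \<in> A \<Longrightarrow> (b, w1, w2) \<in> B \<Longrightarrow>
      Max {norm v1, norm v2, norm w1, norm w2} \<le> k"
    and ne: "A \<noteq> {}" "B \<noteq> {}"
  shows "(\<forall>(a, v)\<in>A. norm v \<le> 2 * k) \<and> (\<forall>(b, w)\<in>B. norm w \<le> 2 * k)"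
proof -
  obtain a0 v0 v0' b0 w0 w0' where 0: "(a0, v0, v0') \<in> A" "(b0, w0, w0') \<in> B" using ne by fastforce
  have "norm v \<le> 2 * k" if "(a, v) \<in> A" for a v
    using le[of a "fst v" "snd v", OF _ 0(2)] that norm_Pair_le_if[of "fst v" k "snd v"] by auto
  moreover have "norm w \<le> 2 * k" if "(b, w) \<in> B" for b w
    using le[OF 0(1), of b "fst w" "snd w"] that norm_Pair_le_if[of "fst w" k "snd w"] by auto
  ultimately show ?thesis by blast
qed

text \<open>Two uses determine this form. At the solution itself, \<open>B = 0\<close>, the bound
  has to lie in L^{p'}, so the constant must vanish; along perturbations, \<open>B > 0\<close>, a
  constant is unavoidable in general, but local integrability is enough.\<close>

lemma codiff_growth_bound:
  fixes dl du :: "'x::euclidean_space \<Rightarrow> 'u::euclidean_space \<times> 'v::euclidean_space \<Rightarrow> (real \<times> 'u \<times> 'v) set"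
  assumes p: "1 \<le> p" and growth: "codiff_growth_condition p \<Omega> dl du"
    and u: "u \<in> Lp_space p \<Omega>" and g: "g \<in> Lp_space p \<Omega>" and B: "0 \<le> B"
    and ne: "AE x in lebesgue_on \<Omega>. \<forall>y. dl x y \<noteq> {} \<and> du x y \<noteq> {}"
  obtains \<rho> c where "\<rho> \<in> Lp_space (conj_exp p) \<Omega>" "B = 0 \<Longrightarrow> c = 0"
    "AE x in lebesgue_on \<Omega>. \<forall>z. norm z \<le> B \<longrightarrow>
      (\<forall>(a, v)\<in>dl x ((u x, g x) + z). norm v \<le> \<rho> x + c) \<and> (\<forall>(b, w)\<in>du x ((u x, g x) + z). norm w \<le> \<rho> x + c)"
proof (cases "p = top")
  case True
  obtain Nu Ng where N: "AE x in lebesgue_on \<Omega>. norm (u x) \<le> Nu" "AE x in lebesgue_on \<Omega>. norm (g x) \<le> Ng"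
    using u g True by (auto simp: Lp_space_top_iff)
  \<comment> \<open>Absolute values guard against negative a.e. bounds, which a null set admits; the
    summand 1 makes \<open>N\<close> positive.\<close>
  define N where "N = \<bar>Nu\<bar> + \<bar>Ng\<bar> + B + 1"
  have "0 < N" using B by (simp add: N_def)
  then obtain \<beta> where \<beta>: "\<beta> \<in> Lp_space 1 \<Omega>"
    "AE x in lebesgue_on \<Omega>. \<forall>u \<xi>. max (norm u) (norm \<xi>) \<le> N \<longrightarrow>
       (\<forall>(a, v1, v2)\<in>dl x (u, \<xi>). \<forall>(b, w1, w2)\<in>du x (u, \<xi>).
          Max {\<bar>a\<bar>, norm v1, norm v2, \<bar>b\<bar>, norm w1, norm w2} \<le> \<beta> x)"
    using growth True unfolding codiff_growth_condition_def by auto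
  show ?thesis
  proof (rule that[of "\<lambda>x. 2 *\<^sub>R \<beta> x" 0])
    show "(\<lambda>x. 2 *\<^sub>R \<beta> x) \<in> Lp_space (conj_exp p) \<Omega>"
      using Lp_space_scaleR[OF \<beta>(1)] True by (simp add: conj_exp_def)
    show "AE x in lebesgue_on \<Omega>. \<forall>z. norm z \<le> B \<longrightarrow>
      (\<forall>(a, v)\<in>dl x ((u x, g x) + z). norm v \<le> 2 *\<^sub>R \<beta> x + 0) \<and> (\<forall>(b, w)\<in>du x ((u x, g x) + z). norm w \<le> 2 *\<^sub>R \<beta> x + 0)"
      using N \<beta>(2) ne
    proof eventually_elim
      case (elim x)
      show ?case
      proof (intro allI impI)
        fix z :: "'u \<times> 'v" assume z: "norm z \<le> B"
        obtain z1 z2 where z12: "z = (z1, z2)" by fastforce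
        have "norm z1 \<le> B" "norm z2 \<le> B"
          using z norm_fst_le[of z1 z2] norm_snd_le[of z2 z1] unfolding z12 by auto
        then have "max (norm (u x + z1)) (norm (g x + z2)) \<le> N"
          using elim(1,2) norm_triangle_ineq[of "u x" z1] norm_triangle_ineq[of "g x" z2] by (auto simp: N_def)
        then have b: "\<forall>(a, v1, v2)\<in>dl x (u x + z1, g x + z2). \<forall>(b, w1, w2)\<in>du x (u x + z1, g x + z2).
            Max {\<bar>a\<bar>, norm v1, norm v2, \<bar>b\<bar>, norm w1, norm w2} \<le> \<beta> x"
          using elim(3) by blast
        have "(\<forall>(a, v)\<in>dl x (u x + z1, g x + z2). norm v \<le> 2 * \<beta> x) \<and> (\<forall>(b, w)\<in>du x (u x + z1, g x + z2). norm w \<le> 2 * \<beta> x)"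
        proof (rule norm_bounds_of_pairwise_Max)
          fix a v1 v2 b' w1 w2 assume "(a, v1, v2) \<in> dl x (u x + z1, g x + z2)" "(b', w1, w2) \<in> du x (u x + z1, g x + z2)"
          with b have "Max {\<bar>a\<bar>, norm v1, norm v2, \<bar>b'\<bar>, norm w1, norm w2} \<le> \<beta> x" by fast
          then show "Max {norm v1, norm v2, norm w1, norm w2} \<le> \<beta> x" by simp
        qed (use elim(4) in auto)
        then show "(\<forall>(a, v)\<in>dl x ((u x, g x) + z). norm v \<le> 2 *\<^sub>R \<beta> x + 0) \<and> (\<forall>(b, w)\<in>du x ((u x, g x) + z). norm w \<le> 2 *\<^sub>R \<beta> x + 0)"
          unfolding z12 by simp
      qed
    qed
  qed simp
next
  case False
  define r where "r = enn2real p"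
  have r: "1 \<le> r" using enn2real_ge_1[OF p False] by (simp add: r_def)
  obtain C \<gamma> where C: "0 < C" and \<gamma>: "\<gamma> \<in> Lp_space (conj_exp p) \<Omega>"
    and b: "AE x in lebesgue_on \<Omega>. \<forall>u \<xi>. \<forall>(a, v1, v2)\<in>dl x (u, \<xi>). \<forall>(b, w1, w2)\<in>du x (u, \<xi>).
      Max {norm v1, norm v2, norm w1, norm w2} \<le> \<gamma> x + C * (rpow (norm u) (r - 1) + rpow (norm \<xi>) (r - 1))"
  proof -
    obtain C \<beta> \<gamma> where *: "0 < C" "\<gamma> \<in> Lp_space (conj_exp p) \<Omega>"
      "AE x in lebesgue_on \<Omega>. \<forall>u \<xi>. \<forall>(a, v1, v2)\<in>dl x (u, \<xi>). \<forall>(b, w1, w2)\<in>du x (u, \<xi>).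
        max \<bar>a\<bar> \<bar>b\<bar> \<le> \<beta> x + C * (norm u powr r + norm \<xi> powr r) \<and>
        Max {norm v1, norm v2, norm w1, norm w2} \<le> \<gamma> x + C * (rpow (norm u) (r - 1) + rpow (norm \<xi>) (r - 1))"
      using growth False unfolding codiff_growth_condition_def r_def by auto
    show ?thesis
      by (rule that[OF *(1,2)]) (use *(3) in eventually_elim, fast)
  qed
  have "\<exists>\<theta> c. \<theta> \<in> Lp_space (conj_exp p) \<Omega> \<and> (B = 0 \<longrightarrow> c = 0) \<and>
    (\<forall>x z1 z2. norm z1 \<le> B \<longrightarrow> norm z2 \<le> B \<longrightarrow>
      C * (rpow (norm (u x + z1)) (r - 1) + rpow (norm (g x + z2)) (r - 1)) \<le> \<theta> x + c)"
  proof (cases "r = 1")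
    case True
    then have "p = 1" using False unfolding r_def by (cases p) auto
    \<comment> \<open>For exponent 1 both \<open>rpow\<close> terms are 1. The constant
      \<open>2 * C\<close> is essentially bounded, so it can be part of \<open>\<theta>\<close>, and
      \<open>c = 0\<close>.\<close>
    then have "(\<lambda>x. 2 * C) \<in> Lp_space (conj_exp p) \<Omega>" by (auto simp: conj_exp_def Lp_space_top_iff)
    then show ?thesis using True by (intro exI[of _ "\<lambda>x. 2 * C"] exI[of _ 0]) (auto simp: rpow_def)
  next
    case r1: False
    define s where "s = r - 1"
    have s: "0 < s" using r r1 by (simp add: s_def)
    \<comment> \<open>This is the part of the estimate \<open>norm_add_powr_le\<close> that depends
      on the functions; the remaining constant carries the factor \<open>B powr s\<close>, which is
      0 for \<open>B = 0\<close>.\<close>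
    define \<theta> where "\<theta> x = (C * 2 powr s) *\<^sub>R (norm (u x) powr s + norm (g x) powr s)" for x
    have "1 < enn2real p" using s unfolding s_def r_def by linarith
    then have "\<theta> \<in> Lp_space (conj_exp p) \<Omega>"
      unfolding \<theta>_def s_def r_def
      by (intro Lp_space_scaleR Lp_space_add Lp_space_powr_conj_exp u g False)
    moreover
    have "C * (rpow (norm (u x + z1)) (r - 1) + rpow (norm (g x + z2)) (r - 1)) \<le> \<theta> x + 2 * (C * 2 powr s * B powr s)"
      if "norm z1 \<le> B" "norm z2 \<le> B" for x z1 z2
    proof -
      have "C * (norm (u x + z1) powr s + norm (g x + z2) powr s) \<le>
          C * (2 powr s * (norm (u x) powr s + B powr s) + 2 powr s * (norm (g x) powr s + B powr s))"
        using C that B s by (intro mult_left_mono add_mono norm_add_powr_le) auto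
      then show ?thesis using s by (simp add: rpow_def \<theta>_def algebra_simps flip: s_def)
    qed
    ultimately show ?thesis using s
      by (intro exI[of _ \<theta>] exI[of _ "2 * (C * 2 powr s * B powr s)"]) auto
  qed
  then obtain \<theta> c where \<theta>: "\<theta> \<in> Lp_space (conj_exp p) \<Omega>" "B = 0 \<Longrightarrow> c = 0"
    "\<And>x z1 z2. norm z1 \<le> B \<Longrightarrow> norm z2 \<le> B \<Longrightarrow>
      C * (rpow (norm (u x + z1)) (r - 1) + rpow (norm (g x + z2)) (r - 1)) \<le> \<theta> x + c" by blast
  show ?thesis
  proof (rule that[of "\<lambda>x. 2 *\<^sub>R (\<gamma> x + \<theta> x)" "2 * c"])
    show "(\<lambda>x. 2 *\<^sub>R (\<gamma> x + \<theta> x)) \<in> Lp_space (conj_exp p) \<Omega>" by (intro Lp_space_scaleR Lp_space_add \<gamma> \<theta>)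
    show "B = 0 \<Longrightarrow> 2 * c = 0" using \<theta>(2) by simp
    show "AE x in lebesgue_on \<Omega>. \<forall>z. norm z \<le> B \<longrightarrow>
      (\<forall>(a, v)\<in>dl x ((u x, g x) + z). norm v \<le> 2 *\<^sub>R (\<gamma> x + \<theta> x) + 2 * c) \<and>
      (\<forall>(b, w)\<in>du x ((u x, g x) + z). norm w \<le> 2 *\<^sub>R (\<gamma> x + \<theta> x) + 2 * c)"
      using b ne
    proof eventually_elim
      case (elim x)
      show ?case
      proof (intro allI impI)
        fix z :: "'u \<times> 'v" assume z: "norm z \<le> B"
        obtain z1 z2 where z12: "z = (z1, z2)" by fastforce
        have "norm z1 \<le> B" "norm z2 \<le> B"
          using z norm_fst_le[of z1 z2] norm_snd_le[of z2 z1] unfolding z12 by auto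
        from \<theta>(3)[OF this] have "\<gamma> x + C * (rpow (norm (u x + z1)) (r - 1) + rpow (norm (g x + z2)) (r - 1)) \<le> \<gamma> x + \<theta> x + c"
          by (simp add: add.assoc)
        note le = this
        have "(\<forall>(a, v)\<in>dl x (u x + z1, g x + z2). norm v \<le> 2 * (\<gamma> x + \<theta> x + c)) \<and>
            (\<forall>(b, w)\<in>du x (u x + z1, g x + z2). norm w \<le> 2 * (\<gamma> x + \<theta> x + c))"
        proof (rule norm_bounds_of_pairwise_Max)
          fix a v1 v2 b' w1 w2 assume "(a, v1, v2) \<in> dl x (u x + z1, g x + z2)" "(b', w1, w2) \<in> du x (u x + z1, g x + z2)"
          with elim(1) have "Max {norm v1, norm v2, norm w1, norm w2}
              \<le> \<gamma> x + C * (rpow (norm (u x + z1)) (r - 1) + rpow (norm (g x + z2)) (r - 1))" by fast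
          also note le
          finally show "Max {norm v1, norm v2, norm w1, norm w2} \<le> \<gamma> x + \<theta> x + c" .
        qed (use elim(2) in auto)
        moreover have "2 *\<^sub>R (\<gamma> x + \<theta> x) + 2 * c = 2 * (\<gamma> x + \<theta> x + c)" by simp
        ultimately show "(\<forall>(a, v)\<in>dl x ((u x, g x) + z). norm v \<le> 2 *\<^sub>R (\<gamma> x + \<theta> x) + 2 * c) \<and>
          (\<forall>(b, w)\<in>du x ((u x, g x) + z). norm w \<le> 2 *\<^sub>R (\<gamma> x + \<theta> x) + 2 * c)"
          unfolding z12 by simp
      qed
    qed
  qed
qed

lemma growth_condition_integrable:
  assumes growth: "growth_condition p \<Omega> f" and u: "u \<in> Lp_space p \<Omega>" and g: "g \<in> Lp_space p \<Omega>"
    and m: "(\<lambda>x. f x (u x, g x)) \<in> borel_measurable (lebesgue_on \<Omega>)"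
  shows "integrable (lebesgue_on \<Omega>) (\<lambda>x. f x (u x, g x))"
proof (cases "p = top")
  case True
  obtain Nu Ng where N: "AE x in lebesgue_on \<Omega>. norm (u x) \<le> Nu" "AE x in lebesgue_on \<Omega>. norm (g x) \<le> Ng"
    using u g True by (auto simp: Lp_space_top_iff)
  define N where "N = \<bar>Nu\<bar> + \<bar>Ng\<bar> + 1"
  have "0 < N" by (simp add: N_def)
  then obtain \<beta> where \<beta>: "\<beta> \<in> Lp_space 1 \<Omega>"
    "AE x in lebesgue_on \<Omega>. \<forall>u \<xi>. max (norm u) (norm \<xi>) \<le> N \<longrightarrow> \<bar>f x (u, \<xi>)\<bar> \<le> \<beta> x"
    using growth True unfolding growth_condition_def by auto
  show ?thesis
  proof (rule Bochner_Integration.integrable_bound[OF Lp_space_one_integrable[OF \<beta>(1)] m])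
    show "AE x in lebesgue_on \<Omega>. norm (f x (u x, g x)) \<le> norm (\<beta> x)"
      using N \<beta>(2)
    proof eventually_elim
      case (elim x)
      then have "max (norm (u x)) (norm (g x)) \<le> N" by (auto simp: N_def)
      then have "\<bar>f x (u x, g x)\<bar> \<le> \<beta> x" using elim(3) by blast
      then show ?case by simp
    qed
  qed
next
  case False
  obtain \<beta> C where \<beta>: "\<beta> \<in> Lp_space 1 \<Omega>"
    "AE x in lebesgue_on \<Omega>. \<forall>u \<xi>. \<bar>f x (u, \<xi>)\<bar> \<le> \<beta> x + C * (norm u powr enn2real p + norm \<xi> powr enn2real p)"
    using growth False unfolding growth_condition_def by auto
  show ?thesis
  proof (rule Bochner_Integration.integrable_bound[OF _ m])
    show "integrable (lebesgue_on \<Omega>) (\<lambda>x. \<beta> x + C * (norm (u x) powr enn2real p + norm (g x) powr enn2real p))"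
      using u g False Lp_space_one_integrable[OF \<beta>(1)] by (auto simp: Lp_space_finite_iff)
    show "AE x in lebesgue_on \<Omega>. norm (f x (u x, g x)) \<le> norm (\<beta> x + C * (norm (u x) powr enn2real p + norm (g x) powr enn2real p))"
      using \<beta>(2)
    proof eventually_elim
      case (elim x)
      then have "\<bar>f x (u x, g x)\<bar> \<le> \<beta> x + C * (norm (u x) powr enn2real p + norm (g x) powr enn2real p)" by blast
      then show ?case by simp
    qed
  qed
qed

section \<open>Necessary optimality conditions\<close>

lemma axis_bounded_linear: "bounded_linear (axis i :: 'a::euclidean_space \<Rightarrow> 'a^'n)"
  by (intro linear_conv_bounded_linear[THEN iffD1] linearI) (auto simp: vec_eq_iff axis_def)

lemma jacobian_axis:
  fixes \<phi> :: "real^'d \<Rightarrow> real"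
  assumes "smooth \<phi>"
  shows "jacobian (\<lambda>x. axis i (\<phi> x) :: real^'m) x = axis i (grad \<phi> x)"
  unfolding jacobian_def dir_deriv_bounded_linear[OF axis_bounded_linear assms]
  by (auto simp: vec_eq_iff axis_def grad_def)

lemma inner_axis_vec: "v \<bullet> (axis i a :: 'a::euclidean_space^'n) = v $ i \<bullet> a"
proof -
  have "v \<bullet> (axis i a :: 'a^'n) = (\<Sum>j\<in>UNIV. if j = i then v $ i \<bullet> a else 0)"
    unfolding inner_vec_def by (intro sum.cong) (auto simp: axis_def)
  then show ?thesis by simp
qed

text \<open>Test functions concentrated in one component, \<open>axis i (\<phi> x)\<close>, isolate
  the i-th row of the divergence identity. Domination by \<open>\<rho>\<close> puts the field and
  its divergence into the same Lebesgue space.\<close>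

lemma annihilator_in_Lp_div_space:
  fixes v :: "real^'d \<Rightarrow> (real^'m) \<times> (real^'d^'m)"
  assumes \<Omega>: "open \<Omega>" and q: "1 \<le> q" and \<rho>: "\<rho> \<in> Lp_space q \<Omega>"
    and v: "v \<in> borel_measurable (lebesgue_on \<Omega>)" "AE x in lebesgue_on \<Omega>. norm (v x) \<le> norm (\<rho> x :: real)"
    and zero: "\<And>h. h \<in> test_functions \<Omega> \<Longrightarrow> (LINT x|lebesgue_on \<Omega>. v x \<bullet> (h x, jacobian h x)) = 0"
  shows "(\<lambda>x. snd (v x)) \<in> Lp_div_space q \<Omega>"
    and "AE x in lebesgue_on \<Omega>. weak_div \<Omega> (\<lambda>x. snd (v x)) x = fst (v x)"
proof -
  have vq: "v \<in> Lp_space q \<Omega>" by (rule Lp_space_dominated[OF \<rho> v])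
  have loc: "locally_integrable \<Omega> v" by (rule Lp_space_locally_integrable[OF \<Omega> vq q])
  have mf: "(\<lambda>x. fst (v x)) \<in> borel_measurable (lebesgue_on \<Omega>)" and ms: "(\<lambda>x. snd (v x)) \<in> borel_measurable (lebesgue_on \<Omega>)"
    by (rule measurable_compose[OF v(1)], intro borel_measurable_continuous_onI continuous_intros)+
  have nle: "norm (fst p) \<le> norm p" "norm (snd p) \<le> norm p" for p :: "(real^'m) \<times> (real^'d^'m)"
    using norm_fst_le[of "fst p" "snd p"] norm_snd_le[of "snd p" "fst p"] by simp_all
  have fq: "(\<lambda>x. fst (v x)) \<in> Lp_space q \<Omega>"
    by (rule Lp_space_dominated[OF vq mf]) (simp add: nle)
  have sq: "(\<lambda>x. snd (v x)) \<in> Lp_space q \<Omega>"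
    by (rule Lp_space_dominated[OF vq ms]) (simp add: nle)
  have div: "has_row_weak_div \<Omega> (\<lambda>x. snd (v x)) (\<lambda>x. fst (v x))"
    unfolding has_row_weak_div_def has_weak_div_def
  proof (intro allI conjI ballI)
    fix i
    show l1: "locally_integrable \<Omega> (\<lambda>x. snd (v x) $ i)" and l2: "locally_integrable \<Omega> (\<lambda>x. fst (v x) $ i)"
      using locally_integrable_bounded_linear[OF bounded_linear_compose[OF bounded_linear_vec_nth bounded_linear_snd] loc]
        locally_integrable_bounded_linear[OF bounded_linear_compose[OF bounded_linear_vec_nth bounded_linear_fst] loc]
      by auto
    fix \<phi> :: "real^'d \<Rightarrow> real" assume \<phi>: "\<phi> \<in> test_functions \<Omega>"
    then have sm: "smooth \<phi>" by (simp add: test_functions_def)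
    have h: "(\<lambda>x. axis i (\<phi> x) :: real^'m) \<in> test_functions \<Omega>"
      by (rule test_functions_bounded_linear[OF axis_bounded_linear \<phi>])
    have z: "(LINT x|lebesgue_on \<Omega>. fst (v x) $ i * \<phi> x + snd (v x) $ i \<bullet> grad \<phi> x) = 0"
      using zero[OF h] by (simp add: jacobian_axis[OF sm] inner_prod_def inner_axis_vec)
    have i1: "integrable (lebesgue_on \<Omega>) (\<lambda>x. fst (v x) $ i * \<phi> x)" by (rule integrable_mult_test[OF \<Omega> l2 \<phi>])
    have "integrable (lebesgue_on \<Omega>) (\<lambda>x. \<Sum>j\<in>UNIV. snd (v x) $ i $ j * grad \<phi> x $ j)"
    proof (rule Bochner_Integration.integrable_sum)
      fix j
      have "(\<lambda>x. grad \<phi> x $ j) \<in> test_functions \<Omega>"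
        using test_functions_dir_deriv[OF \<phi>, of "axis j 1"] by (simp add: grad_def axis_in_Basis_iff)
      then show "integrable (lebesgue_on \<Omega>) (\<lambda>x. snd (v x) $ i $ j * grad \<phi> x $ j)"
        by (rule integrable_mult_test[OF \<Omega> locally_integrable_bounded_linear[OF bounded_linear_vec_nth l1]])
    qed
    then have i2: "integrable (lebesgue_on \<Omega>) (\<lambda>x. snd (v x) $ i \<bullet> grad \<phi> x)" by (simp add: inner_vec_def)
    show "(LINT x|lebesgue_on \<Omega>. fst (v x) $ i * \<phi> x) = - (LINT x|lebesgue_on \<Omega>. snd (v x) $ i \<bullet> grad \<phi> x)"
      using z i1 i2 by simp
  qed
  show eq: "AE x in lebesgue_on \<Omega>. weak_div \<Omega> (\<lambda>x. snd (v x)) x = fst (v x)"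
    by (rule weak_div_AE_eq[OF \<Omega> div])
  have "complete_measure (lebesgue_on \<Omega>)" using \<Omega> by (intro complete_measure_lebesgue_on) auto
  moreover have "AE x in lebesgue_on \<Omega>. fst (v x) = weak_div \<Omega> (\<lambda>x. snd (v x)) x"
    using eq by eventually_elim simp
  ultimately have "weak_div \<Omega> (\<lambda>x. snd (v x)) \<in> borel_measurable (lebesgue_on \<Omega>)"
    using complete_measure.borel_measurable_AE_eq mf by blast
  then have "weak_div \<Omega> (\<lambda>x. snd (v x)) \<in> Lp_space q \<Omega>"
    by (rule Lp_space_dominated[OF fq]) (use eq in eventually_elim, simp)
  then show "(\<lambda>x. snd (v x)) \<in> Lp_div_space q \<Omega>" using sq div by (auto simp: Lp_div_space_def)
qed

lemma function_space_jets:
  fixes \<Omega> :: "(real^'d) set"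
  shows "function_space ((\<lambda>h x. (h x, jacobian h x)) ` (test_functions \<Omega> :: (real^'d \<Rightarrow> real^'m) set))"
  unfolding function_space_def
proof (intro conjI ballI allI)
  let ?J = "\<lambda>h x. (h x, jacobian h x) :: (real^'m) \<times> (real^'d^'m)"
  have 0: "(\<lambda>x. 0) \<in> test_functions \<Omega>" by (rule test_functionsI[of _ "{}"]) (auto simp: smooth_const)
  have sm: "smooth h" if "h \<in> test_functions \<Omega>" for h :: "real^'d \<Rightarrow> real^'m"
    using that by (simp add: test_functions_def)
  have "?J (\<lambda>x. 0) = (\<lambda>x. 0)"
    using jacobian_scaleR[OF sm[OF 0], of 0] by (auto simp: fun_eq_iff zero_prod_def)
  then show "(\<lambda>x. 0) \<in> ?J ` test_functions \<Omega>" by (intro image_eqI[where x = "\<lambda>x. 0"] 0) simp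
  fix f assume "f \<in> ?J ` test_functions \<Omega>"
  then obtain g where g: "g \<in> test_functions \<Omega>" "f = ?J g" by blast
  fix c :: real
  show "(\<lambda>x. c *\<^sub>R f x) \<in> ?J ` test_functions \<Omega>"
    by (rule image_eqI[of _ _ "\<lambda>x. c *\<^sub>R g x"])
       (auto simp: g jacobian_scaleR sm intro: test_functions_scaleR)
  fix f' assume "f' \<in> ?J ` test_functions \<Omega>"
  then obtain h where h: "h \<in> test_functions \<Omega>" "f' = ?J h" by blast
  show "(\<lambda>x. f x + f' x) \<in> ?J ` test_functions \<Omega>"
    by (rule image_eqI[of _ _ "\<lambda>x. g x + h x"])
       (auto simp: g h jacobian_add sm intro: test_functions_add)
qed

lemma jet_properties:
  fixes h :: "real^'d \<Rightarrow> real^'m"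
  assumes h: "h \<in> test_functions \<Omega>"
  obtains B K where "0 \<le> B" "compact K" "K \<subseteq> \<Omega>" "\<And>x. norm (h x, jacobian h x) \<le> B"
    "\<And>x. x \<notin> K \<Longrightarrow> (h x, jacobian h x) = 0" "\<And>S. (\<lambda>x. (h x, jacobian h x)) \<in> borel_measurable (lebesgue_on S)"
proof -
  note j = jacobian_test_function[OF h]
  obtain B1 where B1: "0 < B1" "\<And>x. norm (h x) \<le> B1" using test_functions_norm_bound[OF h] by blast
  obtain B2 where B2: "0 < B2" "\<And>x. norm (jacobian h x) \<le> B2" using test_functions_norm_bound[OF j] by blast
  obtain K1 where K1: "compact K1" "K1 \<subseteq> \<Omega>" "\<forall>x. x \<notin> K1 \<longrightarrow> h x = 0" using h unfolding test_functions_iff by blast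
  obtain K2 where K2: "compact K2" "K2 \<subseteq> \<Omega>" "\<forall>x. x \<notin> K2 \<longrightarrow> jacobian h x = 0" using j unfolding test_functions_iff by blast
  show ?thesis
  proof (rule that[of "B1 + B2" "K1 \<union> K2"])
    show "norm (h x, jacobian h x) \<le> B1 + B2" for x
      using norm_Pair_le[of "h x" "jacobian h x"] B1(2)[of x] B2(2)[of x] by linarith
    show "(\<lambda>x. (h x, jacobian h x)) \<in> borel_measurable (lebesgue_on S)" for S
      using test_functions_measurable_on[OF h] test_functions_measurable_on[OF j] by (intro borel_measurable_Pair)
  qed (use B1 B2 K1 K2 in \<open>auto simp: zero_prod_def\<close>)
qed

lemma support_fun_translation:
  assumes "compact S" "S \<noteq> {}" shows "support_fun ((\<lambda>v. v + w) ` S) y = support_fun S y + w \<bullet> y"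
proof (rule antisym)
  show "support_fun ((\<lambda>v. v + w) ` S) y \<le> support_fun S y + w \<bullet> y"
    using assms by (intro support_fun_le) (auto simp: inner_add_left support_fun_ge)
  have c: "compact ((\<lambda>v. v + w) ` S)" using assms by (intro compact_continuous_image continuous_intros)
  obtain v where v: "v \<in> S" "support_fun S y = v \<bullet> y" using support_fun_attained[OF assms] .
  show "support_fun S y + w \<bullet> y \<le> support_fun ((\<lambda>v. v + w) ` S) y"
    using support_fun_ge[OF c imageI[OF v(1)], of y] v(2) by (simp add: inner_add_left)
qed

text \<open>The functional refers to the chosen weak gradient of the perturbed function, which
  agrees with the sum of the gradients only almost everywhere; equality of the integrals therefore
  also needs measurability of both integrands.\<close>

lemma functional_perturbation:
  fixes u h :: "real^'d \<Rightarrow> real^'m"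
  assumes \<Omega>: "open \<Omega>" and u: "has_weak_grad \<Omega> u (weak_grad \<Omega> u)" and h: "h \<in> test_functions \<Omega>"
    and f: "\<And>y. (\<lambda>x. f x y) \<in> borel_measurable (lebesgue_on \<Omega>)" "AE x in lebesgue_on \<Omega>. continuous_on UNIV (f x)"
    and m: "u \<in> borel_measurable (lebesgue_on \<Omega>)" "weak_grad \<Omega> u \<in> borel_measurable (lebesgue_on \<Omega>)"
  shows "functional \<Omega> f (\<lambda>x. u x + t *\<^sub>R h x)
    = (LINT x|lebesgue_on \<Omega>. f x ((u x, weak_grad \<Omega> u x) + t *\<^sub>R (h x, jacobian h x)))"
proof -
  have cm: "complete_measure (lebesgue_on \<Omega>)" using \<Omega> by (intro complete_measure_lebesgue_on) auto
  have "has_weak_grad \<Omega> (\<lambda>x. u x + t *\<^sub>R h x) (\<lambda>x. weak_grad \<Omega> u x + t *\<^sub>R jacobian h x)"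
    by (intro has_weak_grad_add[OF \<Omega>] u has_weak_grad_scaleR has_weak_grad_test_function[OF \<Omega> h])
  from weak_grad_AE_eq[OF \<Omega> this]
  have eq: "AE x in lebesgue_on \<Omega>. f x ((u x, weak_grad \<Omega> u x) + t *\<^sub>R (h x, jacobian h x))
      = f x (u x + t *\<^sub>R h x, weak_grad \<Omega> (\<lambda>x. u x + t *\<^sub>R h x) x)"
    by eventually_elim simp
  have "(\<lambda>x. (h x, jacobian h x)) \<in> borel_measurable (lebesgue_on \<Omega>)" by (rule jet_properties[OF h])
  then have "(\<lambda>x. (u x, weak_grad \<Omega> u x) + t *\<^sub>R (h x, jacobian h x)) \<in> borel_measurable (lebesgue_on \<Omega>)"
    using m by measurable
  from complete_measure.caratheodory_superposition[OF cm f this]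
  have m1: "(\<lambda>x. f x ((u x, weak_grad \<Omega> u x) + t *\<^sub>R (h x, jacobian h x))) \<in> borel_measurable (lebesgue_on \<Omega>)" .
  show ?thesis
    unfolding functional_def
    using eq complete_measure.borel_measurable_AE_eq[OF cm m1 eq] m1 by (intro integral_cong_AE) (auto elim: eventually_mono)
qed

lemma Lp_space_sum:
  fixes g :: "'i \<Rightarrow> 'a::euclidean_space \<Rightarrow> 'b::euclidean_space"
  assumes "\<And>i. i \<in> I \<Longrightarrow> g i \<in> Lp_space p \<Omega>" shows "(\<lambda>x. \<Sum>i\<in>I. g i x) \<in> Lp_space p \<Omega>"
proof -
  have "(\<lambda>x. 0 :: 'b) \<in> Lp_space p \<Omega>"
    by (cases "p = top") (auto simp: Lp_space_top_iff Lp_space_finite_iff)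
  then show ?thesis
    using assms by (induction I rule: infinite_finite_induct) (auto intro: Lp_space_add)
qed

lemma sum_Pair_zero: "(\<Sum>i\<in>I. a i *\<^sub>R (0 :: 'b::real_vector, c i)) = (0, \<Sum>i\<in>I. a i *\<^sub>R c i)"
  by (induction I rule: infinite_finite_induct) (auto simp: zero_prod_def)

lemma sum_in_set_sum:
  assumes "finite I" "\<And>i. i \<in> I \<Longrightarrow> e i \<in> D i" shows "(\<Sum>i\<in>I. e i) \<in> (\<Sum>i\<in>I. D i)"
  using assms by (auto simp: set_sum_alt)

theorem theorem3p6:
  fixes \<Omega> :: "(real^'d) set"
    and p :: ennreal
    and l :: nat
    and f :: "nat \<Rightarrow> real^'d \<Rightarrow> (real^'m) \<times> (real^'d^'m) \<Rightarrow> real"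
    and dl du :: "nat \<Rightarrow> real^'d \<Rightarrow> (real^'m) \<times> (real^'d^'m) \<Rightarrow>
                   (real \<times> (real^'m) \<times> (real^'d^'m)) set"
    and u0 us :: "real^'d \<Rightarrow> real^'m"
    and w1 :: "nat \<Rightarrow> real^'d \<Rightarrow> real^'m"
    and w2 :: "nat \<Rightarrow> real^'d \<Rightarrow> real^'d^'m"
  assumes "open \<Omega>"
    and "1 \<le> p"
    and "\<And>i. i \<in> {0..l} \<Longrightarrow> codiff_conditions p \<Omega> (f i) (dl i) (du i)"
    and "1 < p \<or> (bounded \<Omega> \<and> segment_property \<Omega>)"
    and "u0 \<in> sobolev p \<Omega>"
    and "locally_optimal p \<Omega> f l u0 us"
    and "\<And>i. i \<in> {1..l} \<Longrightarrow>
           measurable_selection \<Omega> (\<lambda>x. du i x (us x, weak_grad \<Omega> us x)) (\<lambda>x. (0, w1 i x, w2 i x))"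
    and "\<not> (\<exists>\<zeta>\<in>Lp_div_space (conj_exp p) \<Omega>. AE x in lebesgue_on \<Omega>.
           (0, weak_div \<Omega> \<zeta> x, \<zeta> x) \<in>
             convex hull (\<Union>i\<in>{i\<in>{1..l}. functional \<Omega> (f i) us = 0}.
               dl i x (us x, weak_grad \<Omega> us x) + {(0, w1 i x, w2 i x)}))"
  shows "\<forall>w10 w20.
           measurable_selection \<Omega> (\<lambda>x. du 0 x (us x, weak_grad \<Omega> us x)) (\<lambda>x. (0, w10 x, w20 x)) \<longrightarrow>
           (\<exists>lam. \<exists>\<zeta>\<in>Lp_div_space (conj_exp p) \<Omega>.
              (\<forall>i\<in>{1..l}. lam i \<ge> 0 \<and> lam i * functional \<Omega> (f i) us = 0) \<and>
              (AE x in lebesgue_on \<Omega>.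
                 (0, weak_div \<Omega> \<zeta> x, \<zeta> x) \<in>
                   (dl 0 x (us x, weak_grad \<Omega> us x) + {(0, w10 x, w20 x)})
                   + (\<Sum>i\<in>{1..l}. (*\<^sub>R) (lam i) `
                        (dl i x (us x, weak_grad \<Omega> us x) + {(0, w1 i x, w2 i x)}))))"
proof (intro allI impI)
  fix w10 w20
  assume sel0: "measurable_selection \<Omega> (\<lambda>x. du 0 x (us x, weak_grad \<Omega> us x)) (\<lambda>x. (0, w10 x, w20 x))"

  \<comment> \<open>The solution, its jet and the selections\<close>
  let ?M = "lebesgue_on \<Omega>" and ?q = "conj_exp p"
  note \<Omega> = assms(1) and p = assms(2)
  have \<Omega>': "\<Omega> \<in> sets lebesgue" using \<Omega> by auto
  interpret C: complete_measure ?M using \<Omega>' by (rule complete_measure_lebesgue_on)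
  interpret F: sigma_finite_measure ?M using \<Omega>' by (rule sigma_finite_measure_lebesgue_on)
  have q: "1 \<le> ?q" using p by (rule conj_exp_ge_1)
  have feas: "us \<in> feasible p \<Omega> f l u0" using assms(6) by (simp add: locally_optimal_def)
  obtain r where r: "0 < r" "\<And>u. u \<in> feasible p \<Omega> f l u0 \<Longrightarrow> sobolev_norm p \<Omega> (\<lambda>x. u x - us x) < r \<Longrightarrow>
      functional \<Omega> (f 0) us \<le> functional \<Omega> (f 0) u"
    using assms(6) by (auto simp: locally_optimal_def)
  have d0: "(\<lambda>x. us x - u0 x) \<in> sobolev0 p \<Omega>" and le0: "\<And>i. i \<in> {1..l} \<Longrightarrow> functional \<Omega> (f i) us \<le> 0"
    using feas by (auto simp: feasible_def)
  have "us \<in> sobolev p \<Omega>"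
    using sobolev_add[OF \<Omega> _ assms(5), of "\<lambda>x. us x - u0 x"] d0 by (simp add: sobolev0_def)
  note us = sobolevD[OF this]
  note us_m = Lp_space_measurable[OF us(1)] Lp_space_measurable[OF us(3)]
  define y where "y x = (us x, weak_grad \<Omega> us x)" for x
  have my: "y \<in> borel_measurable ?M" unfolding y_def using us_m by (intro borel_measurable_Pair)
  \<comment> \<open>The objective joins the constraints as index 0 of a single family.\<close>
  define W where "W i x = (if i = 0 then (w10 x, w20 x) else (w1 i x, w2 i x))" for i x
  have sel: "measurable_selection \<Omega> (\<lambda>x. du i x (y x)) (\<lambda>x. (0, W i x))" if "i \<in> {0..l}" for i
    using sel0 assms(7)[of i] that by (cases "i = 0") (auto simp: W_def y_def)
  have mW: "W i \<in> borel_measurable ?M" if "i \<in> {0..l}" for i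
  proof -
    have "(\<lambda>x. (0 :: real, W i x)) \<in> borel_measurable ?M" using sel[OF that] by (simp add: measurable_selection_def)
    from measurable_compose[OF this borel_measurable_continuous_onI[OF continuous_on_snd[OF continuous_on_id]]]
    show ?thesis by simp
  qed
  have W: "AE x in ?M. (0, W i x) \<in> du i x (y x)" if "i \<in> {0..l}" for i
    using sel[OF that] by (simp add: measurable_selection_def)
  have mf: "\<And>z. (\<lambda>x. f i x z) \<in> borel_measurable ?M" and cf: "AE x in ?M. continuous_on UNIV (f i x)"
    and cod: "AE x in ?M. \<forall>z. is_codifferential (f i x) z (dl i x z) (du i x z)"
    and mdl: "\<And>z V. open V \<Longrightarrow> {x\<in>space ?M. dl i x z \<inter> V \<noteq> {}} \<in> sets ?M"
    and hdl: "AE x in ?M. \<forall>z. ((\<lambda>z'. hausdorff_dist (dl i x z') (dl i x z)) \<longlongrightarrow> 0) (at z)"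
    and growth: "growth_condition p \<Omega> (f i)" and cgrowth: "codiff_growth_condition p \<Omega> (dl i) (du i)"
    if "i \<in> {0..l}" for i
    using assms(3)[OF that]
    by (auto simp: codiff_conditions_def caratheodory_def caratheodory_multi_def measurable_multi_def)
  have hypo: "AE x in ?M. \<forall>z. compact (dl i x z) \<and> convex (dl i x z) \<and> dl i x z \<noteq> {} \<and> hypo_max (dl i x z) 0 = 0"
    if "i \<in> {0..l}" for i
    using cod[OF that] by eventually_elim (blast dest: is_codifferential_lower)
  have ne: "AE x in ?M. \<forall>z. dl i x z \<noteq> {} \<and> du i x z \<noteq> {}" if "i \<in> {0..l}" for i
    using cod[OF that] by eventually_elim (auto simp: is_codifferential_def)
  have f_int: "integrable ?M (\<lambda>x. f i x (y x))" if "i \<in> {0..l}" for i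
  proof -
    have "(\<lambda>x. f i x (y x)) \<in> borel_measurable ?M"
      by (rule C.caratheodory_superposition[where g = "f i", OF mf[OF that] cf[OF that] my])
    then show ?thesis unfolding y_def by (rule growth_condition_integrable[OF growth[OF that] us(1,3)])
  qed
  have fun_us: "functional \<Omega> (f i) us = (LINT x|?M. f i x (y x))" for i by (simp add: functional_def y_def)

  \<comment> \<open>A common bound for the codifferentials along the solution\<close>
  have "\<exists>R. R \<in> Lp_space ?q \<Omega> \<and> (AE x in ?M. (\<forall>(a, v)\<in>dl i x (y x). norm v \<le> R x) \<and> (\<forall>(b, w)\<in>du i x (y x). norm w \<le> R x))"
    if i: "i \<in> {0..l}" for i
  proof -
    \<comment> \<open>The growth bound is taken with radius 0, where the additive constant
      disappears.\<close>
    obtain R c where R: "R \<in> Lp_space ?q \<Omega>" "(0::real) = 0 \<Longrightarrow> c = 0"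
      "AE x in ?M. \<forall>z. norm z \<le> 0 \<longrightarrow> (\<forall>(a, v)\<in>dl i x ((us x, weak_grad \<Omega> us x) + z). norm v \<le> R x + c) \<and>
         (\<forall>(b, w)\<in>du i x ((us x, weak_grad \<Omega> us x) + z). norm w \<le> R x + c)"
      using codiff_growth_bound[OF p cgrowth[OF i] us(1,3) order.refl ne[OF i]] by blast
    have "AE x in ?M. (\<forall>(a, v)\<in>dl i x (y x). norm v \<le> R x) \<and> (\<forall>(b, w)\<in>du i x (y x). norm w \<le> R x)"
      using R(3)
    proof eventually_elim
      case (elim x)
      from elim[rule_format, of 0] R(2) show ?case by (simp add: y_def)
    qed
    with R(1) show ?thesis by blast
  qed
  then have "\<forall>i\<in>{0..l}. \<exists>R. R \<in> Lp_space ?q \<Omega> \<and> (AE x in ?M. (\<forall>(a, v)\<in>dl i x (y x). norm v \<le> R x) \<and> (\<forall>(b, w)\<in>du i x (y x). norm w \<le> R x))"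
    by blast
  from bchoice[OF this] obtain R where R: "\<And>i. i \<in> {0..l} \<Longrightarrow> R i \<in> Lp_space ?q \<Omega>"
    "\<And>i. i \<in> {0..l} \<Longrightarrow> AE x in ?M. (\<forall>(a, v)\<in>dl i x (y x). norm v \<le> R i x) \<and> (\<forall>(b, w)\<in>du i x (y x). norm w \<le> R i x)"
    by blast
  \<comment> \<open>The factor 2 pays for an element of the slice and for \<open>W i x\<close>; the
    sum over all indices is a bound common to the whole family.\<close>
  define \<rho> where "\<rho> x = (\<Sum>i\<in>{0..l}. 2 * \<bar>R i x\<bar>)" for x
  have \<rho>_nn: "0 \<le> \<rho> x" for x unfolding \<rho>_def by (intro sum_nonneg) auto
  have \<rho>_Lp: "\<rho> \<in> Lp_space ?q \<Omega>"
    unfolding \<rho>_def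
  proof (rule Lp_space_sum)
    fix i assume i: "i \<in> {0..l}"
    note Ri = Lp_space_scaleR[OF R(1)[OF i], of 2]
    have "(\<lambda>x. 2 * \<bar>R i x\<bar>) \<in> borel_measurable ?M" using Lp_space_measurable[OF R(1)[OF i]] by measurable
    then show "(\<lambda>x. 2 * \<bar>R i x\<bar>) \<in> Lp_space ?q \<Omega>" by (rule Lp_space_dominated[OF Ri]) auto
  qed
  note \<rho>_m = Lp_space_measurable[OF \<rho>_Lp]

  \<comment> \<open>The convex sets of quasidifferential elements\<close>
  define good where "good i x \<longleftrightarrow> is_codifferential (f i x) (y x) (dl i x (y x)) (du i x (y x)) \<and>
    (\<forall>v\<in>zero_slice (dl i x (y x)). norm (v + W i x) \<le> \<rho> x)" for i x
  have good: "AE x in ?M. good i x" if i: "i \<in> {0..l}" for i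
    using cod[OF i] R(2)[OF i] W[OF i]
  proof eventually_elim
    case (elim x)
    have "norm (v + W i x) \<le> \<rho> x" if "v \<in> zero_slice (dl i x (y x))" for v
    proof -
      have "norm v \<le> R i x" "norm (W i x) \<le> R i x" using elim(2,3) that by (auto simp: zero_slice_def)
      then have "norm (v + W i x) \<le> 2 * \<bar>R i x\<bar>" using norm_triangle_ineq[of v "W i x"] by linarith
      also have "\<dots> \<le> \<rho> x" unfolding \<rho>_def using i by (intro member_le_sum) auto
      finally show ?thesis .
    qed
    then show ?case using elim(1) unfolding good_def by blast
  qed
  \<comment> \<open>The abstract multiplier rule asks for compact convex nonempty sets at every
    point, so the exceptional null set receives the placeholder \<open>{0}\<close>.\<close>
  define S where "S i x = (if good i x then (\<lambda>v. v + W i x) ` zero_slice (dl i x (y x)) else {0})" for i x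
  have slice: "compact (zero_slice (dl i x (y x)))" "convex (zero_slice (dl i x (y x)))" "zero_slice (dl i x (y x)) \<noteq> {}"
    if "good i x" for i x
  proof -
    have "is_codifferential (f i x) (y x) (dl i x (y x)) (du i x (y x))" using that unfolding good_def by blast
    note lower = is_codifferential_lower[OF this]
    show "compact (zero_slice (dl i x (y x)))" by (rule zero_slice_compact[OF lower])
    show "convex (zero_slice (dl i x (y x)))" by (rule zero_slice_convex[OF lower])
    show "zero_slice (dl i x (y x)) \<noteq> {}" by (rule zero_slice_nonempty[OF lower])
  qed
  have S: "compact (S i x)" "convex (S i x)" "S i x \<noteq> {}" for i x
  proof -
    have "compact ((\<lambda>v. v + W i x) ` zero_slice (dl i x (y x)))" "convex ((\<lambda>v. v + W i x) ` zero_slice (dl i x (y x)))"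
      if "good i x"
      using slice[OF that] convex_translation[of "zero_slice (dl i x (y x))" "W i x"]
      by (auto simp: add.commute[of _ "W i x"] intro!: compact_continuous_image continuous_intros)
    then show "compact (S i x)" "convex (S i x)" by (auto simp: S_def)
    show "S i x \<noteq> {}" using slice(3) by (auto simp: S_def)
  qed
  have S_bound: "norm v \<le> \<rho> x" if "v \<in> S i x" for i x v
    using that \<rho>_nn by (auto simp: S_def good_def split: if_splits)
  have S_mem: "(0, c) \<in> dl i x (y x) + {(0, W i x)}" if "c \<in> S i x" "good i x" for i x c
    using that by (force simp: S_def zero_slice_def set_plus_def)
  have S_supp: "AE x in ?M. support_fun (S i x) (h x) = support_fun (zero_slice (dl i x (y x))) (h x) + W i x \<bullet> h x"
    if "i \<in> {0..l}" for i and h :: "real^'d \<Rightarrow> (real^'m) \<times> (real^'d^'m)"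
    using good[OF that] by eventually_elim (simp add: S_def support_fun_translation slice)
  have m_slice: "(\<lambda>x. support_fun (zero_slice (dl i x (y x))) (h x) + W i x \<bullet> h x) \<in> borel_measurable ?M"
    if i: "i \<in> {0..l}" and h: "h \<in> borel_measurable ?M" for i h
    by (intro borel_measurable_add borel_measurable_inner mW i h
        C.borel_measurable_support_fun_zero_slice[OF mdl[OF i] hypo[OF i] hdl[OF i] my h])
  have S_meas: "(\<lambda>x. support_fun (S i x) (h x)) \<in> borel_measurable ?M"
    if i: "i \<in> {0..l}" and h: "h \<in> borel_measurable ?M" for i h
    by (rule C.borel_measurable_AE_eq[OF m_slice[OF i h]]) (use S_supp[OF i, of h] in eventually_elim, simp)

  \<comment> \<open>Active indices and the space of jets\<close>
  define act where "act = {i\<in>{1..l}. functional \<Omega> (f i) us = 0}"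
  define A where "A = insert 0 act"
  have A: "finite A" "A \<noteq> {}" "A \<subseteq> {0..l}" "0 \<notin> act" "finite act" by (auto simp: A_def act_def)
  define L where "L = (\<lambda>h x. (h x, jacobian h x) :: (real^'m) \<times> (real^'d^'m)) ` test_functions \<Omega>"
  have L: "function_space L" unfolding L_def by (rule function_space_jets)
  have jet_int: "integrable ?M (\<lambda>x. (\<theta> x + c) * norm (h x, jacobian h x))"
    if h: "h \<in> test_functions \<Omega>" and \<theta>: "locally_integrable \<Omega> \<theta>" for \<theta> c and h :: "real^'d \<Rightarrow> real^'m"
  proof -
    obtain B K where "compact K" "K \<subseteq> \<Omega>" "\<And>x. norm (h x, jacobian h x) \<le> B" "\<And>x. x \<notin> K \<Longrightarrow> (h x, jacobian h x) = 0"
      "(\<lambda>x. (h x, jacobian h x)) \<in> borel_measurable ?M" using jet_properties[OF h] by metis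
    then show ?thesis by (intro integrable_locally_integrable_mult_norm_test[OF \<Omega> \<theta>])
  qed
  have L_sub: "L \<subseteq> weighted_L1 ?M \<rho>"
  proof
    fix \<eta> assume "\<eta> \<in> L"
    then obtain h where h: "h \<in> test_functions \<Omega>" "\<eta> = (\<lambda>x. (h x, jacobian h x))" by (auto simp: L_def)
    have "(\<lambda>x. (h x, jacobian h x)) \<in> borel_measurable ?M" using jet_properties[OF h(1)] by metis
    moreover have "integrable ?M (\<lambda>x. (\<rho> x + 0) * norm (h x, jacobian h x))"
      by (rule jet_int[OF h(1) Lp_space_locally_integrable[OF \<Omega> \<rho>_Lp q]])
    ultimately show "\<eta> \<in> weighted_L1 ?M \<rho>" by (simp add: weighted_L1_def h(2))
  qed

  \<comment> \<open>Optimality excludes a common direction of decrease\<close>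
  have no: "\<exists>i\<in>A. 0 \<le> (LINT x|?M. support_fun (S i x) (\<eta> x))" if "\<eta> \<in> L" for \<eta>
  proof (rule ccontr)
    assume "\<not> (\<exists>i\<in>A. 0 \<le> (LINT x|?M. support_fun (S i x) (\<eta> x)))"
    then have neg: "(LINT x|?M. support_fun (S i x) (\<eta> x)) < 0" if "i \<in> A" for i using that by (auto simp: not_le)
    obtain h where h: "h \<in> test_functions \<Omega>" and \<eta>: "\<eta> = (\<lambda>x. (h x, jacobian h x))" using \<open>\<eta> \<in> L\<close> by (auto simp: L_def)
    obtain B where B: "0 \<le> B" "\<And>x. norm (\<eta> x) \<le> B" using jet_properties[OF h] unfolding \<eta> by metis
    have m\<eta>: "\<eta> \<in> borel_measurable ?M" using jet_properties[OF h] unfolding \<eta> by metis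
    let ?t = "\<lambda>n. inverse (real (Suc n))"
    let ?u = "\<lambda>n x. us x + ?t n *\<^sub>R h x"
    have fun_u: "functional \<Omega> (f i) (?u n) = (LINT x|?M. f i x (y x + \<eta> x /\<^sub>R real (Suc n)))" if "i \<in> {0..l}" for i n
      using functional_perturbation[where f = "f i", OF \<Omega> us(2) h mf[OF that] cf[OF that] us_m, of "?t n"]
      by (simp add: y_def \<eta>)
    have "\<exists>Q. integrable ?M (\<lambda>x. Q x * norm (\<eta> x)) \<and> (AE x in ?M. \<forall>z. norm z \<le> norm (\<eta> x) \<longrightarrow>
        (\<forall>(a, v)\<in>dl i x (y x + z). norm v \<le> Q x) \<and> (\<forall>(b, w)\<in>du i x (y x + z). norm w \<le> Q x))" if i: "i \<in> {0..l}" for i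
    proof -
      \<comment> \<open>The perturbed jets stay within distance \<open>B\<close> of the jet of the
        solution. The constant \<open>c\<close> is harmless because \<open>\<eta>\<close> has
        compact support.\<close>
      obtain \<theta> c where \<theta>: "\<theta> \<in> Lp_space ?q \<Omega>"
        "AE x in ?M. \<forall>z. norm z \<le> B \<longrightarrow> (\<forall>(a, v)\<in>dl i x ((us x, weak_grad \<Omega> us x) + z). norm v \<le> \<theta> x + c) \<and>
           (\<forall>(b, w)\<in>du i x ((us x, weak_grad \<Omega> us x) + z). norm w \<le> \<theta> x + c)"
        using codiff_growth_bound[OF p cgrowth[OF i] us(1,3) B(1) ne[OF i]] by blast
      show ?thesis
      proof (intro exI[of _ "\<lambda>x. \<theta> x + c"] conjI)
        show "integrable ?M (\<lambda>x. (\<theta> x + c) * norm (\<eta> x))"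
          unfolding \<eta> by (rule jet_int[OF h Lp_space_locally_integrable[OF \<Omega> \<theta>(1) q]])
        show "AE x in ?M. \<forall>z. norm z \<le> norm (\<eta> x) \<longrightarrow>
            (\<forall>(a, v)\<in>dl i x (y x + z). norm v \<le> \<theta> x + c) \<and> (\<forall>(b, w)\<in>du i x (y x + z). norm w \<le> \<theta> x + c)"
          using \<theta>(2)
        proof eventually_elim
          case (elim x)
          show ?case using elim B(2)[of x] order.trans unfolding y_def by blast
        qed
      qed
    qed
    note Q = this
    \<comment> \<open>The index set \<open>A\<close> contains 0, so this covers the objective
      too.\<close>
    have active: "\<forall>\<^sub>F n in sequentially. functional \<Omega> (f i) (?u n) < functional \<Omega> (f i) us" if "i \<in> A" for i
    proof -
      have i: "i \<in> {0..l}" using that A(3) by auto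
      obtain Q where Q: "integrable ?M (\<lambda>x. Q x * norm (\<eta> x))" "AE x in ?M. \<forall>z. norm z \<le> norm (\<eta> x) \<longrightarrow>
        (\<forall>(a, v)\<in>dl i x (y x + z). norm v \<le> Q x) \<and> (\<forall>(b, w)\<in>du i x (y x + z). norm w \<le> Q x)" using Q[OF i] by blast
      have "(LINT x|?M. support_fun (zero_slice (dl i x (y x))) (\<eta> x) + W i x \<bullet> \<eta> x) = (LINT x|?M. support_fun (S i x) (\<eta> x))"
        by (rule integral_cong_AE[OF m_slice[OF i m\<eta>] S_meas[OF i m\<eta>]]) (use S_supp[OF i, of \<eta>] in eventually_elim, simp)
      then have "(LINT x|?M. support_fun (zero_slice (dl i x (y x))) (\<eta> x) + W i x \<bullet> \<eta> x) < 0" using neg[OF that] by simp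
      from C.integral_directional_upper[OF mf[OF i] cf[OF i] cod[OF i] mdl[OF i] hdl[OF i] my m\<eta> mW[OF i] W[OF i] Q(2,1) f_int[OF i] this]
      show ?thesis unfolding fun_u[OF i] fun_us .
    qed
    \<comment> \<open>An active constraint decreases from 0; any other keeps its negative sign,
      since its functional changes by at most a multiple of the step \<open>?t n\<close>.\<close>
    have inactive: "\<forall>\<^sub>F n in sequentially. functional \<Omega> (f i) (?u n) \<le> 0" if i: "i \<in> {1..l}" for i
    proof (cases "i \<in> act")
      case True
      then have "\<forall>\<^sub>F n in sequentially. functional \<Omega> (f i) (?u n) < functional \<Omega> (f i) us" by (intro active) (simp add: A_def)
      then show ?thesis by eventually_elim (use True in \<open>simp add: act_def\<close>)
    next
      case False
      then have neg0: "functional \<Omega> (f i) us < 0" using le0[OF i] i by (auto simp: act_def)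
      have i': "i \<in> {0..l}" using i by auto
      obtain Q where Q: "integrable ?M (\<lambda>x. Q x * norm (\<eta> x))" "AE x in ?M. \<forall>z. norm z \<le> norm (\<eta> x) \<longrightarrow>
        (\<forall>(a, v)\<in>dl i x (y x + z). norm v \<le> Q x) \<and> (\<forall>(b, w)\<in>du i x (y x + z). norm w \<le> Q x)" using Q[OF i'] by blast
      have lim: "(\<lambda>n. ?t n * (LINT x|?M. 2 * (Q x * norm (\<eta> x)))) \<longlonglongrightarrow> 0"
        by (rule tendsto_mult_left_zero[OF LIMSEQ_inverse_real_of_nat])
      have "0 < - functional \<Omega> (f i) us" using neg0 by linarith
      from order_tendstoD(2)[OF lim this]
      have "\<forall>\<^sub>F n in sequentially. ?t n * (LINT x|?M. 2 * (Q x * norm (\<eta> x))) < - functional \<Omega> (f i) us" .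
      then show ?thesis
      proof eventually_elim
        case (elim n)
        have "\<bar>functional \<Omega> (f i) (?u n) - functional \<Omega> (f i) us\<bar> \<le> ?t n * (LINT x|?M. 2 * (Q x * norm (\<eta> x)))"
          unfolding fun_u[OF i'] fun_us
          by (rule C.integral_increment_bound[OF mf[OF i'] cf[OF i'] cod[OF i'] my m\<eta> Q(2,1) f_int[OF i']]) (auto simp: inverse_le_1_iff)
        with elim show ?case by linarith
      qed
    qed
    have small: "\<forall>\<^sub>F n in sequentially. sobolev_norm p \<Omega> (\<lambda>x. ?u n x - us x) < r"
    proof -
      have "(\<lambda>n. ?t n * sobolev_norm p \<Omega> h) \<longlonglongrightarrow> 0" by (rule tendsto_mult_left_zero[OF LIMSEQ_inverse_real_of_nat])
      then have "\<forall>\<^sub>F n in sequentially. ?t n * sobolev_norm p \<Omega> h < r" using r(1) by (rule order_tendstoD(2))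
      then show ?thesis
        by eventually_elim (simp add: sobolev_norm_scaleR_test_function[OF \<Omega> h _ p] del: of_nat_Suc)
    qed
    have "\<forall>\<^sub>F n in sequentially. \<forall>i\<in>{1..l}. functional \<Omega> (f i) (?u n) \<le> 0"
      using inactive by (intro eventually_ball_finite) auto
    moreover have "\<forall>\<^sub>F n in sequentially. functional \<Omega> (f 0) (?u n) < functional \<Omega> (f 0) us" by (rule active) (simp add: A_def)
    ultimately have "\<forall>\<^sub>F n in sequentially. False"
      using small
    proof eventually_elim
      case (elim n)
      have "(\<lambda>x. (us x - u0 x) + ?t n *\<^sub>R h x) \<in> sobolev0 p \<Omega>"
        by (rule sobolev0_add_test_function[OF \<Omega> d0 test_functions_scaleR[OF h]])
      then have "(\<lambda>x. ?u n x - u0 x) \<in> sobolev0 p \<Omega>" by (simp add: algebra_simps)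
      then have "?u n \<in> feasible p \<Omega> f l u0" using elim(1) by (simp add: feasible_def)
      from r(2)[OF this elim(3)] elim(2) show False by simp
    qed
    then show False by simp
  qed

  \<comment> \<open>Multipliers and the annihilating density\<close>
  have "\<exists>lam v. (\<forall>i\<in>A. 0 \<le> lam i) \<and> (\<Sum>i\<in>A. lam i) = 1 \<and> v \<in> borel_measurable ?M \<and>
    (AE x in ?M. \<exists>c. (\<forall>i\<in>A. c i \<in> S i x) \<and> v x = (\<Sum>i\<in>A. lam i *\<^sub>R c i)) \<and>
    (\<forall>h\<in>L. (LINT x|?M. v x \<bullet> h x) = 0)" (is ?multipliers)
  proof (rule F.integral_sublinear_system_multipliers[where A = A and \<rho> = \<rho> and S = S and L = L])
    show "(\<lambda>x. support_fun (S i x) (\<eta> x)) \<in> borel_measurable ?M" if "i \<in> A" "\<eta> \<in> borel_measurable ?M" for i \<eta>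
      using that A(3) by (intro S_meas) auto
    fix lam v assume "\<And>i. i \<in> A \<Longrightarrow> 0 \<le> lam i" "(\<Sum>i\<in>A. lam i) = 1" "v \<in> borel_measurable ?M"
      "AE x in ?M. \<exists>c. (\<forall>i\<in>A. c i \<in> S i x) \<and> v x = (\<Sum>i\<in>A. lam i *\<^sub>R c i)"
      "\<And>h. h \<in> L \<Longrightarrow> (LINT x|?M. v x \<bullet> h x) = 0"
    then show ?multipliers by (intro exI[of _ lam] exI[of _ v]) simp
  qed (rule A \<rho>_m \<rho>_nn S L L_sub S_bound no; assumption?)+
  then obtain lam v where lam: "\<And>i. i \<in> A \<Longrightarrow> 0 \<le> lam i" "(\<Sum>i\<in>A. lam i) = 1" and v: "v \<in> borel_measurable ?M"
    "AE x in ?M. \<exists>c. (\<forall>i\<in>A. c i \<in> S i x) \<and> v x = (\<Sum>i\<in>A. lam i *\<^sub>R c i)"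
    "\<And>h. h \<in> L \<Longrightarrow> (LINT x|?M. v x \<bullet> h x) = 0"
    by blast
  have v_bound: "AE x in ?M. norm (v x) \<le> \<rho> x"
    using v(2)
  proof eventually_elim
    case (elim x)
    then obtain c where c: "\<And>i. i \<in> A \<Longrightarrow> c i \<in> S i x" "v x = (\<Sum>i\<in>A. lam i *\<^sub>R c i)" by blast
    have "norm (v x) \<le> (\<Sum>i\<in>A. lam i * \<rho> x)"
      unfolding c(2)
    proof (rule sum_norm_le)
      fix i assume i: "i \<in> A"
      have "norm (c i) \<le> \<rho> x" by (rule S_bound[OF c(1)[OF i]])
      then show "norm (lam i *\<^sub>R c i) \<le> lam i * \<rho> x" using lam(1)[OF i] by (simp add: mult_left_mono)
    qed
    then show ?case using lam(2) by (simp flip: sum_distrib_right)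
  qed
  have good_all: "AE x in ?M. \<forall>i\<in>{0..l}. good i x" using good by (intro AE_finite_allI) auto
  have split: "lam 0 + (\<Sum>i\<in>act. lam i) = 1" using lam(2) A(4,5) by (simp add: A_def)
  have zero: "(LINT x|?M. v x \<bullet> (h x, jacobian h x)) = 0" if "h \<in> test_functions \<Omega>" for h
    using v(3)[of "\<lambda>x. (h x, jacobian h x)"] that by (auto simp: L_def)

  \<comment> \<open>Positivity of the multiplier of the objective\<close>
  have lam0: "0 < lam 0"
  proof (rule ccontr)
    assume "\<not> 0 < lam 0"
    then have l0: "lam 0 = 0" using lam(1)[of 0] by (simp add: A_def)
    have bv: "AE x in ?M. norm (v x) \<le> norm (\<rho> x)" using v_bound by eventually_elim simp
    have D: "(\<lambda>x. snd (v x)) \<in> Lp_div_space ?q \<Omega>" "AE x in ?M. weak_div \<Omega> (\<lambda>x. snd (v x)) x = fst (v x)"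
      by (rule annihilator_in_Lp_div_space[OF \<Omega> q \<rho>_Lp v(1) bv]; erule zero)+
    have "AE x in ?M. (0, weak_div \<Omega> (\<lambda>x. snd (v x)) x, snd (v x)) \<in>
        convex hull (\<Union>i\<in>act. dl i x (y x) + {(0, w1 i x, w2 i x)})"
      using v(2) D(2) good_all
    proof eventually_elim
      case (elim x)
      then obtain c where c: "\<And>i. i \<in> A \<Longrightarrow> c i \<in> S i x" "v x = (\<Sum>i\<in>A. lam i *\<^sub>R c i)" by blast
      \<comment> \<open>Without the objective the active multipliers alone sum to 1, so this is a
        convex combination and its field is one that the hypothesis forbids.\<close>
      have "(\<Sum>i\<in>act. lam i *\<^sub>R (0 :: real, c i)) \<in> convex hull (\<Union>i\<in>act. dl i x (y x) + {(0, w1 i x, w2 i x)})"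
      proof (rule convex_sum[OF A(5) convex_convex_hull])
        show "(\<Sum>i\<in>act. lam i) = 1" using split l0 by simp
        fix i assume i: "i \<in> act"
        then show "0 \<le> lam i" using lam(1) by (simp add: A_def)
        have "W i x = (w1 i x, w2 i x)" "i \<in> {0..l}" using i by (auto simp: W_def act_def)
        then have "(0, c i) \<in> dl i x (y x) + {(0, w1 i x, w2 i x)}"
          using S_mem[of "c i" i x] c(1)[of i] i elim(3) by (auto simp: A_def)
        then show "(0, c i) \<in> convex hull (\<Union>i\<in>act. dl i x (y x) + {(0, w1 i x, w2 i x)})"
          using i by (intro hull_inc) blast
      qed
      also have "(\<Sum>i\<in>act. lam i *\<^sub>R (0 :: real, c i)) = (0, v x)"
        unfolding sum_Pair_zero using c(2) A(4,5) l0 by (simp add: A_def)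
      finally show ?case using elim(2) by simp
    qed
    then show False using assms(8) D(1) unfolding act_def y_def by blast
  qed

  \<comment> \<open>Normalisation and the final inclusion\<close>
  define lam' where "lam' i = (if i \<in> act then lam i / lam 0 else 0)" for i
  \<comment> \<open>Scaling preserves the annihilation of jets and the bound by a multiple of
    \<open>\<rho>\<close>, so the divergence is identified anew for \<open>v'\<close>.\<close>
  define v' where "v' x = v x /\<^sub>R lam 0" for x
  have mv': "v' \<in> borel_measurable ?M" unfolding v'_def using v(1) by measurable
  have bv': "AE x in ?M. norm (v' x) \<le> norm (\<rho> x /\<^sub>R lam 0)"
    using v_bound by eventually_elim (use lam0 in \<open>auto simp: v'_def abs_mult intro!: divide_right_mono mult_left_mono\<close>)
  have zero': "(LINT x|?M. v' x \<bullet> (h x, jacobian h x)) = 0" if "h \<in> test_functions \<Omega>" for h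
    using zero[OF that] by (simp add: v'_def)
  have D: "(\<lambda>x. snd (v' x)) \<in> Lp_div_space ?q \<Omega>" "AE x in ?M. weak_div \<Omega> (\<lambda>x. snd (v' x)) x = fst (v' x)"
    by (rule annihilator_in_Lp_div_space[OF \<Omega> q Lp_space_scaleR[OF \<rho>_Lp] mv' bv']; erule zero')+
  have "AE x in ?M. (0, weak_div \<Omega> (\<lambda>x. snd (v' x)) x, snd (v' x)) \<in>
      (dl 0 x (y x) + {(0, w10 x, w20 x)}) + (\<Sum>i\<in>{1..l}. (*\<^sub>R) (lam' i) ` (dl i x (y x) + {(0, w1 i x, w2 i x)}))"
    using v(2) D(2) good_all
  proof eventually_elim
    case (elim x)
    then obtain c where c: "\<And>i. i \<in> A \<Longrightarrow> c i \<in> S i x" "v x = (\<Sum>i\<in>A. lam i *\<^sub>R c i)" by blast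
    have g: "good i x" if "i \<in> {0..l}" for i using elim(3) that by blast
    \<comment> \<open>Inactive indices have multiplier 0, yet their summand in the Minkowski sum
      still needs an element; any member of \<open>S i x\<close> will do.\<close>
    define e where "e i = (if i \<in> act then c i else SOME c. c \<in> S i x)" for i
    have e: "e i \<in> S i x" if "i \<in> {1..l}" for i
      using c(1)[of i] S(3)[of i x] some_in_eq[of "S i x"] by (auto simp: e_def A_def)
    have "(0, c 0) \<in> dl 0 x (y x) + {(0, w10 x, w20 x)}"
      using S_mem[of "c 0" 0 x] c(1)[of 0] g[of 0] by (simp add: A_def W_def)
    moreover have "(\<Sum>i\<in>{1..l}. lam' i *\<^sub>R (0, e i)) \<in> (\<Sum>i\<in>{1..l}. (*\<^sub>R) (lam' i) ` (dl i x (y x) + {(0, w1 i x, w2 i x)}))"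
    proof (rule sum_in_set_sum)
      fix i assume i: "i \<in> {1..l}"
      then have "(0, e i) \<in> dl i x (y x) + {(0, w1 i x, w2 i x)}"
        using S_mem[OF e[OF i] g] by (simp add: W_def)
      then show "lam' i *\<^sub>R (0, e i) \<in> (*\<^sub>R) (lam' i) ` (dl i x (y x) + {(0, w1 i x, w2 i x)})" by (rule imageI)
    qed simp
    ultimately have mem: "(0, c 0) + (\<Sum>i\<in>{1..l}. lam' i *\<^sub>R (0, e i)) \<in> (dl 0 x (y x) + {(0, w10 x, w20 x)}) +
        (\<Sum>i\<in>{1..l}. (*\<^sub>R) (lam' i) ` (dl i x (y x) + {(0, w1 i x, w2 i x)}))"
      by (rule set_plus_intro)
    have "(\<Sum>i\<in>{1..l}. lam' i *\<^sub>R e i) = (\<Sum>i\<in>act. (lam i / lam 0) *\<^sub>R c i)"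
      by (rule sum.mono_neutral_cong_right) (auto simp: lam'_def e_def act_def)
    also have "\<dots> = (\<Sum>i\<in>act. lam i *\<^sub>R c i) /\<^sub>R lam 0"
      unfolding scaleR_sum_right by (intro sum.cong) (auto simp: divide_inverse mult.commute)
    finally have "c 0 + (\<Sum>i\<in>{1..l}. lam' i *\<^sub>R e i) = v' x"
      using c(2) A(4,5) lam0 by (simp add: v'_def A_def scaleR_add_right)
    then have "(0, c 0) + (\<Sum>i\<in>{1..l}. lam' i *\<^sub>R (0 :: real, e i)) = (0, v' x)"
      unfolding sum_Pair_zero by simp
    then show ?case using mem elim(2) by simp
  qed
  moreover have "\<forall>i\<in>{1..l}. 0 \<le> lam' i \<and> lam' i * functional \<Omega> (f i) us = 0"
    using lam(1) lam0 by (auto simp: lam'_def A_def act_def)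
  ultimately show "\<exists>lam. \<exists>\<zeta>\<in>Lp_div_space ?q \<Omega>.
      (\<forall>i\<in>{1..l}. lam i \<ge> 0 \<and> lam i * functional \<Omega> (f i) us = 0) \<and>
      (AE x in ?M. (0, weak_div \<Omega> \<zeta> x, \<zeta> x) \<in>
        (dl 0 x (us x, weak_grad \<Omega> us x) + {(0, w10 x, w20 x)})
        + (\<Sum>i\<in>{1..l}. (*\<^sub>R) (lam i) ` (dl i x (us x, weak_grad \<Omega> us x) + {(0, w1 i x, w2 i x)})))"
    unfolding y_def[symmetric] by (intro exI[of _ lam'] bexI[OF _ D(1)] conjI)
qed

end
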